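(* With $f_m(b)$, $T$, $t$, $V_m$, $Y_m$ as defined in the context, the following identities hold. $m=0$: \begin{align*} f_0(1)&=-\tfrac{9}{22}V_0t^{-1}-\tfrac{61}{22}V_0-\tfrac{95}{22}V_0t-\tfrac{49}{22}V_0T+\tfrac{48}{11}V_0Tt-\tfrac{95}{22}V_0Tt^2+\tfrac{9}{22}Y_0,\\ f_0(2)&=-\tfrac{7}{22}V_0t^{-1}+\tfrac{87}{22}V_0-\tfrac{47}{22}V_0t-\tfrac{65}{22}V_0T-\tfrac{3}{11}V_0Tt-\tfrac{47}{22}V_0Tt^2+\tfrac{7}{22}Y_0,\\ f_0(3)&=-\tfrac{5}{22}V_0t^{-1}-\tfrac{249}{22}V_0+\tfrac{1}{22}V_0t+\tfrac{161}{22}V_0T-\tfrac{54}{11}V_0Tt+\tfrac{1}{22}V_0Tt^2+\tfrac{5}{22}Y_0,\\ f_0(4)&=-\tfrac{3}{22}V_0t^{-1}+\tfrac{141}{22}V_0+\tfrac{49}{22}V_0t-\tfrac{97}{22}V_0T+\tfrac{16}{11}V_0Tt+\tfrac{49}{22}V_0Tt^2+\tfrac{3}{22}Y_0,\\ f_0(5)&=-\tfrac{1}{22}V_0t^{-1}+\tfrac{47}{22}V_0+\tfrac{97}{22}V_0t-\tfrac{113}{22}V_0T-\tfrac{35}{11}V_0Tt+\tfrac{97}{22}V_0Tt^2+\tfrac{1}{22}Y_0. \end{align*} $m=1$: \begin{align*} f_1(1)&=-\tfrac{46}{11}V_1-\tfrac{42}{11}V_1t+\tfrac{4}{11}V_1t^2+\tfrac{36}{11}V_1T-\tfrac{71}{11}V_1Tt-\tfrac{145}{11}V_1Tt^2-3V_1Tt^3-\tfrac{1}{11}Y_1,\\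 f_1(2)&=-\tfrac{4}{11}V_1-\tfrac{223}{22}V_1t-\tfrac{215}{22}V_1t^2+\tfrac{1}{22}V_1T+\tfrac{78}{11}V_1Tt+\tfrac{40}{11}V_1Tt^2-6V_1Tt^3+\tfrac{7}{22}Y_1,\\ f_1(3)&=\tfrac{49}{11}V_1+\tfrac{221}{22}V_1t+\tfrac{123}{22}V_1t^2-\tfrac{103}{22}V_1T-\tfrac{48}{11}V_1Tt-\tfrac{6}{11}V_1Tt^2+2V_1Tt^3+\tfrac{5}{22}Y_1,\\ f_1(4)&=-\tfrac{19}{11}V_1-\tfrac{61}{22}V_1t-\tfrac{23}{22}V_1t^2+\tfrac{35}{22}V_1T-\tfrac{53}{11}V_1Tt-\tfrac{52}{11}V_1Tt^2-V_1Tt^3+\tfrac{3}{22}Y_1,\\ f_1(5)&=-\tfrac{87}{11}V_1-\tfrac{101}{22}V_1t+\tfrac{73}{22}V_1t^2+\tfrac{173}{22}V_1T+\tfrac{63}{11}V_1Tt+\tfrac{23}{11}V_1Tt^2+7V_1Tt^3+\tfrac{1}{22}Y_1. \end{align*} $m=2$: \begin{align*} f_2(1)&=\tfrac{2}{11}V_2t^{-1}-\tfrac{17}{11}V_2+\tfrac{15}{11}V_2t+\tfrac{39}{11}V_2T-\tfrac{58}{11}V_2Tt+\tfrac{4}{11}V_2Tt^2-\tfrac{2}{11}Y_2,\\ f_2(2)&=-\tfrac{47}{22}V_2t^{-1}-\tfrac{145}{22}V_2-\tfrac{171}{22}V_2t-\tfrac{9}{22}V_2T+\tfrac{16}{11}V_2Tt+\tfrac{27}{22}V_2Tt^2+\tfrac{3}{22}Y_2,\\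 f_2(3)&=-\tfrac{5}{11}V_2t^{-1}-\tfrac{18}{11}V_2+\tfrac{23}{11}V_2t-\tfrac{37}{11}V_2T+\tfrac{24}{11}V_2Tt-\tfrac{10}{11}V_2Tt^2+\tfrac{5}{11}Y_2,\\ f_2(4)&=-\tfrac{3}{11}V_2t^{-1}+\tfrac{86}{11}V_2+\tfrac{38}{11}V_2t+\tfrac{2}{11}V_2T-\tfrac{34}{11}V_2Tt-\tfrac{6}{11}V_2Tt^2+\tfrac{3}{11}Y_2,\\ f_2(5)&=-\tfrac{1}{11}V_2t^{-1}-\tfrac{173}{11}V_2-\tfrac{68}{11}V_2t+\tfrac{41}{11}V_2T+\tfrac{29}{11}V_2Tt-\tfrac{2}{11}V_2Tt^2+\tfrac{1}{11}Y_2. \end{align*} $m=3$: \begin{align*} f_3(1)&=\tfrac{5}{11}V_3t^{-1}-\tfrac{153}{22}V_3-\tfrac{53}{22}V_3t-\tfrac{15}{22}V_3Tt^{-1}+\tfrac{73}{11}V_3T+\tfrac{60}{11}V_3Tt+\tfrac{5}{22}Y_3,\\ f_3(2)&=-\tfrac{1}{11}V_3t^{-1}+\tfrac{79}{22}V_3+\tfrac{59}{22}V_3t+\tfrac{3}{22}V_3Tt^{-1}-\tfrac{63}{11}V_3T-\tfrac{12}{11}V_3Tt-\tfrac{1}{22}Y_3,\\ f_3(3)&=-\tfrac{51}{11}V_3t^{-1}+\tfrac{18}{11}V_3-\tfrac{8}{11}V_3t+\tfrac{16}{11}V_3Tt^{-1}-\tfrac{67}{11}V_3T-\tfrac{7}{11}V_3Tt+\tfrac{2}{11}Y_3,\\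 f_3(4)&=\tfrac{9}{11}V_3t^{-1}-\tfrac{227}{22}V_3-\tfrac{47}{22}V_3t-\tfrac{27}{22}V_3Tt^{-1}+\tfrac{83}{11}V_3T-\tfrac{13}{11}V_3Tt+\tfrac{9}{22}Y_3,\\ f_3(5)&=\tfrac{3}{11}V_3t^{-1}+\tfrac{247}{22}V_3+\tfrac{65}{22}V_3t-\tfrac{9}{22}V_3Tt^{-1}-\tfrac{53}{11}V_3T-\tfrac{85}{11}V_3Tt+\tfrac{3}{22}Y_3. \end{align*} $m=4$: \begin{align*} f_4(1)&=\tfrac{122}{11}V_4t^{-1}+\tfrac{405}{22}V_4+\tfrac{161}{22}V_4t-\tfrac{245}{22}V_4Tt^{-1}-\tfrac{135}{11}V_4T-\tfrac{10}{11}V_4Tt+\tfrac{1}{22}Y_4,\\ f_4(2)&=-\tfrac{75}{11}V_4t^{-1}-\tfrac{123}{11}V_4-\tfrac{48}{11}V_4t+\tfrac{52}{11}V_4Tt^{-1}+\tfrac{82}{11}V_4T+\tfrac{24}{11}V_4Tt+\tfrac{1}{11}Y_4,\\ f_4(3)&=\tfrac{3}{11}V_4t^{-1}+\tfrac{5}{22}V_4-\tfrac{1}{22}V_4t-\tfrac{9}{22}V_4Tt^{-1}-\tfrac{42}{11}V_4T-\tfrac{30}{11}V_4Tt+\tfrac{3}{22}Y_4,\\ f_4(4)&=-\tfrac{29}{11}V_4t^{-1}-\tfrac{4}{11}V_4+\tfrac{25}{11}V_4t-\tfrac{17}{11}V_4Tt^{-1}-\tfrac{78}{11}V_4T-\tfrac{73}{11}V_4Tt+\tfrac{2}{11}Y_4,\\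 f_4(5)&=\tfrac{5}{11}V_4t^{-1}-\tfrac{153}{22}V_4-\tfrac{163}{22}V_4t-\tfrac{15}{22}V_4Tt^{-1}+\tfrac{51}{11}V_4T+\tfrac{71}{11}V_4Tt+\tfrac{5}{22}Y_4. \end{align*} $m=5$: \begin{align*} f_5(1)&=-\tfrac{15}{11}V_5+\tfrac{103}{11}V_5t+9V_5t^2+\tfrac{16}{11}V_5t^3-7V_5Tt-\tfrac{91}{11}V_5Tt^2-\tfrac{16}{11}V_5Tt^3+\tfrac{4}{11}Y_5,\\ f_5(2)&=-\tfrac{5}{22}V_5-\tfrac{369}{22}V_5t-15V_5t^2-\tfrac{35}{22}V_5t^3+8V_5Tt+\tfrac{126}{11}V_5Tt^2+\tfrac{35}{22}V_5Tt^3+\tfrac{5}{22}Y_5,\\ f_5(3)&=-\tfrac{34}{11}V_5+\tfrac{56}{11}V_5t+5V_5t^2+\tfrac{4}{11}V_5t^3+V_5Tt-\tfrac{53}{11}V_5Tt^2-\tfrac{4}{11}V_5Tt^3+\tfrac{1}{11}Y_5,\\ f_5(4)&=\tfrac{1}{22}V_5-\tfrac{23}{22}V_5t+3V_5t^2+\tfrac{7}{22}V_5t^3-6V_5Tt-\tfrac{1}{11}V_5Tt^2-\tfrac{7}{22}V_5Tt^3-\tfrac{1}{22}Y_5,\\ f_5(5)&=-\tfrac{53}{11}V_5+\tfrac{9}{11}V_5t+V_5t^2-\tfrac{8}{11}V_5t^3-2V_5Tt-\tfrac{15}{11}V_5Tt^2+\tfrac{8}{11}V_5Tt^3-\tfrac{2}{11}Y_5.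 \end{align*} $m=6$: \begin{align*} f_6(1)&=-10V_6-19V_6t-6V_6t^2+9V_6T+6V_6Tt+6V_6Tt^2,\\ f_6(2)&=2V_6+17V_6t+10V_6t^2-4V_6T-10V_6Tt-10V_6Tt^2,\\ f_6(3)&=3V_6-13V_6t-7V_6t^2-6V_6T+7V_6Tt+7V_6Tt^2,\\ f_6(4)&=-7V_6+V_6t-2V_6t^2+3V_6T+2V_6Tt+2V_6Tt^2,\\ f_6(5)&=5V_6+4V_6t+3V_6t^2+V_6T-3V_6Tt-3V_6Tt^2. \end{align*} $m=7$: \begin{align*} f_7(1)&=\tfrac{141}{22}V_7t^{-1}+\tfrac{56}{11}V_7+\tfrac{197}{22}V_7t+\tfrac{21}{22}V_7t^2-\tfrac{141}{22}V_7Tt^{-1}-\tfrac{9}{11}V_7T-8V_7Tt-\tfrac{21}{22}V_7Tt^2+\tfrac{3}{22}Y_7,\\ f_7(2)&=-\tfrac{46}{11}V_7t^{-1}-\tfrac{64}{11}V_7-\tfrac{78}{11}V_7t-\tfrac{12}{11}V_7t^2+\tfrac{46}{11}V_7Tt^{-1}-\tfrac{7}{11}V_7T+6V_7Tt+\tfrac{12}{11}V_7Tt^2+\tfrac{3}{11}Y_7,\\ f_7(3)&=-\tfrac{25}{11}V_7t^{-1}-\tfrac{19}{11}V_7+\tfrac{26}{11}V_7t+\tfrac{4}{11}V_7t^2+\tfrac{25}{11}V_7Tt^{-1}-\tfrac{38}{11}V_7T-2V_7Tt-\tfrac{4}{11}V_7Tt^2-\tfrac{1}{11}Y_7,\\ f_7(4)&=\tfrac{47}{22}V_7t^{-1}+\tfrac{59}{11}V_7-\tfrac{15}{22}V_7t+\tfrac{7}{22}V_7t^2-\tfrac{47}{22}V_7Tt^{-1}-\tfrac{3}{11}V_7T+V_7Tt-\tfrac{7}{22}V_7Tt^2+\tfrac{1}{22}Y_7,\\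 f_7(5)&=\tfrac{50}{11}V_7t^{-1}-\tfrac{83}{11}V_7-\tfrac{52}{11}V_7t-\tfrac{8}{11}V_7t^2-\tfrac{50}{11}V_7Tt^{-1}+\tfrac{76}{11}V_7T+4V_7Tt+\tfrac{8}{11}V_7Tt^2+\tfrac{2}{11}Y_7. \end{align*} $m=8$: \begin{align*} f_8(1)&=-2V_8t^{-1}-\tfrac{21}{22}V_8+\tfrac{107}{22}V_8t+\tfrac{79}{22}V_8t^2-\tfrac{107}{22}V_8Tt+\tfrac{2}{11}V_8Tt^2+\tfrac{79}{22}V_8Tt^3-\tfrac{1}{22}Y_8,\\ f_8(2)&=-4V_8t^{-1}-\tfrac{120}{11}V_8-\tfrac{80}{11}V_8t+\tfrac{2}{11}V_8t^2-\tfrac{41}{11}V_8Tt-\tfrac{29}{11}V_8Tt^2+\tfrac{2}{11}V_8Tt^3-\tfrac{1}{11}Y_8,\\ f_8(3)&=5V_8t^{-1}+\tfrac{179}{22}V_8+\tfrac{79}{22}V_8t-\tfrac{5}{22}V_8t^2+\tfrac{163}{22}V_8Tt+\tfrac{6}{11}V_8Tt^2-\tfrac{5}{22}V_8Tt^3-\tfrac{3}{22}Y_8,\\ f_8(4)&=-8V_8t^{-1}-\tfrac{95}{22}V_8-\tfrac{23}{22}V_8t-\tfrac{69}{22}V_8t^2-\tfrac{219}{22}V_8Tt-\tfrac{14}{11}V_8Tt^2-\tfrac{69}{22}V_8Tt^3+\tfrac{7}{22}Y_8,\\ f_8(5)&=V_8t^{-1}-\tfrac{124}{11}V_8-\tfrac{123}{11}V_8t-\tfrac{6}{11}V_8t^2+\tfrac{2}{11}V_8Tt-\tfrac{34}{11}V_8Tt^2-\tfrac{6}{11}V_8Tt^3+\tfrac{3}{11}Y_8.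 \end{align*} $m=9$: \begin{align*} f_9(1)&=\tfrac{15}{22}V_9t^{-2}+\tfrac{4}{11}V_9t^{-1}-\tfrac{5}{11}V_9-\tfrac{15}{22}V_9Tt^{-2}+\tfrac{7}{22}V_9Tt^{-1}-\tfrac{29}{11}V_9T-\tfrac{1}{22}V_9Tt-\tfrac{5}{22}Y_9,\\ f_9(2)&=-\tfrac{3}{22}V_9t^{-2}-\tfrac{25}{11}V_9t^{-1}+\tfrac{1}{11}V_9+\tfrac{3}{22}V_9Tt^{-2}+\tfrac{47}{22}V_9Tt^{-1}+\tfrac{30}{11}V_9T+\tfrac{97}{22}V_9Tt+\tfrac{1}{22}Y_9,\\ f_9(3)&=-\tfrac{21}{22}V_9t^{-2}+\tfrac{67}{11}V_9t^{-1}+\tfrac{7}{11}V_9+\tfrac{21}{22}V_9Tt^{-2}-\tfrac{155}{22}V_9Tt^{-1}-\tfrac{32}{11}V_9T-\tfrac{47}{22}V_9Tt+\tfrac{7}{22}Y_9,\\ f_9(4)&=\tfrac{8}{11}V_9t^{-2}-\tfrac{28}{11}V_9t^{-1}+\tfrac{35}{11}V_9-\tfrac{8}{11}V_9Tt^{-2}+\tfrac{36}{11}V_9Tt^{-1}-\tfrac{39}{11}V_9T-\tfrac{57}{11}V_9Tt+\tfrac{1}{11}Y_9,\\ f_9(5)&=\tfrac{9}{22}V_9t^{-2}-\tfrac{46}{11}V_9t^{-1}-\tfrac{124}{11}V_9-\tfrac{9}{22}V_9Tt^{-2}+\tfrac{101}{22}V_9Tt^{-1}+\tfrac{31}{11}V_9T-\tfrac{49}{22}V_9Tt-\tfrac{3}{22}Y_9.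 \end{align*} $m=10$: \begin{align*} f_{10}(1)&=\tfrac{75}{11}V_{10}+\tfrac{39}{11}V_{10}t-\tfrac{4}{11}V_{10}t^2+\tfrac{16}{11}V_{10}Tt+\tfrac{14}{11}V_{10}Tt^2-\tfrac{4}{11}V_{10}Tt^3+\tfrac{2}{11}Y_{10},\\ f_{10}(2)&=-\tfrac{92}{11}V_{10}-\tfrac{43}{11}V_{10}t-\tfrac{8}{11}V_{10}t^2+\tfrac{32}{11}V_{10}Tt+\tfrac{28}{11}V_{10}Tt^2-\tfrac{8}{11}V_{10}Tt^3+\tfrac{4}{11}Y_{10},\\ f_{10}(3)&=\tfrac{43}{22}V_{10}+\tfrac{3}{22}V_{10}t+\tfrac{9}{22}V_{10}t^2-\tfrac{157}{22}V_{10}Tt-\tfrac{46}{11}V_{10}Tt^2+\tfrac{9}{22}V_{10}Tt^3+\tfrac{1}{22}Y_{10},\\ f_{10}(4)&=-\tfrac{52}{11}V_{10}+\tfrac{2}{11}V_{10}t+\tfrac{6}{11}V_{10}t^2-\tfrac{24}{11}V_{10}Tt-\tfrac{21}{11}V_{10}Tt^2+\tfrac{6}{11}V_{10}Tt^3-\tfrac{3}{11}Y_{10},\\ f_{10}(5)&=\tfrac{23}{11}V_{10}-\tfrac{80}{11}V_{10}t+\tfrac{2}{11}V_{10}t^2+\tfrac{113}{11}V_{10}Tt-\tfrac{7}{11}V_{10}Tt^2+\tfrac{2}{11}V_{10}Tt^3-\tfrac{1}{11}Y_{10}. \end{align*}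
   Context: For a partition $\pi$ let $\omega(\pi)$ denote the number of ones in $\pi$. The crank of $\pi$ is the largest part of $\pi$ if $\omega(\pi)=0$; otherwise it is (the number of parts of $\pi$ larger than $\omega(\pi)$) minus $\omega(\pi)$. For integers $r$, $m\ge 1$, $n\ge 0$, $M_{\omega}(r,m,n)=\sum \omega(\pi)$, the sum being over all partitions $\pi$ of $n$ whose crank is congruent to $r$ modulo $m$. For $0\le m\le 10$ and $1\le b\le 5$ put $$f_m(b)=\sum_{n=0}^{\infty}\left(M_{\omega}(b,11,11n+m)-M_{\omega}(11-b,11,11n+m)\right)q^n ,$$ so that the functions $f_m(b)$, $0\le m\le 10$, are the components of the 11-dissection $\sum_{n\ge0}(M_\omega(b,11,n)-M_\omega(11-b,11,n))q^n=\sum_{m=0}^{10}q^mf_m(b)|_{q\to q^{11}}$. For $|q|<1$ put $(x;q)_\infty=\prod_{k\ge0}(1-xq^k)$, $(x_1,\dots,x_m;q)_\infty=\prod_i(x_i;q)_\infty$, $J_{a,b}=(q^a,q^{b-a},q^b;q^b)_\infty$, $J_a=(q^a;q^a)_\infty$. Define $$T=\frac{J_{2,11}^2J_{5,11}}{J_{1,11}J_{4,11}^2},\qquad t=\frac{qJ_{1,11}J_{4,11}}{J_{5,11}^2},$$ \begin{align*} &V_0=\frac{qJ_{4,11}J_{11}^5}{J_{2,11}^2J_{3,11}},\quad V_1=\frac{J_{5,11}^2J_{11}^5}{J_{2,11}^4},\quad V_2=\frac{qJ_{11}^5}{J_{2,11}^2},\quad V_3=\frac{qJ_{4,11}J_{11}^5}{J_{2,11}^2J_{5,11}},\\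 &V_4=\frac{qJ_{1,11}J_{3,11}J_{4,11}J_{11}^5}{J_{2,11}^4J_{5,11}},\quad V_5=\frac{J_{3,11}J_{5,11}J_{11}^5}{J_{1,11}J_{2,11}^2J_{4,11}},\quad V_6=\frac{J_{3,11}J_{11}^5}{J_{1,11}J_{2,11}^2},\\ &V_7=\frac{J_{3,11}J_{4,11}J_{11}^5}{J_{1,11}J_{2,11}^2J_{5,11}},\quad V_8=\frac{qJ_{1,11}J_{5,11}J_{11}^5}{J_{2,11}^2J_{3,11}J_{4,11}},\quad V_9=\frac{J_{4,11}^2J_{11}^5}{J_{2,11}^3J_{5,11}},\quad V_{10}=\frac{J_{5,11}J_{11}^5}{J_{2,11}^2J_{3,11}}, \end{align*} \begin{align*} &Y_0=\frac{J_{11}^2}{J_{1,11}},\quad Y_1=\frac{J_{5,11}J_{11}^2}{J_{2,11}J_{3,11}},\quad Y_2=\frac{J_{3,11}J_{11}^2}{J_{1,11}J_{4,11}},\quad Y_3=\frac{J_{2,11}J_{11}^2}{J_{1,11}J_{3,11}},\quad Y_4=\frac{J_{11}^2}{J_{2,11}},\\ &Y_5=\frac{J_{4,11}J_{11}^2}{J_{2,11}J_{5,11}},\quad Y_7=\frac{J_{11}^2}{J_{3,11}},\quad Y_8=\frac{qJ_{1,11}J_{11}^2}{J_{4,11}J_{5,11}},\quad Y_9=\frac{J_{11}^2}{J_{4,11}},\quad Y_{10}=\frac{J_{11}^2}{J_{5,11}}. \end{align*} The identities are equalities of functions of $q$ for $0<|q|<1$ (equivalently of Laurent series in $q$). *)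

theory Defs
  imports
    "HOL-Analysis.Analysis"
    "HOL-Library.Multiset"
    "HOL-Number_Theory.Cong"
begin

definition partitions_of :: "nat \<Rightarrow> nat multiset set" where
  "partitions_of n = {p. (\<forall>x \<in># p. 0 < x) \<and> sum_mset p = n}"

definition ones :: "nat multiset \<Rightarrow> nat" where
  "ones p = count p 1"

text \<open>The largest part of the empty partition is taken to be 0; this choice does not affect
  \<open>M_omega\<close>, in which partitions without ones have weight 0.\<close>

definition largest_part :: "nat multiset \<Rightarrow> nat" where
  "largest_part p = Max (insert 0 (set_mset p))"

definition crank :: "nat multiset \<Rightarrow> int" where
  "crank p = (if ones p = 0 then int (largest_part p)
              else int (size (filter_mset (\<lambda>x. ones p < x) p)) - int (ones p))"

definition M_omega :: "int \<Rightarrow> int \<Rightarrow> nat \<Rightarrow> nat" where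
  "M_omega r m n = (\<Sum>p | p \<in> partitions_of n \<and> [crank p = r] (mod m). ones p)"

definition f_comp :: "nat \<Rightarrow> int \<Rightarrow> complex \<Rightarrow> complex" where
  "f_comp m b q =
     (\<Sum>n. (of_nat (M_omega b 11 (11 * n + m)) - of_nat (M_omega (11 - b) 11 (11 * n + m))) * q ^ n)"

definition qpoch_inf :: "complex \<Rightarrow> complex \<Rightarrow> complex" where
  "qpoch_inf x q = (\<Prod>k. 1 - x * q ^ k)"

text \<open>\<open>theta_J a b\<close> is $J_{a,b}$ and \<open>eta_J a\<close> is $J_a$. The natural number subtraction
  \<open>b - a\<close> is only meaningful for \<open>a \<le> b\<close>.\<close>

definition theta_J :: "nat \<Rightarrow> nat \<Rightarrow> complex \<Rightarrow> complex" where
  "theta_J a b q =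
     qpoch_inf (q ^ a) (q ^ b) * qpoch_inf (q ^ (b - a)) (q ^ b) * qpoch_inf (q ^ b) (q ^ b)"

definition eta_J :: "nat \<Rightarrow> complex \<Rightarrow> complex" where
  "eta_J a q = qpoch_inf (q ^ a) (q ^ a)"

definition T_fun :: "complex \<Rightarrow> complex" where
  "T_fun q = theta_J 2 11 q ^ 2 * theta_J 5 11 q / (theta_J 1 11 q * theta_J 4 11 q ^ 2)"

definition t_fun :: "complex \<Rightarrow> complex" where
  "t_fun q = q * theta_J 1 11 q * theta_J 4 11 q / theta_J 5 11 q ^ 2"

definition V0 :: "complex \<Rightarrow> complex" where
  "V0 q = q * theta_J 4 11 q * eta_J 11 q ^ 5 / (theta_J 2 11 q ^ 2 * theta_J 3 11 q)"

definition V1 :: "complex \<Rightarrow> complex" where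
  "V1 q = theta_J 5 11 q ^ 2 * eta_J 11 q ^ 5 / theta_J 2 11 q ^ 4"

definition V2 :: "complex \<Rightarrow> complex" where
  "V2 q = q * eta_J 11 q ^ 5 / theta_J 2 11 q ^ 2"

definition V3 :: "complex \<Rightarrow> complex" where
  "V3 q = q * theta_J 4 11 q * eta_J 11 q ^ 5 / (theta_J 2 11 q ^ 2 * theta_J 5 11 q)"

definition V4 :: "complex \<Rightarrow> complex" where
  "V4 q = q * theta_J 1 11 q * theta_J 3 11 q * theta_J 4 11 q * eta_J 11 q ^ 5 / (theta_J 2 11 q ^ 4 * theta_J 5 11 q)"

definition V5 :: "complex \<Rightarrow> complex" where
  "V5 q = theta_J 3 11 q * theta_J 5 11 q * eta_J 11 q ^ 5 / (theta_J 1 11 q * theta_J 2 11 q ^ 2 * theta_J 4 11 q)"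

definition V6 :: "complex \<Rightarrow> complex" where
  "V6 q = theta_J 3 11 q * eta_J 11 q ^ 5 / (theta_J 1 11 q * theta_J 2 11 q ^ 2)"

definition V7 :: "complex \<Rightarrow> complex" where
  "V7 q = theta_J 3 11 q * theta_J 4 11 q * eta_J 11 q ^ 5 / (theta_J 1 11 q * theta_J 2 11 q ^ 2 * theta_J 5 11 q)"

definition V8 :: "complex \<Rightarrow> complex" where
  "V8 q = q * theta_J 1 11 q * theta_J 5 11 q * eta_J 11 q ^ 5 / (theta_J 2 11 q ^ 2 * theta_J 3 11 q * theta_J 4 11 q)"

definition V9 :: "complex \<Rightarrow> complex" where
  "V9 q = theta_J 4 11 q ^ 2 * eta_J 11 q ^ 5 / (theta_J 2 11 q ^ 3 * theta_J 5 11 q)"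

definition V10 :: "complex \<Rightarrow> complex" where
  "V10 q = theta_J 5 11 q * eta_J 11 q ^ 5 / (theta_J 2 11 q ^ 2 * theta_J 3 11 q)"

definition Y0 :: "complex \<Rightarrow> complex" where
  "Y0 q = eta_J 11 q ^ 2 / theta_J 1 11 q"

definition Y1 :: "complex \<Rightarrow> complex" where
  "Y1 q = theta_J 5 11 q * eta_J 11 q ^ 2 / (theta_J 2 11 q * theta_J 3 11 q)"

definition Y2 :: "complex \<Rightarrow> complex" where
  "Y2 q = theta_J 3 11 q * eta_J 11 q ^ 2 / (theta_J 1 11 q * theta_J 4 11 q)"

definition Y3 :: "complex \<Rightarrow> complex" where
  "Y3 q = theta_J 2 11 q * eta_J 11 q ^ 2 / (theta_J 1 11 q * theta_J 3 11 q)"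

definition Y4 :: "complex \<Rightarrow> complex" where
  "Y4 q = eta_J 11 q ^ 2 / theta_J 2 11 q"

definition Y5 :: "complex \<Rightarrow> complex" where
  "Y5 q = theta_J 4 11 q * eta_J 11 q ^ 2 / (theta_J 2 11 q * theta_J 5 11 q)"

definition Y7 :: "complex \<Rightarrow> complex" where
  "Y7 q = eta_J 11 q ^ 2 / theta_J 3 11 q"

definition Y8 :: "complex \<Rightarrow> complex" where
  "Y8 q = q * theta_J 1 11 q * eta_J 11 q ^ 2 / (theta_J 4 11 q * theta_J 5 11 q)"

definition Y9 :: "complex \<Rightarrow> complex" where
  "Y9 q = eta_J 11 q ^ 2 / theta_J 4 11 q"

definition Y10 :: "complex \<Rightarrow> complex" where
  "Y10 q = eta_J 11 q ^ 2 / theta_J 5 11 q"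

end

(*
  Weight the crank generating function by the number of ones, at an eleventh root of unity z: its
  antisymmetrisation A(z) under z -> 1/z satisfies
    A(z) theta(z)^2 = (q)^2 ((1 - z) z theta'(z) + z theta(z)).
  Both theta(z) and (q) split into residue classes modulo 11 by the triple and the quintuple product,
  with coefficients built from J_1, ..., J_5 at q^11 and their logarithmic derivatives.
  Three-term theta relations parametrise the J_a by the curve (T - 1)(1 + t^2 T) = t, and their
  derivatives express the logarithmic derivatives as a common monomial times polynomials in t and T.
  The claimed formula for A(z) then becomes a finite list of polynomial identities modulo the curve
  and 1 + z + ... + z^10 = 0, which are checked by rewriting with integer coefficient lists.
  Letting q and z run through all eleventh roots of q^11 and of unity isolates the components f_m(b).
*)

theory Submission
  imports Defs
begin

section \<open>q-Pochhammer symbols\<close>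

text \<open>The denominator theta(z)^2 is never inverted. Put C = (1 - z) (q)^2 / theta(z), the
  crank product (q) / ((zq) (q/z)) in the notation (x) = (x; q)_infinity. Centring the summation
  index of theta gives 22 z theta'(z) = 11 theta(z) - z^6 N, where N is built from J_a (22 L_a - (11
  - 2a)) and L_a is the logarithmic derivative belonging to J_a. Hence 22 A = 11 (1 + z) / (1 - z) C
  - z^6 C N / theta(z): the first summand yields the Y_m, the second the V_m, and 22 is the common
  denominator of the statement. What remains are three bilinear identities, C theta = (1 - z) (q)^2,
  (1 - z) Y = 11 (1 + z) C and theta V = - z^6 C N. The L_a themselves are not theta quotients.
  Differentiated three-term relations only control linear combinations of them. Four such relations
  have no constant term; a fifth, in which one argument leaves the fundamental range, brings in a
  constant 1. Together they determine exactly the shifted values 22 L_a - (11 - 2a) that occur in N.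
  Residue class 6 of C is empty, which is why there is no Y_6.\<close>

definition qpoch_fin :: "complex \<Rightarrow> complex \<Rightarrow> nat \<Rightarrow> complex" where
  "qpoch_fin x q n = (\<Prod>k<n. 1 - x * q ^ k)"

lemma qpoch_fin_0 [simp]: "qpoch_fin x q 0 = 1"
  by (simp add: qpoch_fin_def)

lemma qpoch_fin_Suc: "qpoch_fin x q (Suc n) = qpoch_fin x q n * (1 - x * q ^ n)"
  by (simp add: qpoch_fin_def)

lemma summable_norm_mult_power:
  fixes x q :: complex
  assumes "norm q < 1"
  shows "summable (\<lambda>k. norm (x * q ^ k))"
  using assms by (simp add: norm_mult norm_power summable_geometric summable_mult)

lemma convergent_prod_qpoch:
  fixes x q :: complex
  assumes "norm q < 1"
  shows "convergent_prod (\<lambda>k. 1 - x * q ^ k)"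
proof -
  have "summable (\<lambda>k. norm (1 - x * q ^ k - 1))"
    using summable_norm_mult_power[OF assms, of x] by (simp add: norm_minus_commute)
  then show ?thesis
    by (intro abs_convergent_prod_imp_convergent_prod) (simp add: abs_convergent_prod_conv_summable)
qed

lemma qpoch_fin_LIMSEQ:
  assumes "norm q < 1"
  shows "qpoch_fin x q \<longlonglongrightarrow> qpoch_inf x q"
proof -
  have "(\<lambda>k. 1 - x * q ^ k) has_prod qpoch_inf x q"
    unfolding qpoch_inf_def by (rule convergent_prod_has_prod[OF convergent_prod_qpoch[OF assms]])
  then show ?thesis
    using has_prod_imp_tendsto'[of "\<lambda>k. 1 - x * q ^ k"] unfolding qpoch_fin_def by blast
qed

lemma qpoch_inf_0_iff:
  assumes "norm q < 1"
  shows "qpoch_inf x q = 0 \<longleftrightarrow> (\<exists>k. x * q ^ k = 1)"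
proof -
  have "(\<lambda>k. 1 - x * q ^ k) has_prod qpoch_inf x q"
    unfolding qpoch_inf_def by (rule convergent_prod_has_prod[OF convergent_prod_qpoch[OF assms]])
  from has_prod_eq_0_iff[OF this] show ?thesis by auto
qed

lemma qpoch_inf_nonzero:
  assumes "norm q < 1" and "norm x < 1"
  shows "qpoch_inf x q \<noteq> 0"
proof
  assume "qpoch_inf x q = 0"
  then obtain k where "x * q ^ k = 1" using qpoch_inf_0_iff[OF assms(1)] by blast
  then have "norm x * norm q ^ k = 1" by (metis norm_mult norm_one norm_power)
  moreover have "norm x * norm q ^ k \<le> norm x * 1"
    using assms by (intro mult_left_mono power_le_one) auto
  ultimately show False using assms by simp
qed

lemma qpoch_fin_nonzero:
  assumes "norm q < 1"
  shows "qpoch_fin q q n \<noteq> 0"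
proof -
  have "q * q ^ k \<noteq> 1" for k
  proof
    assume "q * q ^ k = 1"
    then have "norm q * norm q ^ k = 1" by (metis norm_mult norm_one norm_power)
    moreover have "norm q * norm q ^ k \<le> norm q * 1"
      using assms by (intro mult_left_mono power_le_one) auto
    ultimately show False using assms by simp
  qed
  then show ?thesis by (simp add: qpoch_fin_def)
qed

lemma qpoch_inf_zero [simp]: "qpoch_inf 0 q = 1"
  by (simp add: qpoch_inf_def)

lemma qpoch_inf_rec:
  assumes "norm q < 1"
  shows "qpoch_inf x q = (1 - x) * qpoch_inf (q * x) q"
proof -
  have "qpoch_fin x q (Suc n) = (1 - x) * qpoch_fin (q * x) q n" for n
    unfolding qpoch_fin_def prod.lessThan_Suc_shift by (simp add: mult_ac)
  then have "(\<lambda>n. qpoch_fin x q (Suc n)) \<longlonglongrightarrow> (1 - x) * qpoch_inf (q * x) q"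
    using qpoch_fin_LIMSEQ[OF assms] by (simp add: tendsto_mult_left)
  moreover have "(\<lambda>n. qpoch_fin x q (Suc n)) \<longlonglongrightarrow> qpoch_inf x q"
    using qpoch_fin_LIMSEQ[OF assms] by (rule LIMSEQ_Suc)
  ultimately show ?thesis using LIMSEQ_unique by blast
qed

lemma qpoch_inf_split:
  assumes "norm q < 1"
  shows "qpoch_inf x q = qpoch_fin x q n * qpoch_inf (x * q ^ n) q"
proof (induction n)
  case (Suc n)
  have "qpoch_inf (x * q ^ n) q = (1 - x * q ^ n) * qpoch_inf (x * q ^ Suc n) q"
    by (subst qpoch_inf_rec[OF assms]) (simp add: mult_ac)
  with Suc show ?case by (simp add: qpoch_fin_Suc mult.assoc)
qed simp

text \<open>Iterating the functional equation moves the argument to \<open>q ^ n * x\<close>, which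
  tends to 0, so \<open>f\<close> is determined by its value there. The q-binomial theorem
  (\<open>b = 1\<close>) and Euler's expansion (\<open>a = 1\<close>, \<open>b = 0\<close>) are both
  instances.\<close>

lemma qpoch_recursion_unique:
  fixes f :: "complex \<Rightarrow> complex"
  assumes q: "norm q < 1" and cont: "isCont f 0" and x: "norm x < r"
    and rec: "\<And>x. norm x < r \<Longrightarrow> (1 - b * x) * f x = (1 - a * x) * f (q * x)"
  shows "qpoch_inf (b * x) q * f x = qpoch_inf (a * x) q * f 0"
proof -
  have iter: "qpoch_fin (b * x) q n * f x = qpoch_fin (a * x) q n * f (q ^ n * x)" for n
  proof (induction n)
    case (Suc n)
    have "norm (q ^ n * x) \<le> 1 * norm x"
      unfolding norm_mult norm_power using q by (intro mult_right_mono power_le_one) auto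
    then have "norm (q ^ n * x) < r" using x by linarith
    from rec[OF this]
    have "(1 - b * x * q ^ n) * f (q ^ n * x) = (1 - a * x * q ^ n) * f (q ^ Suc n * x)"
      by (simp add: mult_ac)
    moreover have "(A * u) * F = (A' * v) * H" if "A * F = A' * G" "u * G = v * H"
      for A F A' G u v H :: complex
      using that by algebra
    ultimately show ?case
      unfolding qpoch_fin_Suc using Suc by blast
  qed simp
  have "(\<lambda>n. q ^ n * x) \<longlonglongrightarrow> 0"
    using LIMSEQ_power_zero[OF q] by (rule tendsto_mult_left_zero)
  then have "(\<lambda>n. f (q ^ n * x)) \<longlonglongrightarrow> f 0"
    using cont by (rule isCont_tendsto_compose[rotated])
  then have "(\<lambda>n. qpoch_fin (a * x) q n * f (q ^ n * x)) \<longlonglongrightarrow> qpoch_inf (a * x) q * f 0"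
    by (intro tendsto_mult qpoch_fin_LIMSEQ[OF q])
  moreover have "(\<lambda>n. qpoch_fin (b * x) q n * f x) \<longlonglongrightarrow> qpoch_inf (b * x) q * f x"
    by (intro tendsto_mult qpoch_fin_LIMSEQ[OF q] tendsto_const)
  ultimately show ?thesis unfolding iter using LIMSEQ_unique by blast
qed

section \<open>The q-binomial theorem\<close>

definition qbin_coeff :: "complex \<Rightarrow> complex \<Rightarrow> nat \<Rightarrow> complex" where
  "qbin_coeff a q k = qpoch_fin a q k / qpoch_fin q q k"

lemma qbin_coeff_rec:
  assumes "norm q < 1"
  shows "(1 - q ^ Suc k) * qbin_coeff a q (Suc k) = (1 - a * q ^ k) * qbin_coeff a q k"
  using qpoch_fin_nonzero[OF assms, of "Suc k"]
  by (simp add: qbin_coeff_def qpoch_fin_Suc field_simps)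

text \<open>The coefficients converge to \<open>qpoch_inf a q / qpoch_inf q q\<close>. Boundedness
  allows comparison with a geometric series in the open unit disc.\<close>

lemma qbin_coeff_bounded:
  assumes "norm q < 1"
  shows "\<exists>K. \<forall>k. norm (qbin_coeff a q k) \<le> K"
proof -
  have "qbin_coeff a q \<longlonglongrightarrow> qpoch_inf a q / qpoch_inf q q"
    unfolding qbin_coeff_def
    by (intro tendsto_divide qpoch_fin_LIMSEQ assms qpoch_inf_nonzero)
  then have "Bseq (qbin_coeff a q)" using convergentI convergent_imp_Bseq by blast
  then show ?thesis unfolding Bseq_def by blast
qed

lemma qbin_summable:
  assumes "norm q < 1" "norm w < 1"
  shows "summable (\<lambda>k. qbin_coeff a q k * w ^ k)"
proof -
  obtain K where K: "\<And>k. norm (qbin_coeff a q k) \<le> K"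
    using qbin_coeff_bounded[OF assms(1)] by blast
  have "summable (\<lambda>k. K * norm w ^ k)" using assms by (simp add: summable_geometric summable_mult)
  then show ?thesis
    by (rule summable_comparison_test') (auto simp: norm_mult norm_power intro!: mult_right_mono K)
qed

lemma qbin_deriv:
  assumes "norm q < 1" "norm w < 1"
  shows "((\<lambda>w. \<Sum>k. qbin_coeff a q k * w ^ k) has_field_derivative
           (\<Sum>k. diffs (qbin_coeff a q) k * w ^ k)) (at w)"
proof -
  obtain r where r: "norm w < r" "r < 1" using assms(2) dense by blast
  then have r': "norm (complex_of_real r) = r"
    using order.strict_trans1[OF norm_ge_zero[of w] r(1)] by (simp add: norm_of_real)
  have "summable (\<lambda>k. qbin_coeff a q k * of_real r ^ k)"
    using r by (intro qbin_summable assms(1)) (simp only: r')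
  then show ?thesis
    by (rule termdiffs_strong) (simp only: r' r)
qed

text \<open>Passing to \<open>f w - f (q * w)\<close> multiplies the k-th coefficient by
  \<open>1 - q ^ k\<close>, which kills the constant term and lets the coefficient recurrence act on
  all others.\<close>

lemma qbin_rec:
  fixes a :: complex
  assumes q: "norm q < 1" and w: "norm w < 1"
  defines "f \<equiv> \<lambda>w. \<Sum>k. qbin_coeff a q k * w ^ k"
  shows "(1 - w) * f w = (1 - a * w) * f (q * w)"
proof -
  have qw: "norm (q * w) < 1"
    using q w by (metis mult_strict_mono' norm_ge_zero norm_mult mult_1)
  have S: "(\<lambda>k. qbin_coeff a q k * u ^ k) sums f u" if "norm u < 1" for u
    unfolding f_def using qbin_summable[OF q that] by (rule summable_sums)
  have "(\<lambda>k. qbin_coeff a q k * w ^ k - qbin_coeff a q k * (q * w) ^ k) sums (f w - f (q * w))"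
    by (intro sums_diff S w qw)
  then have A: "(\<lambda>k. qbin_coeff a q (Suc k) * w ^ Suc k - qbin_coeff a q (Suc k) * (q * w) ^ Suc k)
               sums (f w - f (q * w))"
    by (subst sums_Suc_iff) (simp)
  have B: "qbin_coeff a q (Suc k) * w ^ Suc k - qbin_coeff a q (Suc k) * (q * w) ^ Suc k =
      w * (qbin_coeff a q k * w ^ k - a * (qbin_coeff a q k * (q * w) ^ k))" for k
  proof -
    have "qbin_coeff a q (Suc k) * w ^ Suc k - qbin_coeff a q (Suc k) * (q * w) ^ Suc k =
      ((1 - q ^ Suc k) * qbin_coeff a q (Suc k)) * w ^ Suc k"
      by (simp add: algebra_simps power_mult_distrib)
    also have "\<dots> = w * (qbin_coeff a q k * w ^ k - a * (qbin_coeff a q k * (q * w) ^ k))"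
      unfolding qbin_coeff_rec[OF q] by (simp add: algebra_simps power_mult_distrib)
    finally show ?thesis .
  qed
  have "(\<lambda>k. w * (qbin_coeff a q k * w ^ k - a * (qbin_coeff a q k * (q * w) ^ k)))
                   sums (w * (f w - a * f (q * w)))"
    by (intro sums_mult sums_diff S w qw)
  with A have "f w - f (q * w) = w * (f w - a * f (q * w))"
    unfolding B by (rule sums_unique2)
  then show ?thesis by (simp add: algebra_simps)
qed

theorem q_binomial:
  assumes q: "norm q < 1" and w: "norm w < 1"
  shows "(\<lambda>k. qbin_coeff a q k * w ^ k) sums (qpoch_inf (a * w) q / qpoch_inf w q)"
proof -
  define f where "f = (\<lambda>w. \<Sum>k. qbin_coeff a q k * w ^ k)"
  have cont: "isCont f 0"
    unfolding f_def by (rule DERIV_isCont, rule qbin_deriv[OF q]) simp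
  have f0: "f 0 = 1" unfolding f_def powser_zero by (simp add: qbin_coeff_def)
  have "qpoch_inf (1 * w) q * f w = qpoch_inf (a * w) q * f 0"
    by (rule qpoch_recursion_unique[OF q cont w]) (use qbin_rec[OF q] in \<open>simp add: f_def\<close>)
  then have "f w = qpoch_inf (a * w) q / qpoch_inf w q"
    using qpoch_inf_nonzero[OF q w] by (simp add: f0 field_simps)
  then show ?thesis
    using qbin_summable[OF q w, of a, THEN summable_sums] unfolding f_def by simp
qed

section \<open>Euler's expansion of the infinite product\<close>

definition tri :: "nat \<Rightarrow> nat" where "tri n = n * (n - 1) div 2"

lemma tri_0 [simp]: "tri 0 = 0" by (simp add: tri_def)

lemma tri_Suc: "tri (Suc n) = tri n + n"
proof -
  have "Suc n * n = n * (n - 1) + 2 * n" by (cases n) (auto simp: algebra_simps)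
  then show ?thesis by (simp add: tri_def)
qed

text \<open>Consecutive terms have ratio \<open>norm x * norm q ^ n\<close>, which tends to 0; the
  series therefore converges for every \<open>x\<close>, not only in a disc.\<close>

lemma summable_norm_tri:
  fixes q x :: complex
  assumes "norm q < 1"
  shows "summable (\<lambda>n. norm (q ^ tri n * x ^ n))"
proof -
  have "(\<lambda>n. norm x * norm q ^ n) \<longlonglongrightarrow> norm x * 0"
    using assms by (intro tendsto_mult_left LIMSEQ_power_zero) simp
  then have "\<forall>\<^sub>F n in sequentially. norm x * norm q ^ n < 1 / 2"
    by (rule order_tendstoD) simp
  then obtain N where N: "\<And>n. n \<ge> N \<Longrightarrow> norm x * norm q ^ n < 1 / 2"
    by (auto simp: eventually_sequentially)
  show ?thesis
  proof (rule summable_ratio_test[of "1/2" N])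
    fix n assume "N \<le> n"
    have "norm (norm (q ^ tri (Suc n) * x ^ Suc n)) =
        (norm x * norm q ^ n) * norm (norm (q ^ tri n * x ^ n))"
      by (simp add: tri_Suc norm_mult norm_power power_add)
    also have "\<dots> \<le> (1 / 2) * norm (norm (q ^ tri n * x ^ n))"
      using N[OF \<open>N \<le> n\<close>] by (intro mult_right_mono) auto
    finally show "norm (norm (q ^ tri (Suc n) * x ^ Suc n)) \<le> 1 / 2 * norm (norm (q ^ tri n * x ^ n))" .
  qed simp
qed

definition euler_coeff :: "complex \<Rightarrow> nat \<Rightarrow> complex" where
  "euler_coeff q n = (-1) ^ n * q ^ tri n / qpoch_fin q q n"

lemma euler_coeff_rec:
  assumes "norm q < 1"
  shows "(1 - q ^ Suc n) * euler_coeff q (Suc n) = - (q ^ n) * euler_coeff q n"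
  using qpoch_fin_nonzero[OF assms, of "Suc n"]
  by (simp add: euler_coeff_def qpoch_fin_Suc tri_Suc power_add field_simps)

text \<open>Since \<open>qbin_coeff 0 q n\<close> is \<open>1 / qpoch_fin q q n\<close>, the bound
  already known for these coefficients reduces the claim to
  \<open>summable_norm_tri\<close>.\<close>

lemma summable_norm_euler:
  assumes q: "norm q < 1"
  shows "summable (\<lambda>n. norm (euler_coeff q n * x ^ n))"
proof -
  obtain K where K: "\<And>k. norm (qbin_coeff 0 q k) \<le> K"
    using qbin_coeff_bounded[OF assms(1)] by blast
  have eq: "norm (euler_coeff q n * x ^ n) = norm (qbin_coeff 0 q n) * norm (q ^ tri n * x ^ n)" for n
    by (simp add: euler_coeff_def qbin_coeff_def qpoch_fin_def norm_mult norm_divide norm_power)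
  have "summable (\<lambda>n. K * norm (q ^ tri n * x ^ n))"
    by (intro summable_mult summable_norm_tri q)
  then show ?thesis
    by (rule summable_comparison_test') (unfold eq, auto intro!: mult_right_mono K)
qed

lemma euler_deriv:
  assumes "norm q < 1"
  shows "((\<lambda>w. \<Sum>k. euler_coeff q k * w ^ k) has_field_derivative
           (\<Sum>k. diffs (euler_coeff q) k * x ^ k)) (at x)"
  by (rule termdiffs_strong_converges_everywhere)
     (rule summable_norm_cancel[OF summable_norm_euler[OF assms]])

theorem euler_sums:
  assumes q: "norm q < 1"
  shows "(\<lambda>n. euler_coeff q n * x ^ n) sums qpoch_inf x q"
proof -
  define f where "f = (\<lambda>x. \<Sum>k. euler_coeff q k * x ^ k)"
  have S: "(\<lambda>n. euler_coeff q n * u ^ n) sums f u" for u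
    unfolding f_def using summable_norm_cancel[OF summable_norm_euler[OF q]] by (rule summable_sums)
  have rec: "f x = (1 - x) * f (q * x)" for x
  proof -
    have "(\<lambda>k. euler_coeff q k * x ^ k - euler_coeff q k * (q * x) ^ k) sums (f x - f (q * x))"
      by (intro sums_diff S)
    then have A: "(\<lambda>k. euler_coeff q (Suc k) * x ^ Suc k - euler_coeff q (Suc k) * (q * x) ^ Suc k)
               sums (f x - f (q * x))"
      by (subst sums_Suc_iff) simp
    have B: "euler_coeff q (Suc k) * x ^ Suc k - euler_coeff q (Suc k) * (q * x) ^ Suc k =
       - x * (euler_coeff q k * (q * x) ^ k)" for k
    proof -
      have "euler_coeff q (Suc k) * x ^ Suc k - euler_coeff q (Suc k) * (q * x) ^ Suc k =
        ((1 - q ^ Suc k) * euler_coeff q (Suc k)) * x ^ Suc k"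
        by (simp add: algebra_simps power_mult_distrib)
      then show ?thesis
        unfolding euler_coeff_rec[OF q] by (simp add: algebra_simps power_mult_distrib)
    qed
    have "(\<lambda>k. - x * (euler_coeff q k * (q * x) ^ k)) sums (- x * f (q * x))"
      by (intro sums_mult S)
    with A have "f x - f (q * x) = - x * f (q * x)"
      unfolding B by (rule sums_unique2)
    then show ?thesis by (simp add: algebra_simps)
  qed
  have "isCont f 0"
    unfolding f_def by (rule DERIV_isCont, rule euler_deriv[OF q])
  then have "qpoch_inf (0 * x) q * f x = qpoch_inf (1 * x) q * f 0"
    by (rule qpoch_recursion_unique[OF q, of _ _ "norm x + 1"]) (simp_all flip: rec)
  moreover have "f 0 = 1" unfolding f_def powser_zero by (simp add: euler_coeff_def)
  ultimately have "f x = qpoch_inf x q" by simp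
  then show ?thesis using S[of x] by simp
qed

lemma qpoch_inf_field_differentiable:
  assumes "norm q < 1"
  shows "(\<lambda>x. qpoch_inf x q) field_differentiable (at x)"
proof -
  have "(\<lambda>x. qpoch_inf x q) = (\<lambda>x. \<Sum>k. euler_coeff q k * x ^ k)"
    using euler_sums[OF assms] by (auto simp: sums_iff)
  then show ?thesis using euler_deriv[OF assms] unfolding field_differentiable_def by auto
qed

section \<open>Theta functions\<close>

no_notation Infinite_Set_Sum.abs_summable_on (infix \<open>abs'_summable'_on\<close> 50)

text \<open>The source of all two-dimensional lattice sums below: once a product of two series is a
  sum over pairs, the pairs can be rearranged by any bijection.\<close>

lemma has_sum_times:
  fixes f :: "'a \<Rightarrow> complex" and g :: "'b \<Rightarrow> complex"
  assumes f: "f abs_summable_on A" and g: "g abs_summable_on B"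
    and fS: "(f has_sum S) A" and gT: "(g has_sum T) B"
  shows "((\<lambda>(a, b). f a * g b) has_sum S * T) (A \<times> B)"
    and "(\<lambda>(a, b). f a * g b) abs_summable_on (A \<times> B)"
proof -
  show *: "(\<lambda>(a, b). f a * g b) abs_summable_on (A \<times> B)"
    unfolding Infinite_Sum.abs_summable_on_Sigma_iff
  proof (intro conjI ballI)
    fix a assume "a \<in> A"
    show "(\<lambda>b. case (a, b) of (a, b) \<Rightarrow> f a * g b) abs_summable_on B"
      using summable_on_cmult_right[OF g, of "norm (f a)"] by (simp add: norm_mult)
  next
    have "(\<lambda>a. norm (norm (f a) * (\<Sum>\<^sub>\<infinity>b\<in>B. norm (g b)))) summable_on A"
      using summable_on_cmult_left[OF f, of "norm (\<Sum>\<^sub>\<infinity>b\<in>B. norm (g b))"] by (simp add: abs_mult)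
    then show "(\<lambda>a. \<Sum>\<^sub>\<infinity>b\<in>B. norm (case (a, b) of (a, b) \<Rightarrow> f a * g b)) abs_summable_on A"
      by (simp add: norm_mult infsum_cmult_right')
  qed
  show "((\<lambda>(a, b). f a * g b) has_sum S * T) (A \<times> B)"
  proof (rule has_sum_SigmaI)
    show "((\<lambda>b. case (a, b) of (a, b) \<Rightarrow> f a * g b) has_sum f a * T) B" if "a \<in> A" for a
      using has_sum_cmult_right[OF gT, of "f a"] by simp
    show "((\<lambda>a. f a * T) has_sum S * T) A"
      by (rule has_sum_cmult_left[OF fS])
    show "(\<lambda>(a, b). f a * g b) summable_on A \<times> B"
      by (rule abs_summable_summable[OF *])
  qed
qed

section \<open>The triple product as a sum over the integers\<close>

definition itri :: "int \<Rightarrow> int" where "itri n = n * (n - 1) div 2"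

lemma two_itri: "2 * itri n = n * (n - 1)"
  unfolding itri_def by (cases "even n") auto

lemma itri_eqI: "2 * m = n * (n - 1) \<Longrightarrow> itri n = m"
  using two_itri[of n] by linarith

lemma itri_of_nat: "itri (int n) = int (tri n)"
proof (rule itri_eqI)
  have "2 * tri n = n * (n - 1)" unfolding tri_def by (cases "even n") auto
  then have "int (2 * tri n) = int (n * (n - 1))" by (simp only:)
  then show "2 * int (tri n) = int n * (int n - 1)"
    by (cases n) (simp_all add: algebra_simps)
qed

lemma itri_add: "itri (m + n) = itri m + itri n + m * n"
  using two_itri[of m] two_itri[of n] by (intro itri_eqI) (simp add: algebra_simps)

lemma itri_0 [simp]: "itri 0 = 0" and itri_1 [simp]: "itri 1 = 0"
  by (simp_all add: itri_def)

definition gauss :: "complex \<Rightarrow> complex \<Rightarrow> int \<Rightarrow> complex" where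
  "gauss q y n = q powi itri n * y powi n"

lemma gauss_of_nat: "gauss q y (int n) = q ^ tri n * y ^ n"
  by (simp add: gauss_def itri_of_nat)

lemma UNIV_int_split: "(UNIV :: int set) = range int \<union> range (\<lambda>n. - int n - 1)"
proof -
  have "z \<in> range int \<union> range (\<lambda>n. - int n - 1)" for z
  proof (cases "z \<ge> 0")
    case True then show ?thesis by (auto intro!: image_eqI[of _ _ "nat z"])
  next
    case False then show ?thesis by (auto intro!: image_eqI[of _ _ "nat (- z - 1)"])
  qed
  then show ?thesis by blast
qed

text \<open>The reflection \<open>n -> - n - 1\<close> turns the negative half into a one-sided
  series of the same shape with \<open>y\<close> replaced by \<open>q^2 / y\<close>.\<close>

lemma gauss_abs_summable:
  assumes q: "q \<noteq> 0" "norm q < 1" and y: "y \<noteq> 0"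
  shows "gauss q y abs_summable_on UNIV"
proof -
  have neg: "gauss q y (- int n - 1) = q / y * (q ^ tri n * (q\<^sup>2 / y) ^ n)" for n
  proof -
    have "2 * int (tri n) = int n * (int n - 1)"
      using two_itri[of "int n"] by (simp add: itri_of_nat)
    then have "itri (- int n - 1) = int (tri n + 2 * n + 1)"
      by (intro itri_eqI) (simp add: algebra_simps)
    then have 1: "q powi itri (- int n - 1) = q ^ (tri n + 2 * n + 1)"
      by (simp only: power_int_of_nat)
    have "- int n - 1 = - int (Suc n)" by simp
    then have 2: "y powi (- int n - 1) = inverse (y ^ Suc n)"
      by (simp only: power_int_minus power_int_of_nat)
    show ?thesis
      unfolding gauss_def 1 2
      by (simp add: power_add power_mult power2_eq_square power_mult_distrib divide_inverse power_inverse)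
  qed
  have 1: "gauss q y abs_summable_on range int"
    using summable_norm_tri[OF q(2), of y]
    by (subst summable_on_reindex) (auto simp: o_def gauss_of_nat summable_on_UNIV_nonneg_real_iff)
  have neg': "norm (gauss q y (- int n - 1)) = norm (q / y) * norm (q ^ tri n * (q\<^sup>2 / y) ^ n)" for n
    by (simp only: neg norm_mult)
  have "summable (\<lambda>n. norm (q / y) * norm (q ^ tri n * (q\<^sup>2 / y) ^ n))"
    by (intro summable_mult summable_norm_tri q)
  then have 2: "gauss q y abs_summable_on range (\<lambda>n. - int n - 1)"
    by (subst summable_on_reindex)
       (auto simp only: o_def neg' summable_on_UNIV_nonneg_real_iff inj_on_def norm_ge_zero mult_nonneg_nonneg)
  show ?thesis
    unfolding UNIV_int_split using 1 2 by (intro summable_on_Un_disjoint) auto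
qed

definition theta :: "complex \<Rightarrow> complex \<Rightarrow> complex" where
  "theta q x = qpoch_inf x q * qpoch_inf (q / x) q * qpoch_inf q q"

lemma theta_mult_base:
  assumes "q \<noteq> 0" "norm q < 1" "x \<noteq> 0"
  shows "theta q (q * x) = - theta q x / x"
proof -
  have "qpoch_inf (1 / x) q = (1 - 1 / x) * qpoch_inf (q / x) q"
    by (subst qpoch_inf_rec[OF assms(2)]) simp
  then have "theta q (q * x) = qpoch_inf (q * x) q * ((1 - 1 / x) * qpoch_inf (q / x) q) * qpoch_inf q q"
    using assms by (simp add: theta_def)
  also have "\<dots> = - (1 / x) * (((1 - x) * qpoch_inf (q * x) q) * qpoch_inf (q / x) q * qpoch_inf q q)"
    using assms(3) by (simp add: field_simps)
  also have "(1 - x) * qpoch_inf (q * x) q = qpoch_inf x q"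
    by (rule qpoch_inf_rec[OF assms(2), symmetric])
  finally show ?thesis by (simp add: theta_def)
qed

lemma theta_reflect:
  assumes "q \<noteq> 0" "x \<noteq> 0"
  shows "theta q (q / x) = theta q x"
  using assms by (simp add: theta_def)

lemma theta_inverse:
  assumes "q \<noteq> 0" "norm q < 1" "x \<noteq> 0"
  shows "theta q (1 / x) = - theta q x / x"
proof -
  have "theta q (1 / x) = theta q (q / (q * x))" using assms by simp
  also have "\<dots> = theta q (q * x)" using assms by (intro theta_reflect) auto
  finally show ?thesis by (simp add: theta_mult_base[OF assms])
qed

lemma theta_1:
  assumes "norm q < 1" shows "theta q 1 = 0"
  using qpoch_inf_0_iff[OF assms, of 1] by (auto simp: theta_def intro!: exI[of _ 0])

lemma gauss_mult_base:
  assumes "q \<noteq> 0" "y \<noteq> 0"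
  shows "gauss q (q * y) n = gauss q y (n + 1) / y"
  using assms by (simp add: gauss_def itri_add power_int_add power_int_mult_distrib field_simps)

text \<open>Andrews' derivation of the triple product from Euler's two expansions; convergence of the
  second one requires \<open>norm q < norm x\<close>.\<close>

lemma theta_has_sum_aux:
  assumes q: "q \<noteq> 0" "norm q < 1" and x: "norm q < norm x"
  shows "(gauss q (- x) has_sum theta q x) UNIV"
proof -
  have x0: "x \<noteq> 0" using x by auto
  have qx: "norm (q / x) < 1" using x x0 by (simp add: norm_divide)
  define G where "G = (\<lambda>m. qbin_coeff 0 q m * (q / x) ^ m)"
  obtain K where K: "\<And>k. norm (qbin_coeff 0 q k) \<le> K"
    using qbin_coeff_bounded[OF q(2)] by blast
  have "summable (\<lambda>k. K * norm (q / x) ^ k)"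
    using qx by (simp add: summable_geometric summable_mult)
  then have "summable (\<lambda>m. norm (G m))"
    by (rule summable_comparison_test')
       (auto simp: G_def norm_mult norm_power intro!: mult_right_mono K)
  then have Gs: "G abs_summable_on UNIV"
    by (simp add: summable_on_UNIV_nonneg_real_iff)
  have Gsum: "(G has_sum (1 / qpoch_inf (q / x) q)) UNIV"
    using q_binomial[OF q(2) qx, of 0] \<open>summable (\<lambda>m. norm (G m))\<close>
    by (intro norm_summable_imp_has_sum) (auto simp: G_def)
  define S where "S = infsum (gauss q (- x)) UNIV"
  have gs: "gauss q (- x) abs_summable_on UNIV"
    using gauss_abs_summable[OF q, of "- x"] x0 by simp
  have gsum: "(gauss q (- x) has_sum S) UNIV"
    unfolding S_def by (rule has_sum_infsum[OF abs_summable_summable[OF gs]])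
  have "((\<lambda>(l, m). gauss q (- x) l * G m) has_sum S * (1 / qpoch_inf (q / x) q)) (UNIV \<times> UNIV)"
    by (rule has_sum_times[OF gs Gs gsum Gsum])
  also have "?this \<longleftrightarrow>
    ((\<lambda>(n, m). gauss q (- x) (n + int m) * G m) has_sum S * (1 / qpoch_inf (q / x) q)) (UNIV \<times> UNIV)"
    by (rule has_sum_reindex_bij_witness[of _ "\<lambda>(n, m). (n + int m, m)" "\<lambda>(n, m). (n - int m, m)"]) auto
  finally have D: "((\<lambda>(n, m). gauss q (- x) (n + int m) * G m) has_sum
      S * (1 / qpoch_inf (q / x) q)) (UNIV \<times> UNIV)" .
  \<comment> \<open>After the substitution \<open>l = n + m\<close> the powers of \<open>x\<close>
    in \<open>gauss\<close> and \<open>G\<close> cancel up to \<open>gauss q (- x) n\<close>, and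
    the sum over \<open>m\<close> is Euler's series at \<open>q powi (n + 1)\<close>.\<close>
  have inner: "((\<lambda>m. gauss q (- x) (n + int m) * G m) has_sum
      gauss q (- x) n * qpoch_inf (q powi (n + 1)) q) UNIV" for n
  proof -
    have "((\<lambda>m. euler_coeff q m * (q powi (n + 1)) ^ m) has_sum qpoch_inf (q powi (n + 1)) q) UNIV"
      by (intro norm_summable_imp_has_sum summable_norm_euler euler_sums q)
    then have "((\<lambda>m. gauss q (- x) n * (euler_coeff q m * (q powi (n + 1)) ^ m)) has_sum
        gauss q (- x) n * qpoch_inf (q powi (n + 1)) q) UNIV"
      by (rule has_sum_cmult_right)
    moreover have "gauss q (- x) n * (euler_coeff q m * (q powi (n + 1)) ^ m) =
        gauss q (- x) (n + int m) * G m" for m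
    proof -
      have "(q powi (n + 1)) ^ m = q powi (n * int m) * q ^ m"
        using q by (simp add: power_int_add power_int_mult power_mult_distrib)
      then show ?thesis
        using q x0 by (simp add: gauss_def itri_add itri_of_nat euler_coeff_def G_def qbin_coeff_def
          qpoch_fin_def power_int_add power_minus[of x] power_divide)
    qed
    ultimately show ?thesis by simp
  qed
  have E: "((\<lambda>n. gauss q (- x) n * qpoch_inf (q powi (n + 1)) q) has_sum
      S * (1 / qpoch_inf (q / x) q)) UNIV"
    by (rule has_sum_Sigma'[OF D]) (use inner in simp)
  have "((\<lambda>n. qpoch_inf q q * (euler_coeff q n * x ^ n)) has_sum qpoch_inf q q * qpoch_inf x q) UNIV"
    by (intro has_sum_cmult_right norm_summable_imp_has_sum summable_norm_euler euler_sums q)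
  moreover have "qpoch_inf q q * (euler_coeff q n * x ^ n) =
      gauss q (- x) (int n) * qpoch_inf (q powi (int n + 1)) q" for n
  proof -
    have "qpoch_inf q q = qpoch_fin q q n * qpoch_inf (q powi (int n + 1)) q"
      using qpoch_inf_split[OF q(2), of q n] q by (simp add: power_int_add mult.commute)
    then show ?thesis
      using qpoch_fin_nonzero[OF q(2), of n]
      by (simp add: gauss_of_nat euler_coeff_def power_minus[of x])
  qed
  ultimately have "(((\<lambda>n. gauss q (- x) n * qpoch_inf (q powi (n + 1)) q) \<circ> int) has_sum
      qpoch_inf q q * qpoch_inf x q) UNIV"
    by (simp add: o_def)
  then have "((\<lambda>n. gauss q (- x) n * qpoch_inf (q powi (n + 1)) q) has_sum
      qpoch_inf q q * qpoch_inf x q) (range int)"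
    by (subst has_sum_reindex) auto
  also have "?this \<longleftrightarrow> ((\<lambda>n. gauss q (- x) n * qpoch_inf (q powi (n + 1)) q) has_sum
      qpoch_inf q q * qpoch_inf x q) UNIV"
  proof (rule has_sum_cong_neutral)
    \<comment> \<open>For negative \<open>n\<close> the product contains the factor
      \<open>1 - q powi (n + 1) * q ^ (- n - 1) = 0\<close>, so only the nonnegative half
      contributes.\<close>
    fix n :: int assume "n \<in> UNIV - range int"
    then have "n < 0" by (metis DiffD2 int_nat_eq linorder_not_less rangeI)
    then have "q powi (n + 1) * q ^ nat (- n - 1) = 1"
      using q by (simp flip: power_int_of_nat power_int_add)
    then have "qpoch_inf (q powi (n + 1)) q = 0"
      using qpoch_inf_0_iff[OF q(2)] by blast
    then show "gauss q (- x) n * qpoch_inf (q powi (n + 1)) q = 0" by simp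
  qed auto
  finally have "S * (1 / qpoch_inf (q / x) q) = qpoch_inf q q * qpoch_inf x q"
    using E has_sum_unique by blast
  then have "S = theta q x"
    using qpoch_inf_nonzero[OF q(2) qx] by (simp add: theta_def field_simps)
  then show ?thesis using gsum by simp
qed

text \<open>Both sides transform alike under \<open>x -> q * x\<close>, so the identity spreads from
  \<open>norm q < norm x\<close> to all nonzero \<open>x\<close>: choosing \<open>k\<close> with
  \<open>norm q ^ k < norm x\<close> makes \<open>x / q ^ k\<close> larger than 1 in norm.\<close>

theorem theta_has_sum:
  assumes q: "q \<noteq> 0" "norm q < 1" and x: "x \<noteq> 0"
  shows "(gauss q (- x) has_sum theta q x) UNIV"
proof -
  have step: "(gauss q (- (q ^ k * y)) has_sum theta q (q ^ k * y)) UNIV"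
    if y: "norm q < norm y" for y k
  proof (induction k)
    case 0 then show ?case using theta_has_sum_aux[OF q y] by simp
  next
    case (Suc k)
    define z where "z = q ^ k * y"
    have z: "z \<noteq> 0" using y q by (auto simp: z_def)
    have "(gauss q (- z) has_sum theta q z) UNIV" using Suc by (simp add: z_def)
    then have "((\<lambda>n. gauss q (- z) n * (1 / - z)) has_sum theta q z * (1 / - z)) UNIV"
      by (rule has_sum_cmult_left)
    also have "?this \<longleftrightarrow> ((\<lambda>n. gauss q (- z) (n + 1) * (1 / - z)) has_sum theta q z * (1 / - z)) UNIV"
      by (rule has_sum_reindex_bij_witness[of _ "\<lambda>n. n + 1" "\<lambda>n. n - 1"]) auto
    finally show ?case
      using gauss_mult_base[OF q(1), of "- z"] theta_mult_base[OF q z] z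
      by (simp add: z_def mult.assoc)
  qed
  have "(\<lambda>k. norm q ^ k) \<longlonglongrightarrow> 0" using q by (intro LIMSEQ_power_zero) simp
  then have "\<forall>\<^sub>F k in sequentially. norm q ^ k < norm x" using x by (intro order_tendstoD) auto
  then obtain k where k: "norm q ^ k < norm x" by (metis eventually_happens trivial_limit_sequentially)
  have "norm q * 1 < norm x / norm q ^ k"
  proof -
    have "norm q < 1" by (rule q)
    also have "1 < norm x / norm q ^ k" using k q by (simp add: less_divide_eq)
    finally show ?thesis by simp
  qed
  then show ?thesis using step[of "x / q ^ k" k] q by (simp add: norm_divide norm_power)
qed

lemma theta_abs_summable:
  assumes "q \<noteq> 0" "norm q < 1" "x \<noteq> 0"
  shows "gauss q (- x) abs_summable_on UNIV"
  using gauss_abs_summable[of q "- x"] assms by simp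

lemma qpoch_inf_dissect:
  assumes q: "norm q < 1" and k: "0 < k"
  shows "qpoch_inf x q = (\<Prod>i<k. qpoch_inf (x * q ^ i) (q ^ k))"
proof -
  have qk: "norm (q ^ k) < 1" using q k by (simp add: norm_power power_less_one_iff)
  have "qpoch_fin x q (n * k) = (\<Prod>i<k. qpoch_fin (x * q ^ i) (q ^ k) n)" for n
  proof -
    have "qpoch_fin x q (n * k) = (\<Prod>m<n. \<Prod>i\<in>{m * k..<m * k + k}. 1 - x * q ^ i)"
      by (simp add: qpoch_fin_def prod.nat_group)
    also have "\<dots> = (\<Prod>m<n. \<Prod>i<k. 1 - x * q ^ (i + m * k))"
      using prod.shift_bounds_nat_ivl[of "\<lambda>i. 1 - x * q ^ i" 0 "_ * k" k]
      by (simp add: add.commute lessThan_atLeast0)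
    also have "\<dots> = (\<Prod>i<k. \<Prod>m<n. 1 - x * q ^ (i + m * k))" by (rule prod.swap)
    finally show ?thesis
      by (simp add: qpoch_fin_def power_add mult_ac flip: power_mult)
  qed
  moreover have "(\<lambda>n. \<Prod>i<k. qpoch_fin (x * q ^ i) (q ^ k) n) \<longlonglongrightarrow>
      (\<Prod>i<k. qpoch_inf (x * q ^ i) (q ^ k))"
    by (intro tendsto_prod qpoch_fin_LIMSEQ qk)
  moreover have "(\<lambda>n. qpoch_fin x q (n * k)) \<longlonglongrightarrow> qpoch_inf x q"
    using LIMSEQ_subseq_LIMSEQ[OF qpoch_fin_LIMSEQ[OF q], of "\<lambda>n. n * k"] k
    by (simp add: strict_mono_def o_def)
  ultimately show ?thesis using LIMSEQ_unique by auto
qed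

lemma qpoch_inf_square:
  assumes q: "norm q < 1"
  shows "qpoch_inf (x\<^sup>2) (q\<^sup>2) = qpoch_inf x q * qpoch_inf (- x) q"
proof -
  have "(1 - x * q ^ k) * (1 - - x * q ^ k) = 1 - x\<^sup>2 * (q\<^sup>2) ^ k" for k
    by (simp add: algebra_simps power2_eq_square power_mult_distrib)
  then show ?thesis
    unfolding qpoch_inf_def
    by (subst prodinf_mult) (auto intro: convergent_prod_qpoch[OF q] convergent_prod_qpoch[OF q, of "- x", simplified])
qed

lemma qpoch_inf_base2:
  assumes "norm q < 1"
  shows "qpoch_inf x q = qpoch_inf x (q\<^sup>2) * qpoch_inf (x * q) (q\<^sup>2)"
  using qpoch_inf_dissect[OF assms, of 2 x] by (simp add: numeral_2_eq_2)

lemma theta_cube_base: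
  assumes "q \<noteq> 0" "norm q < 1"
  shows "theta (q ^ 3) q = qpoch_inf q q" and "theta (q ^ 3) (q\<^sup>2) = qpoch_inf q q"
proof -
  have 1: "qpoch_inf q q = qpoch_inf q (q ^ 3) * qpoch_inf (q\<^sup>2) (q ^ 3) * qpoch_inf (q ^ 3) (q ^ 3)"
    using qpoch_inf_dissect[OF assms(2), of 3 q]
    by (simp add: numeral_3_eq_3 power2_eq_square mult_ac)
  have 2: "q ^ 3 / q = q\<^sup>2" "q ^ 3 / q\<^sup>2 = q" using assms by (simp_all add: power_numeral_reduce)
  show "theta (q ^ 3) q = qpoch_inf q q" "theta (q ^ 3) (q\<^sup>2) = qpoch_inf q q"
    unfolding theta_def 1 2 by simp_all
qed

text \<open>Splitting the summation index as \<open>11 * k + s\<close> leaves a triple product in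
  base \<open>b ^ 121\<close> for each \<open>s\<close>. The start \<open>c\<close> of the residue
  system is kept free because two systems are used: \<open>- 5\<close> for theta at a root of unity
  and \<open>- 3\<close> for the Euler product.\<close>

theorem theta_dissection:
  assumes b: "b \<noteq> 0" "norm b < 1" and z: "z \<noteq> 0"
  shows "theta b z = (\<Sum>s\<in>{c..c+10}. b powi itri s * (- z) powi s *
           theta (b ^ 121) (z ^ 11 * b powi (11 * s + 55)))"
proof -
  have b': "b ^ 121 \<noteq> 0" "norm (b ^ 121) < 1"
    using b by (auto simp: norm_power power_less_one_iff)
  let ?y = "\<lambda>s. z ^ 11 * b powi (11 * s + 55)"
  have term_eq: "gauss b (- z) (11 * k + s) =
      b powi itri s * (- z) powi s * gauss (b ^ 121) (- ?y s) k" for k s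
  proof -
    have "itri (11 * k) = 121 * itri k + 55 * k"
      using two_itri[of k] by (intro itri_eqI) (simp add: algebra_simps)
    then have "itri (11 * k + s) = itri s + 121 * itri k + (11 * s + 55) * k"
      by (simp add: itri_add algebra_simps)
    then have "b powi itri (11 * k + s) = b powi itri s * b powi (121 * itri k) * b powi ((11 * s + 55) * k)"
      using b by (simp only: power_int_add simp_thms)
    then have "b powi itri (11 * k + s) = b powi itri s * (b ^ 121) powi itri k * (b powi (11 * s + 55)) powi k"
      by (simp only: power_int_mult power_int_numeral)
    moreover have "(- z) powi (11 * k + s) = (- z) powi s * (- (z ^ 11)) powi k"
      using z by (simp add: power_int_add power_int_mult)
    moreover have "(- ?y s) powi k = (- (z ^ 11)) powi k * (b powi (11 * s + 55)) powi k"
      by (simp flip: power_int_mult_distrib)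
    ultimately show ?thesis by (simp add: gauss_def)
  qed
  have "(gauss b (- z) has_sum theta b z) UNIV" by (rule theta_has_sum[OF b z])
  moreover have "(11 * k + s - c) mod 11 = s - c" "(11 * k + s - c) div 11 = k"
    if "s \<in> {c..c+10}" for k s
  proof -
    have "11 * k + s - c = 11 * k + (s - c)" "0 \<le> s - c" "s - c < 11" using that by auto
    then show "(11 * k + s - c) mod 11 = s - c" "(11 * k + s - c) div 11 = k"
      by (auto intro: int_mod_pos_eq int_div_pos_eq)
  qed
  moreover have "11 * ((n - c) div 11) + ((n - c) mod 11 + c) = n" for n
    using mult_div_mod_eq[of 11 "n - c"] by linarith
  moreover have "(n - c) mod 11 + c \<in> {c..c+10}" for n
    using pos_mod_bound[of 11 "n - c"] pos_mod_sign[of 11 "n - c"] by auto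
  ultimately have "((\<lambda>(s, k). gauss b (- z) (11 * k + s)) has_sum theta b z) ({c..c+10} \<times> UNIV)"
    by (subst has_sum_reindex_bij_witness[of _ "\<lambda>n. ((n - c) mod 11 + c, (n - c) div 11)"
         "\<lambda>(s, k). 11 * k + s" UNIV "gauss b (- z)"]) auto
  then have "((\<lambda>s. b powi itri s * (- z) powi s * theta (b ^ 121) (?y s)) has_sum theta b z) {c..c+10}"
  proof (rule has_sum_Sigma')
    fix s
    have "((\<lambda>k. b powi itri s * (- z) powi s * gauss (b ^ 121) (- ?y s) k) has_sum
        b powi itri s * (- z) powi s * theta (b ^ 121) (?y s)) UNIV"
      by (intro has_sum_cmult_right theta_has_sum b') (use z b in auto)
    then show "((\<lambda>k. case (s, k) of (s, k) \<Rightarrow> gauss b (- z) (11 * k + s)) has_sum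
        b powi itri s * (- z) powi s * theta (b ^ 121) (?y s)) UNIV"
      by (simp add: term_eq)
  qed
  then show ?thesis by (simp add: has_sum_finite_iff)
qed

section \<open>Products of two theta functions as lattice sums\<close>

lemma gauss_product_has_sum:
  assumes "p \<noteq> 0" "norm p < 1" "r \<noteq> 0" "norm r < 1" "x \<noteq> 0" "y \<noteq> 0"
  shows "((\<lambda>(k, l). gauss p (- x) k * gauss r (- y) l) has_sum theta p x * theta r y) UNIV"
  using has_sum_times(1)[OF theta_abs_summable theta_abs_summable theta_has_sum theta_has_sum, of p x r y] assms
  by simp

text \<open>\<open>thetaA\<close> and \<open>thetaB\<close> span the two-dimensional space in which
  \<open>theta p (x * y) * theta p (x / y) / x\<close> becomes a 2x2 determinant. They belong to the
  odd and even shifts of the lattice in \<open>int_pair_parity\<close>.\<close>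

definition thetaA :: "complex \<Rightarrow> complex \<Rightarrow> complex" where
  "thetaA p x = theta (p\<^sup>2) (- (p * x\<^sup>2))"

definition thetaB :: "complex \<Rightarrow> complex \<Rightarrow> complex" where
  "thetaB p x = x * theta (p\<^sup>2) (- (p\<^sup>2 * x\<^sup>2))"

lemma int_pair_parity:
  fixes e o' :: "int \<times> int \<Rightarrow> int \<times> int"
  defines "e \<equiv> \<lambda>(k, l). (k + l, k - l)" and "o' \<equiv> \<lambda>(k, l). (k + l + 1, k - l)"
  shows "range e \<inter> range o' = {}" "range e \<union> range o' = UNIV"
proof -
  have e: "(m, n) \<in> range e \<longleftrightarrow> even (m + n)" for m n
  proof
    assume "even (m + n)"
    then have "m = (m + n) div 2 + (m - n) div 2" "n = (m + n) div 2 - (m - n) div 2"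
      by presburger+
    then have "(m, n) = e ((m + n) div 2, (m - n) div 2)" unfolding e_def by simp
    then show "(m, n) \<in> range e" by (rule range_eqI)
  qed (auto simp: e_def)
  have o: "(m, n) \<in> range o' \<longleftrightarrow> odd (m + n)" for m n
  proof
    assume "odd (m + n)"
    then have "m = (m + n) div 2 + (m - n) div 2 + 1" "n = (m + n) div 2 - (m - n) div 2"
      by presburger+
    then have "(m, n) = o' ((m + n) div 2, (m - n) div 2)" unfolding o'_def by simp
    then show "(m, n) \<in> range o'" by (rule range_eqI)
  qed (auto simp: o'_def)
  show "range e \<inter> range o' = {}" "range e \<union> range o' = UNIV"
    by (simp_all only: set_eq_iff split_paired_All Un_iff Int_iff e o) auto
qed

text \<open>Index pairs with even sum are \<open>(k + l, k - l)\<close>, those with odd sum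
  \<open>(k + l + 1, k - l)\<close>; on each family the exponents separate into a part in
  \<open>k\<close> and a part in \<open>l\<close>. The determinant form is what matters: three-term
  relations and their derivatives become identities between 2x2 minors.\<close>

theorem theta_product_det:
  assumes p: "p \<noteq> 0" "norm p < 1" and xy: "x \<noteq> 0" "y \<noteq> 0"
  shows "theta p (x * y) * theta p (x / y) =
    x * (thetaB p x * thetaA p y - thetaA p x * thetaB p y)"
proof -
  let ?f = "\<lambda>(m, n). gauss p (- (x * y)) m * gauss p (- (x / y)) n"
  let ?e = "\<lambda>(k::int, l::int). (k + l, k - l)" and ?o = "\<lambda>(k::int, l::int). (k + l + 1, k - l)"
  have p2: "p\<^sup>2 \<noteq> 0" "norm (p\<^sup>2) < 1" using p by (auto simp: norm_power power_less_one_iff)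
  have S: "(?f has_sum theta p (x * y) * theta p (x / y)) UNIV"
    by (rule gauss_product_has_sum) (use p xy in auto)
  have xy_powi: "(- (x * y)) powi a * (- (x / y)) powi b = (-1) powi (a + b) * x powi (a + b) * y powi (a - b)" for a b
  proof -
    have "(- (x * y)) powi a * (- (x / y)) powi b =
       ((-1) powi a * (-1) powi b) * (x powi a * x powi b) * (y powi a / y powi b)"
      using power_int_mult_distrib[of "-1" "x * y" a] power_int_mult_distrib[of "-1" "x / y" b]
      by (simp add: power_int_mult_distrib power_int_divide_distrib)
    then show ?thesis using xy by (simp add: power_int_add power_int_diff)
  qed
  have ev: "?f (k + l, k - l) = gauss (p\<^sup>2) (- (- (x\<^sup>2))) k * gauss (p\<^sup>2) (- (- (p * y\<^sup>2))) l" for k l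
  proof -
    have "itri (k + l) + itri (k - l) = 2 * itri k + (2 * itri l + l)"
      using two_itri[of k] two_itri[of l] two_itri[of "k + l"] two_itri[of "k - l"]
      by (simp add: algebra_simps)
    then have "p powi itri (k + l) * p powi itri (k - l) = p powi (2 * itri k + (2 * itri l + l))"
      using p by (simp only: power_int_add[symmetric] simp_thms)
    also have "\<dots> = (p\<^sup>2) powi itri k * ((p\<^sup>2) powi itri l * p powi l)"
      using p by (simp add: power_int_add power_int_mult)
    finally have 1: "p powi itri (k + l) * p powi itri (k - l) = \<dots>" .
    have 2: "(- (x * y)) powi (k + l) * (- (x / y)) powi (k - l) = (x\<^sup>2) powi k * (y\<^sup>2) powi l"
      unfolding xy_powi by (simp add: power_int_mult)
    have "?f (k + l, k - l) = (p powi itri (k + l) * p powi itri (k - l)) *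
        ((- (x * y)) powi (k + l) * (- (x / y)) powi (k - l))"
      by (simp only: gauss_def prod.case mult_ac)
    also have "\<dots> = gauss (p\<^sup>2) (- (- (x\<^sup>2))) k * gauss (p\<^sup>2) (- (- (p * y\<^sup>2))) l"
      unfolding 1 2 by (simp add: gauss_def power_int_mult_distrib)
    finally show ?thesis .
  qed
  have od: "?f (k + l + 1, k - l) =
      (- x * y) * (gauss (p\<^sup>2) (- (- (p * x\<^sup>2))) k * gauss (p\<^sup>2) (- (- (p\<^sup>2 * y\<^sup>2))) l)" for k l
  proof -
    have "itri (k + l + 1) + itri (k - l) = (2 * itri k + k) + (2 * itri l + 2 * l)"
      using two_itri[of k] two_itri[of l] two_itri[of "k + l + 1"] two_itri[of "k - l"]
      by (simp add: algebra_simps)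
    then have "p powi itri (k + l + 1) * p powi itri (k - l) =
        p powi ((2 * itri k + k) + (2 * itri l + 2 * l))"
      using p by (simp only: power_int_add[symmetric] simp_thms)
    also have "\<dots> = ((p\<^sup>2) powi itri k * p powi k) * ((p\<^sup>2) powi itri l * (p\<^sup>2) powi l)"
      using p by (simp add: power_int_add power_int_mult)
    finally have 1: "p powi itri (k + l + 1) * p powi itri (k - l) = \<dots>" .
    have 2: "(- (x * y)) powi (k + l + 1) * (- (x / y)) powi (k - l) =
        (- x * y) * ((x\<^sup>2) powi k * (y\<^sup>2) powi l)"
      unfolding xy_powi using xy by (simp add: power_int_mult power_int_add)
    have "?f (k + l + 1, k - l) = (p powi itri (k + l + 1) * p powi itri (k - l)) *
        ((- (x * y)) powi (k + l + 1) * (- (x / y)) powi (k - l))"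
      by (simp only: gauss_def prod.case mult_ac)
    also have "\<dots> = (- x * y) * (gauss (p\<^sup>2) (- (- (p * x\<^sup>2))) k * gauss (p\<^sup>2) (- (- (p\<^sup>2 * y\<^sup>2))) l)"
      unfolding 1 2 by (simp add: gauss_def power_int_mult_distrib)
    finally show ?thesis .
  qed
  have "((?f \<circ> ?e) has_sum theta (p\<^sup>2) (- (x\<^sup>2)) * thetaA p y) UNIV"
    using gauss_product_has_sum[OF p2 p2, of "- (x\<^sup>2)" "- (p * y\<^sup>2)"] p xy
    by (simp add: o_def case_prod_unfold thetaA_def ev[unfolded prod.case])
  then have E: "(?f has_sum theta (p\<^sup>2) (- (x\<^sup>2)) * thetaA p y) (range ?e)"
    by (subst has_sum_reindex) (auto simp: inj_on_def)
  have "((\<lambda>z. (- x * y) * (case z of (k, l) \<Rightarrow>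
      gauss (p\<^sup>2) (- (- (p * x\<^sup>2))) k * gauss (p\<^sup>2) (- (- (p\<^sup>2 * y\<^sup>2))) l)) has_sum
      (- x * y) * (thetaA p x * theta (p\<^sup>2) (- (p\<^sup>2 * y\<^sup>2)))) UNIV"
    unfolding thetaA_def by (intro has_sum_cmult_right gauss_product_has_sum) (use p2 p xy in auto)
  then have "((?f \<circ> ?o) has_sum (- x * y) * (thetaA p x * theta (p\<^sup>2) (- (p\<^sup>2 * y\<^sup>2)))) UNIV"
    by (simp add: o_def case_prod_unfold od[unfolded prod.case])
  then have O: "(?f has_sum (- x * y) * (thetaA p x * theta (p\<^sup>2) (- (p\<^sup>2 * y\<^sup>2)))) (range ?o)"
    by (subst has_sum_reindex) (auto simp: inj_on_def)
  have disj: "range ?e \<inter> range ?o = {}" and un: "range ?e \<union> range ?o = UNIV"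
    by (rule int_pair_parity)+
  have 1: "theta p (x * y) * theta p (x / y) =
     theta (p\<^sup>2) (- (x\<^sup>2)) * thetaA p y + (- x * y) * (thetaA p x * theta (p\<^sup>2) (- (p\<^sup>2 * y\<^sup>2)))"
    using has_sum_Un_disjoint[OF E O disj] S unfolding un by (rule has_sum_unique[rotated])
  have 2: "theta (p\<^sup>2) (- (x\<^sup>2)) = x * thetaB p x"
    using theta_mult_base[OF p2, of "- (x\<^sup>2)"] xy by (simp add: thetaB_def power2_eq_square)
  have 3: "thetaB p y = y * theta (p\<^sup>2) (- (p\<^sup>2 * y\<^sup>2))" by (simp add: thetaB_def)
  have 4: "x * b * a' + - x * y * (a * c) = x * (b * a' - a * (y * c))" for a b a' c :: complex
    by algebra
  show ?thesis unfolding 1 unfolding 2 3 by (rule 4)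
qed

text \<open>With \<open>n = j - 2 * l + r\<close> and \<open>m = j + l\<close> one has
  \<open>n + 2 * m = 3 * j + r\<close>, so \<open>r\<close> is the class of \<open>n + 2 * m\<close>
  modulo 3. This substitution separates \<open>j\<close> from \<open>l\<close> in the exponent of
  the quintuple product.\<close>

lemma has_sum_UNIV_mod_3:
  fixes f :: "int \<times> int \<Rightarrow> complex"
  assumes f: "(f has_sum S) UNIV"
    and c: "\<And>r. r \<in> {0, 1, 2} \<Longrightarrow> ((\<lambda>(j, l). f (j - 2 * l + r, j + l)) has_sum T r) UNIV"
  shows "S = T 0 + T 1 + T 2"
proof -
  have "(f has_sum S) UNIV \<longleftrightarrow>
      ((\<lambda>(r, j, l). f (j - 2 * l + r, j + l)) has_sum S) ({0, 1, 2} \<times> UNIV)"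
  proof (rule has_sum_reindex_bij_witness[of _
        "\<lambda>(r, j, l). (j - 2 * l + r, j + l)"
        "\<lambda>(n, m). ((n + 2 * m) mod 3, (n + 2 * m) div 3, m - (n + 2 * m) div 3)"])
    fix a :: "int \<times> int"
    obtain n m where a: "a = (n, m)" by (cases a)
    have k: "3 * ((n + 2 * m) div 3) - 2 * m + (n + 2 * m) mod 3 = n"
      using mult_div_mod_eq[of 3 "n + 2 * m"] by linarith
    then show "(case case a of (n, m) \<Rightarrow> ((n + 2 * m) mod 3, (n + 2 * m) div 3, m - (n + 2 * m) div 3) of
        (r, j, l) \<Rightarrow> (j - 2 * l + r, j + l)) = a"
      by (simp add: a)
    show "(case a of (n, m) \<Rightarrow> ((n + 2 * m) mod 3, (n + 2 * m) div 3, m - (n + 2 * m) div 3))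
        \<in> {0, 1, 2} \<times> UNIV"
      using pos_mod_bound[of 3 "n + 2 * m"] pos_mod_sign[of 3 "n + 2 * m"] by (auto simp: a)
    then show "(case case a of (n, m) \<Rightarrow> ((n + 2 * m) mod 3, (n + 2 * m) div 3, m - (n + 2 * m) div 3) of
        (r, j, l) \<Rightarrow> f (j - 2 * l + r, j + l)) = f a"
      by (simp add: a k)
  next
    fix b :: "int \<times> int \<times> int" assume b: "b \<in> {0, 1, 2} \<times> UNIV"
    obtain r j l where rjl: "b = (r, j, l)" by (cases b)
    have "j - 2 * l + r + 2 * (j + l) = 3 * j + r" by simp
    moreover have "(3 * j + r) div 3 = j" "(3 * j + r) mod 3 = r" using b rjl by auto
    ultimately show "(case case b of (r, j, l) \<Rightarrow> (j - 2 * l + r, j + l) of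
        (n, m) \<Rightarrow> ((n + 2 * m) mod 3, (n + 2 * m) div 3, m - (n + 2 * m) div 3)) = b"
      by (simp add: rjl)
  qed auto
  with f have "((\<lambda>(r, j, l). f (j - 2 * l + r, j + l)) has_sum S) ({0, 1, 2} \<times> UNIV)" by simp
  then have "(T has_sum S) {0, 1, 2}"
    by (rule has_sum_Sigma') (use c in auto)
  then show ?thesis by (simp add: has_sum_finite_iff add.assoc)
qed

text \<open>The double series of \<open>theta p (- x) * theta (p^2) (p * x^2)\<close> is split into
  three classes. The last one carries a theta function at 1 and vanishes; the other two share the
  constant \<open>qpoch_inf (p^2) (p^2)\<close>. Multiplication by \<open>theta p x\<close>
  completes the left product to \<open>theta p (x^2)\<close>, by pairing \<open>x\<close> with
  \<open>- x\<close> and then even with odd factors.\<close>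

theorem quintuple_product:
  assumes p: "p \<noteq> 0" "norm p < 1" and x: "x \<noteq> 0"
  shows "theta p x * (theta (p ^ 3) (p\<^sup>2 / x ^ 3) + x * theta (p ^ 3) (p\<^sup>2 * x ^ 3)) =
    qpoch_inf p p * theta p (x\<^sup>2)"
proof -
  have p2: "p\<^sup>2 \<noteq> 0" "norm (p\<^sup>2) < 1" and p3: "p ^ 3 \<noteq> 0" "norm (p ^ 3) < 1"
    and p6: "p ^ 6 \<noteq> 0" "norm (p ^ 6) < 1"
    using p by (auto simp: norm_power power_less_one_iff)
  let ?f = "\<lambda>(n, m). gauss p (- (- x)) n * gauss (p\<^sup>2) (- (p * x\<^sup>2)) m"
  define sgn where "sgn = (\<lambda>n::int. (-1 :: complex) powi n)"
  have neg: "(- y) powi n = sgn n * y powi n" for y :: complex and n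
    using power_int_mult_distrib[of "-1" y n] by (simp add: sgn_def)
  have f_eq: "?f (n, m) = sgn m * p powi (itri n + 2 * itri m + m) * x powi (n + 2 * m)" for n m
    using p x by (simp add: gauss_def neg power_int_mult_distrib power_int_add power_int_mult)
  have g_eq: "gauss (p ^ 3) (- (p ^ c * x ^ 3)) j * gauss (p ^ 6) (- (p ^ d)) l =
      sgn (j + l) * p powi (3 * itri j + int c * j + (6 * itri l + int d * l)) * x powi (3 * j)" for c d j l
  proof -
    have pw: "(y ^ n) powi k = y powi (int n * k)" for y :: complex and n k
      by (simp only: power_int_mult power_int_of_nat)
    have "sgn (j + l) = sgn j * sgn l" by (simp add: sgn_def power_int_add)
    moreover have "p powi (3 * itri j + int c * j + (6 * itri l + int d * l)) =
        p powi (3 * itri j) * p powi (int c * j) * (p powi (6 * itri l) * p powi (int d * l))"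
      using p by (simp only: power_int_add simp_thms)
    ultimately show ?thesis
      unfolding gauss_def neg power_int_mult_distrib pw by (simp only: of_nat_numeral mult_ac)
  qed
  have e0: "?f (j - 2 * l + 0, j + l) = gauss (p ^ 3) (- (p ^ 1 * x ^ 3)) j * gauss (p ^ 6) (- (p ^ 4)) l" for j l
  proof -
    have "itri (j - 2 * l + 0) + 2 * itri (j + l) + (j + l) = 3 * itri j + int 1 * j + (6 * itri l + int 4 * l)"
      using two_itri[of "j - 2 * l + 0"] two_itri[of "j + l"] two_itri[of j] two_itri[of l]
      by (simp add: algebra_simps)
    moreover have "j - 2 * l + 0 + 2 * (j + l) = 3 * j" by simp
    ultimately show ?thesis unfolding f_eq g_eq by (simp only:)
  qed
  have e1: "?f (j - 2 * l + 1, j + l) = x * (gauss (p ^ 3) (- (p ^ 2 * x ^ 3)) j * gauss (p ^ 6) (- (p ^ 2)) l)" for j l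
  proof -
    have "itri (j - 2 * l + 1) + 2 * itri (j + l) + (j + l) = 3 * itri j + int 2 * j + (6 * itri l + int 2 * l)"
      using two_itri[of "j - 2 * l + 1"] two_itri[of "j + l"] two_itri[of j] two_itri[of l]
      by (simp add: algebra_simps)
    moreover have "x powi (j - 2 * l + 1 + 2 * (j + l)) = x * x powi (3 * j)"
      using x by (simp add: power_int_add)
    ultimately show ?thesis unfolding f_eq g_eq by (simp only: mult_ac)
  qed
  have e2: "?f (j - 2 * l + 2, j + l) = p * x\<^sup>2 * (gauss (p ^ 3) (- (p ^ 3 * x ^ 3)) j * gauss (p ^ 6) (- (p ^ 0)) l)" for j l
  proof -
    have "itri (j - 2 * l + 2) + 2 * itri (j + l) + (j + l) = 1 + (3 * itri j + int 3 * j + (6 * itri l + int 0 * l))"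
      using two_itri[of "j - 2 * l + 2"] two_itri[of "j + l"] two_itri[of j] two_itri[of l]
      by (simp add: algebra_simps)
    then have "p powi (itri (j - 2 * l + 2) + 2 * itri (j + l) + (j + l)) =
        p * p powi (3 * itri j + int 3 * j + (6 * itri l + int 0 * l))"
      using p by (simp only: power_int_add simp_thms power_int_1_right)
    moreover have "x powi (j - 2 * l + 2 + 2 * (j + l)) = x\<^sup>2 * x powi (3 * j)"
      using x by (simp add: power_int_add)
    ultimately show ?thesis unfolding f_eq g_eq by (simp only: mult_ac)
  qed
  have S: "((\<lambda>(j, l). gauss (p ^ 3) (- (p ^ c * x ^ 3)) j * gauss (p ^ 6) (- (p ^ d)) l) has_sum
      theta (p ^ 3) (p ^ c * x ^ 3) * theta (p ^ 6) (p ^ d)) UNIV" for c d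
    by (rule gauss_product_has_sum) (use p3 p6 p x in auto)
  define T where "T = (\<lambda>r :: int.
    if r = 0 then theta (p ^ 3) (p ^ 1 * x ^ 3) * theta (p ^ 6) (p ^ 4)
    else if r = 1 then x * (theta (p ^ 3) (p ^ 2 * x ^ 3) * theta (p ^ 6) (p ^ 2))
    else p * x\<^sup>2 * (theta (p ^ 3) (p ^ 3 * x ^ 3) * theta (p ^ 6) (p ^ 0)))"
  have main: "theta p (- x) * theta (p\<^sup>2) (p * x\<^sup>2) = T 0 + T 1 + T 2"
  proof (rule has_sum_UNIV_mod_3)
    show "(?f has_sum theta p (- x) * theta (p\<^sup>2) (p * x\<^sup>2)) UNIV"
      by (rule gauss_product_has_sum) (use p p2 x in auto)
  next
    fix r :: int assume "r \<in> {0, 1, 2}"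
    then consider "r = 0" | "r = 1" | "r = 2" by blast
    then show "((\<lambda>(j, l). ?f (j - 2 * l + r, j + l)) has_sum T r) UNIV"
    proof cases
      case 1 show ?thesis unfolding 1 e0 using S[of 1 4] by (simp add: T_def)
    next
      case 2 show ?thesis unfolding 2 e1
        using has_sum_cmult_right[OF S[of 2 2], of x] by (simp add: T_def case_prod_unfold)
    next
      case 3 show ?thesis unfolding 3 e2
        using has_sum_cmult_right[OF S[of 3 0], of "p * x\<^sup>2"] by (simp add: T_def case_prod_unfold)
    qed
  qed
  have h0: "theta (p ^ 6) (p ^ 0) = 0" using theta_1[OF p6(2)] by simp
  have h2: "theta (p ^ 6) (p ^ 2) = qpoch_inf (p\<^sup>2) (p\<^sup>2)" "theta (p ^ 6) (p ^ 4) = qpoch_inf (p\<^sup>2) (p\<^sup>2)"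
    using theta_cube_base[OF p2] by (simp_all flip: power_mult)
  have h3: "theta (p ^ 3) (p ^ 1 * x ^ 3) = theta (p ^ 3) (p\<^sup>2 / x ^ 3)"
  proof -
    have "p ^ 3 / (p ^ 1 * x ^ 3) = p\<^sup>2 / x ^ 3"
      using p by (simp add: power3_eq_cube power2_eq_square)
    moreover have "p ^ 1 * x ^ 3 \<noteq> 0" using p x by simp
    note theta_reflect[OF p3(1) this]
    ultimately show ?thesis by (simp only:)
  qed
  have T0: "T 0 = theta (p ^ 3) (p\<^sup>2 / x ^ 3) * qpoch_inf (p\<^sup>2) (p\<^sup>2)"
    by (simp only: T_def h2 h3 if_True refl)
  have T1: "T 1 = x * (theta (p ^ 3) (p\<^sup>2 * x ^ 3) * qpoch_inf (p\<^sup>2) (p\<^sup>2))"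
    by (simp only: T_def h2 if_True if_False refl one_neq_zero)
  have T2: "T 2 = 0" unfolding T_def h0 by simp
  have *: "theta p (- x) * theta (p\<^sup>2) (p * x\<^sup>2) =
     qpoch_inf (p\<^sup>2) (p\<^sup>2) * (theta (p ^ 3) (p\<^sup>2 / x ^ 3) + x * theta (p ^ 3) (p\<^sup>2 * x ^ 3))"
    unfolding main T0 T1 T2 by (simp only: add_0_right distrib_left mult_ac)
  have nz: "qpoch_inf (p\<^sup>2) (p\<^sup>2) \<noteq> 0" by (rule qpoch_inf_nonzero[OF p2(2) p2(2)])
  have a: "qpoch_inf (x\<^sup>2) p = qpoch_inf x p * qpoch_inf (- x) p * qpoch_inf (p * x\<^sup>2) (p\<^sup>2)"
    unfolding qpoch_inf_square[OF p(2), of x, symmetric] mult.commute[of p "x\<^sup>2"]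
    by (rule qpoch_inf_base2[OF p(2)])
  have px: "p / x\<^sup>2 * p = (p / x)\<^sup>2" "p / - x = - (p / x)"
    by (simp_all add: power_divide power2_eq_square)
  have b: "qpoch_inf (p / x\<^sup>2) p = qpoch_inf (p / x) p * qpoch_inf (p / - x) p * qpoch_inf (p / x\<^sup>2) (p\<^sup>2)"
  proof -
    have "qpoch_inf (p / x\<^sup>2) p = qpoch_inf (p / x\<^sup>2) (p\<^sup>2) * qpoch_inf ((p / x)\<^sup>2) (p\<^sup>2)"
      using qpoch_inf_base2[OF p(2), of "p / x\<^sup>2"] unfolding px(1) .
    then show ?thesis unfolding qpoch_inf_square[OF p(2)] px(2) by (simp only: mult_ac)
  qed
  have "p\<^sup>2 / (p * x\<^sup>2) = p / x\<^sup>2" using p by (simp add: power2_eq_square)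
  then have c: "theta (p\<^sup>2) (p * x\<^sup>2) = qpoch_inf (p * x\<^sup>2) (p\<^sup>2) * qpoch_inf (p / x\<^sup>2) (p\<^sup>2) * qpoch_inf (p\<^sup>2) (p\<^sup>2)"
    by (simp add: theta_def)
  have "qpoch_inf (p\<^sup>2) (p\<^sup>2) * (qpoch_inf p p * theta p (x\<^sup>2)) =
      theta p x * (theta p (- x) * theta (p\<^sup>2) (p * x\<^sup>2))"
    unfolding c unfolding theta_def a b by (simp only: mult_ac)
  then show ?thesis unfolding * using nz by (simp add: mult_ac)
qed

section \<open>Derivatives of theta functions\<close>

lemma qpoch_inf_field_derivative [derivative_intros]:
  assumes "norm q < 1" "(g has_field_derivative g') (at x within s)"
  shows "((\<lambda>x. qpoch_inf (g x) q) has_field_derivative deriv (\<lambda>x. qpoch_inf x q) (g x) * g') (at x within s)"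
  using qpoch_inf_field_differentiable[OF assms(1)] assms(2)
  by (intro DERIV_chain2) (auto simp: field_differentiable_derivI)

definition thetaD :: "complex \<Rightarrow> complex \<Rightarrow> complex" where
  "thetaD q x = x * deriv (theta q) x"

lemma theta_has_derivative:
  assumes "norm q < 1" "x \<noteq> 0"
  shows "(theta q has_field_derivative thetaD q x / x) (at x)"
proof -
  have "theta q field_differentiable (at x)"
    unfolding theta_def field_differentiable_def
    by (rule exI) (rule derivative_eq_intros refl assms | use assms in simp)+
  then show ?thesis using assms by (simp add: thetaD_def field_differentiable_derivI)
qed

lemma theta_chain:
  assumes "norm q < 1" "g x \<noteq> 0" "(g has_field_derivative g') (at x within s)"
  shows "((\<lambda>x. theta q (g x)) has_field_derivative thetaD q (g x) / g x * g') (at x within s)"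
  by (rule DERIV_chain2[OF theta_has_derivative[OF assms(1,2)] assms(3)])

lemma thetaD_eqI:
  assumes "(theta q has_field_derivative d) (at x)"
  shows "thetaD q x = x * d"
  using DERIV_imp_deriv[OF assms] by (simp add: thetaD_def)

lemma thetaD_explicit:
  assumes "norm q < 1" "x \<noteq> 0"
  shows "thetaD q x = (x * deriv (\<lambda>x. qpoch_inf x q) x * qpoch_inf (q / x) q
     - q / x * deriv (\<lambda>x. qpoch_inf x q) (q / x) * qpoch_inf x q) * qpoch_inf q q"
proof -
  have "(theta q has_field_derivative
      (deriv (\<lambda>x. qpoch_inf x q) x * qpoch_inf (q / x) q
        - q / x\<^sup>2 * deriv (\<lambda>x. qpoch_inf x q) (q / x) * qpoch_inf x q) * qpoch_inf q q) (at x)"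
    unfolding theta_def
    by (rule derivative_eq_intros refl assms | use assms in \<open>simp add: power2_eq_square algebra_simps\<close>)+
  from thetaD_eqI[OF this] show ?thesis using assms(2) by (simp add: power2_eq_square algebra_simps)
qed

lemma thetaD_reflect:
  assumes "norm q < 1" "q \<noteq> 0" "x \<noteq> 0"
  shows "thetaD q (q / x) = - thetaD q x"
  unfolding thetaD_explicit[OF assms(1,3)] using assms
  by (subst thetaD_explicit) (auto simp: algebra_simps)

text \<open>Theta has a simple zero at 1, so only the derivative of its factor \<open>1 - x\<close>
  survives there.\<close>

lemma thetaD_1:
  assumes "norm q < 1"
  shows "thetaD q 1 = - (qpoch_inf q q ^ 3)"
proof -
  let ?g = "\<lambda>x. qpoch_inf (q * x) q * qpoch_inf (q / x) q * qpoch_inf q q"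
  have "theta q = (\<lambda>x. (1 - x) * ?g x)"
    unfolding theta_def by (rule ext, subst qpoch_inf_rec[OF assms]) (simp add: mult_ac)
  moreover obtain g' where "(?g has_field_derivative g') (at 1)"
  proof
    show "(?g has_field_derivative (deriv (\<lambda>x. qpoch_inf x q) q * q * qpoch_inf q q
        - q * deriv (\<lambda>x. qpoch_inf x q) q * qpoch_inf q q) * qpoch_inf q q) (at 1)"
      by (rule derivative_eq_intros refl assms | simp add: algebra_simps)+
  qed
  then have "((\<lambda>x. (1 - x) * ?g x) has_field_derivative (0 - 1) * ?g 1 + g' * (1 - 1)) (at 1)"
    by (intro DERIV_mult DERIV_diff DERIV_const DERIV_ident)
  ultimately show ?thesis using thetaD_eqI[of q _ 1] by (simp add: power3_eq_cube)
qed

lemma thetaD_mult_base: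
  assumes "norm q < 1" "q \<noteq> 0" "x \<noteq> 0"
  shows "thetaD q (q * x) = (theta q x - thetaD q x) / x"
proof -
  have 1: "((\<lambda>x. theta q (q * x)) has_field_derivative thetaD q (q * x) / (q * x) * q) (at x)"
    by (rule theta_chain) (use assms in \<open>auto intro!: derivative_eq_intros\<close>)
  have 2: "((\<lambda>x. - theta q x / x) has_field_derivative
      (- (thetaD q x / x) * x - (- theta q x) * 1) / (x * x)) (at x)"
    by (intro DERIV_divide DERIV_minus DERIV_ident theta_has_derivative assms)
  have "\<forall>\<^sub>F y in nhds x. y \<noteq> 0" using assms(3) by (rule t1_space_nhds)
  then have "\<forall>\<^sub>F y in nhds x. theta q (q * y) = - theta q y / y"
    by eventually_elim (rule theta_mult_base[OF assms(2,1)])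
  from iffD1[OF DERIV_cong_ev[OF refl this refl] 1] 2
  have "thetaD q (q * x) / (q * x) * q = (- (thetaD q x / x) * x - (- theta q x) * 1) / (x * x)"
    by (rule DERIV_unique)
  then show ?thesis using assms by (simp add: field_simps)
qed

lemma thetaD_inverse:
  assumes "norm q < 1" "q \<noteq> 0" "x \<noteq> 0"
  shows "thetaD q (1 / x) = (thetaD q x - theta q x) / x"
proof -
  have "thetaD q (q / (q * x)) = - thetaD q (q * x)"
    using assms by (intro thetaD_reflect) auto
  then show ?thesis using assms by (simp add: thetaD_mult_base minus_divide_left)
qed

definition theta_log_deriv :: "complex \<Rightarrow> complex \<Rightarrow> complex" where
  "theta_log_deriv q x = thetaD q x / theta q x"

text \<open>Existence suffices: the values of these derivatives are eliminated in
  \<open>theta_log_deriv_relation\<close>.\<close>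

lemma thetaA_thetaB_differentiable:
  assumes "p \<noteq> 0" "norm p < 1" "x \<noteq> 0"
  shows "thetaA p field_differentiable (at x)" "thetaB p field_differentiable (at x)"
proof -
  have p2: "norm (p\<^sup>2) < 1"
    using assms(2) by (simp add: norm_power power_less_one_iff)
  have chain: "((\<lambda>x. theta (p\<^sup>2) (- (c * x\<^sup>2))) has_field_derivative
      thetaD (p\<^sup>2) (- (c * x\<^sup>2)) / (- (c * x\<^sup>2)) * (- (c * (2 * x)))) (at x)" if "c \<noteq> 0" for c
  proof (rule theta_chain[OF p2])
    show "- (c * x\<^sup>2) \<noteq> 0" using that assms(3) by simp
    have "((\<lambda>x. c * x\<^sup>2) has_field_derivative c * (2 * x)) (at x)"
      by (auto intro!: derivative_eq_intros)
    then show "((\<lambda>x. - (c * x\<^sup>2)) has_field_derivative - (c * (2 * x))) (at x)"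
      by (rule DERIV_minus)
  qed
  show "thetaA p field_differentiable (at x)"
    unfolding thetaA_def field_differentiable_def by (rule exI, rule chain[OF assms(1)])
  have "p\<^sup>2 \<noteq> 0" using assms(1) by simp
  from DERIV_mult[OF DERIV_ident chain[OF this]] show "thetaB p field_differentiable (at x)"
    unfolding thetaB_def field_differentiable_def by (rule exI)
qed

section \<open>Three-term relations and their derivatives\<close>

definition theta_bracket :: "complex \<Rightarrow> complex \<Rightarrow> complex \<Rightarrow> complex" where
  "theta_bracket p x y = theta p (x * y) * theta p (x / y) / x"

lemma theta_bracket_eq:
  assumes "p \<noteq> 0" "norm p < 1" "x \<noteq> 0" "y \<noteq> 0"
  shows "theta_bracket p x y = thetaB p x * thetaA p y - thetaA p x * thetaB p y"
  using theta_product_det[OF assms] assms(3) by (simp add: theta_bracket_def)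

text \<open>By \<open>theta_bracket_eq\<close> the brackets are the minors of a matrix with two rows
  and four columns, and minors satisfy the Pluecker relation.\<close>

theorem theta_pluecker:
  assumes "p \<noteq> 0" "norm p < 1" "x \<noteq> 0" "y \<noteq> 0" "z \<noteq> 0" "w \<noteq> 0"
  shows "theta_bracket p x y * theta_bracket p z w - theta_bracket p x z * theta_bracket p y w +
    theta_bracket p x w * theta_bracket p y z = 0"
  unfolding theta_bracket_eq[OF assms(1-3,4)] theta_bracket_eq[OF assms(1,2,5,6)]
    theta_bracket_eq[OF assms(1-3,5)] theta_bracket_eq[OF assms(1,2,4,6)]
    theta_bracket_eq[OF assms(1-3,6)] theta_bracket_eq[OF assms(1,2,4,5)]
  by algebra

text \<open>Differentiating the determinant in its first argument replaces one column by the unknown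
  derivatives \<open>a\<close>, \<open>b\<close>. Three such determinants, with second argument
  \<open>y\<close>, \<open>z\<close> and \<open>x\<close>, are linearly dependent. For second
  argument \<open>x\<close> the value is explicit, because theta vanishes at 1 and its derivative
  there is minus the cube of the Euler product.\<close>

theorem theta_log_deriv_relation:
  assumes p: "p \<noteq> 0" "norm p < 1" and nz: "x \<noteq> 0" "y \<noteq> 0" "z \<noteq> 0"
    and th: "theta p (x * y) \<noteq> 0" "theta p (x / y) \<noteq> 0" "theta p (x * z) \<noteq> 0" "theta p (x / z) \<noteq> 0"
  shows "theta_bracket p x y * theta_bracket p x z *
      (theta_log_deriv p (x * y) + theta_log_deriv p (x / y)
        - theta_log_deriv p (x * z) - theta_log_deriv p (x / z)) =
      - theta p (x\<^sup>2) * qpoch_inf p p ^ 3 / x * theta_bracket p y z"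
proof -
  obtain a b where a: "(thetaA p has_field_derivative a) (at x)"
    and b: "(thetaB p has_field_derivative b) (at x)"
    using thetaA_thetaB_differentiable[OF p nz(1)] unfolding field_differentiable_def by blast
  have ring: "x * (((A / x * T' + B / x * T) * x - T * T' * 1) / (x * x)) =
      (A * T' + T * B) / x - T * T' / x" for A B T T' :: complex
    using nz(1) by (simp add: divide_simps)
  have D: "x * (b * thetaA p y - a * thetaB p y) =
     (thetaD p (x * y) * theta p (x / y) + theta p (x * y) * thetaD p (x / y)) / x
       - theta p (x * y) * theta p (x / y) / x" if y: "y \<noteq> 0" for y
  proof -
    have 1: "((\<lambda>x. thetaB p x * thetaA p y - thetaA p x * thetaB p y) has_field_derivative
        b * thetaA p y - a * thetaB p y) (at x)"
      by (intro DERIV_diff DERIV_cmult_right a b)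
    have "((\<lambda>x. theta p (x * y)) has_field_derivative thetaD p (x * y) / (x * y) * y) (at x)"
      by (rule theta_chain) (use p nz y in \<open>auto intro!: derivative_eq_intros\<close>)
    also have "thetaD p (x * y) / (x * y) * y = thetaD p (x * y) / x" using y by simp
    finally have 3: "((\<lambda>x. theta p (x * y)) has_field_derivative thetaD p (x * y) / x) (at x)" .
    have "((\<lambda>x. theta p (x / y)) has_field_derivative thetaD p (x / y) / (x / y) * (1 / y)) (at x)"
      by (rule theta_chain) (use p nz y in \<open>auto intro!: derivative_eq_intros\<close>)
    also have "thetaD p (x / y) / (x / y) * (1 / y) = thetaD p (x / y) / x" using y by simp
    finally have 4: "((\<lambda>x. theta p (x / y)) has_field_derivative thetaD p (x / y) / x) (at x)" .
    have 2: "((\<lambda>x. theta_bracket p x y) has_field_derivative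
        ((thetaD p (x * y) / x * theta p (x / y) +
          thetaD p (x / y) / x * theta p (x * y)) * x -
         theta p (x * y) * theta p (x / y) * 1) / (x * x)) (at x)"
      unfolding theta_bracket_def by (rule DERIV_divide[OF DERIV_mult[OF 3 4] DERIV_ident nz(1)])
    have "((\<lambda>x. thetaB p x * thetaA p y - thetaA p x * thetaB p y) has_field_derivative
        ((thetaD p (x * y) / x * theta p (x / y) +
          thetaD p (x / y) / x * theta p (x * y)) * x -
         theta p (x * y) * theta p (x / y) * 1) / (x * x)) (at x)"
      using 2
    proof (rule has_field_derivative_transform_within_open)
      show "open (- {0 :: complex})" by (intro open_Compl closed_singleton)
      show "x \<in> - {0}" using nz by simp
      show "theta_bracket p u y = thetaB p u * thetaA p y - thetaA p u * thetaB p y" if "u \<in> - {0}" for u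
        using that by (intro theta_bracket_eq p y) simp
    qed
    note e = DERIV_unique[OF 1 this]
    show ?thesis unfolding e by (rule ring)
  qed
  \<comment> \<open>The \<open>- 1\<close> stems from the division by \<open>x\<close> in the
    bracket; it cancels between \<open>y\<close> and \<open>z\<close>.\<close>
  have L: "x * (b * thetaA p y - a * thetaB p y) =
      theta_bracket p x y * (theta_log_deriv p (x * y) + theta_log_deriv p (x / y) - 1)"
    if "y \<noteq> 0" "theta p (x * y) \<noteq> 0" "theta p (x / y) \<noteq> 0" for y
  proof -
    have "(A * T' + T * B) / x - T * T' / x = T * T' / x * (A / T + B / T' - 1)"
      if "T \<noteq> 0" "T' \<noteq> 0" for A B T T' :: complex
      using that nz(1) by (simp add: divide_simps, (simp add: algebra_simps)?)
    from this[OF that(2,3)] show ?thesis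
      unfolding D[OF that(1)] theta_bracket_def theta_log_deriv_def .
  qed
  have M: "x * (b * thetaA p x - a * thetaB p x) = - theta p (x\<^sup>2) * qpoch_inf p p ^ 3 / x"
    unfolding D[OF nz(1)] using nz by (simp add: theta_1[OF p(2)] thetaD_1[OF p(2)] power2_eq_square)
  have "(x * (b * thetaA p y - a * thetaB p y)) * theta_bracket p x z
      - (x * (b * thetaA p z - a * thetaB p z)) * theta_bracket p x y
    = (x * (b * thetaA p x - a * thetaB p x)) * theta_bracket p y z"
    unfolding theta_bracket_eq[OF p nz(1,2)] theta_bracket_eq[OF p nz(1,3)] theta_bracket_eq[OF p nz(2,3)]
    by algebra
  moreover have "b1 * b2 * (e1 + e2 - e3 - e4) = (b1 * (e1 + e2 - 1)) * b2 - (b2 * (e3 + e4 - 1)) * b1"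
    for b1 b2 e1 e2 e3 e4 :: complex by algebra
  ultimately show ?thesis
    unfolding M L[OF nz(2) th(1,2)] L[OF nz(3) th(3,4)] by simp
qed

section \<open>The crank generating function\<close>

definition mset_weight :: "(nat \<Rightarrow> complex) \<Rightarrow> nat multiset \<Rightarrow> complex" where
  "mset_weight w p = prod_mset (image_mset w p)"

lemma mset_weight_add: "mset_weight w (p + r) = mset_weight w p * mset_weight w r"
  by (simp add: mset_weight_def)

lemma mset_weight_replicate: "mset_weight w (replicate_mset k a) = w a ^ k"
  by (simp add: mset_weight_def)

lemma norm_mset_weight: "norm (mset_weight w p) = Re (mset_weight (\<lambda>x. of_real (norm (w x))) p)"
  unfolding mset_weight_def by (induction p) (simp_all add: norm_mult)

lemma filter_mset_neq_split:
  "replicate_mset (count p a) a + filter_mset (\<lambda>x. x \<noteq> a) p = p"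
  by (rule multiset_eqI) auto

text \<open>A multiset over \<open>insert a B\<close> is a multiplicity of \<open>a\<close> together
  with a multiset over \<open>B\<close>, so the sum gains one geometric factor.\<close>

lemma mset_weight_has_sum_insert:
  fixes B :: "nat set"
  assumes w: "norm (w a) < 1" and a: "a \<notin> B"
    and abs: "mset_weight w abs_summable_on {p. set_mset p \<subseteq> B}"
    and sum: "(mset_weight w has_sum S) {p. set_mset p \<subseteq> B}"
  shows "mset_weight w abs_summable_on {p. set_mset p \<subseteq> insert a B}"
    and "(mset_weight w has_sum (1 / (1 - w a)) * S) {p. set_mset p \<subseteq> insert a B}"
proof -
  have geo: "(\<lambda>k. w a ^ k) abs_summable_on UNIV"
    using w by (simp add: norm_power summable_on_UNIV_nonneg_real_iff summable_geometric)
  have geo_sum: "((\<lambda>k. w a ^ k) has_sum (1 / (1 - w a))) UNIV"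
    using geometric_sums[OF w] w
    by (intro norm_summable_imp_has_sum) (simp_all add: norm_power summable_geometric)
  let ?i = "\<lambda>(k, p). replicate_mset k a + p"
  let ?j = "\<lambda>p. (count p a, filter_mset (\<lambda>x. x \<noteq> a) p)"
  let ?AB = "{p. set_mset p \<subseteq> insert a B}" and ?B = "{p. set_mset p \<subseteq> B}"
  have bij: "bij_betw ?i (UNIV \<times> ?B) ?AB"
  proof (rule bij_betw_byWitness[where f' = ?j])
    have "?j (?i (k, p)) = (k, p)" if "set_mset p \<subseteq> B" for k p
    proof -
      have "a \<notin># p" using that a by auto
      then have "filter_mset (\<lambda>x. x \<noteq> a) p = p" "count p a = 0"
        by (auto simp: filter_mset_eq_conv count_eq_zero_iff)
      then show ?thesis by simp
    qed
    then show "\<forall>x\<in>UNIV \<times> ?B. ?j (?i x) = x" by blast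
    show "\<forall>p\<in>?AB. ?i (?j p) = p" by (simp add: filter_mset_neq_split)
    show "?i ` (UNIV \<times> ?B) \<subseteq> ?AB" by (auto simp: subset_iff split: if_splits)
    show "?j ` ?AB \<subseteq> UNIV \<times> ?B" by auto
  qed
  note T = has_sum_times[OF geo abs geo_sum sum]
  have eq: "mset_weight w (?i x) = (case x of (k, p) \<Rightarrow> w a ^ k * mset_weight w p)" for x
    by (cases x) (simp add: mset_weight_add mset_weight_replicate)
  show "(mset_weight w has_sum (1 / (1 - w a)) * S) ?AB"
    using T(1) has_sum_reindex_bij_betw[OF bij, of "mset_weight w"] unfolding eq by simp
  show "mset_weight w abs_summable_on ?AB"
    using T(2) summable_on_reindex_bij_betw[OF bij, of "\<lambda>p. norm (mset_weight w p)"] unfolding eq by simp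
qed

lemma mset_weight_has_sum_finite:
  assumes "finite A" "\<And>a. a \<in> A \<Longrightarrow> norm (w a) < 1"
  shows "mset_weight w abs_summable_on {p. set_mset p \<subseteq> A} \<and>
    (mset_weight w has_sum (\<Prod>a\<in>A. 1 / (1 - w a))) {p. set_mset p \<subseteq> A}"
  using assms
proof (induction A rule: finite_induct)
  case empty
  have "{p :: nat multiset. set_mset p \<subseteq> {}} = {{#}}" by auto
  then show ?case by (simp add: mset_weight_def has_sum_finite_iff)
next
  case (insert a A)
  from mset_weight_has_sum_insert[of w a A "\<Prod>a\<in>A. 1 / (1 - w a)"] insert
  show ?case by simp
qed

text \<open>A finite set that carries all but \<open>e\<close> of the sum of norms is eventually
  contained in \<open>T n\<close>, and what lies outside \<open>T n\<close> is then bounded by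
  \<open>e\<close>.\<close>

lemma infsum_increasing_limit:
  fixes f :: "'a \<Rightarrow> complex"
  assumes f: "f abs_summable_on S" and sub: "\<And>n. T n \<subseteq> S"
    and exh: "\<And>F. finite F \<Longrightarrow> F \<subseteq> S \<Longrightarrow> \<forall>\<^sub>F n in sequentially. F \<subseteq> T n"
  shows "(\<lambda>n. infsum f (T n)) \<longlonglongrightarrow> infsum f S"
proof (rule tendstoI)
  fix e :: real assume e: "e > 0"
  define V where "V = infsum (\<lambda>x. norm (f x)) S"
  have "((\<lambda>x. norm (f x)) has_sum V) S" unfolding V_def using f by (rule has_sum_infsum)
  then have "\<forall>\<^sub>F F in finite_subsets_at_top S. dist (sum (\<lambda>x. norm (f x)) F) V < e"
    unfolding has_sum_def using e by (rule tendstoD)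
  then obtain F where F: "finite F" "F \<subseteq> S" "dist (sum (\<lambda>x. norm (f x)) F) V < e"
    unfolding eventually_finite_subsets_at_top by blast
  from exh[OF F(1,2)] show "\<forall>\<^sub>F n in sequentially. dist (infsum f (T n)) (infsum f S) < e"
  proof eventually_elim
    case (elim n)
    have sT: "f summable_on T n" and sS: "f summable_on S"
      using f sub abs_summable_summable summable_on_subset_banach by blast+
    have aT: "f abs_summable_on T n" and aD: "f abs_summable_on (S - T n)"
      using f sub summable_on_subset_banach by (blast intro: summable_on_subset_banach)+
    have "infsum f S - infsum f (T n) = infsum f (S - T n)"
      using infsum_Diff[OF sS sT sub] by simp
    then have "dist (infsum f (T n)) (infsum f S) = norm (infsum f (S - T n))"
      by (simp add: dist_norm norm_minus_commute)
    also have "\<dots> \<le> infsum (\<lambda>x. norm (f x)) (S - T n)"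
      using aD by (rule norm_infsum_bound)
    also have "\<dots> = V - infsum (\<lambda>x. norm (f x)) (T n)"
      unfolding V_def using infsum_Diff[OF f aT sub] by simp
    also have "\<dots> \<le> V - sum (\<lambda>x. norm (f x)) F"
      using finite_sum_le_infsum[OF aT F(1) elim] by simp
    also have "\<dots> < e" using F(3) by (auto simp: dist_real_def)
    finally show ?case .
  qed
qed

definition no_ones :: "nat multiset set" where
  "no_ones = {p. \<forall>x\<in>#p. 2 \<le> x}"

lemma no_ones_exhaust:
  assumes "finite F" "F \<subseteq> no_ones"
  shows "\<exists>N. \<forall>n\<ge>N. F \<subseteq> {p. set_mset p \<subseteq> {2..<n}}"
  using assms
proof (induction F rule: finite_induct)
  case (insert p F)
  then obtain N where N: "\<And>n. n \<ge> N \<Longrightarrow> F \<subseteq> {p. set_mset p \<subseteq> {2..<n}}" by auto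
  obtain M where M: "\<And>x. x \<in># p \<Longrightarrow> x < M"
    using finite_nat_set_iff_bounded[of "set_mset p"] by auto
  have "\<And>x. x \<in># p \<Longrightarrow> 2 \<le> x" using insert.prems by (auto simp: no_ones_def)
  then show ?case using N M by (intro exI[of _ "max M N"]) (force simp: less_le_trans)
qed simp

text \<open>Every finite set of multisets uses finitely many parts, so its norm sum is at most
  \<open>1 / qpoch_fin (S^2) S n\<close> with \<open>S = norm s\<close>. This sequence converges and
  is therefore bounded.\<close>

lemma no_ones_abs_summable:
  assumes s: "norm s < 1" and w: "\<And>j. 2 \<le> j \<Longrightarrow> norm (w j) = norm s ^ j"
  shows "mset_weight w abs_summable_on no_ones"
proof -
  define S where "S = complex_of_real (norm s)"
  have S: "norm S < 1" using s by (simp add: S_def)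
  have S2: "norm (S\<^sup>2) < 1" using S by (simp add: norm_power power_less_one_iff)
  have "(\<lambda>n. 1 / qpoch_fin (S\<^sup>2) S n) \<longlonglongrightarrow> 1 / qpoch_inf (S\<^sup>2) S"
    by (intro tendsto_divide tendsto_const qpoch_fin_LIMSEQ S qpoch_inf_nonzero S2)
  then have "Bseq (\<lambda>n. 1 / qpoch_fin (S\<^sup>2) S n)"
    using convergentI convergent_imp_Bseq by blast
  then obtain K where K: "\<And>n. norm (1 / qpoch_fin (S\<^sup>2) S n) \<le> K" unfolding Bseq_def by blast
  have w1: "norm (w j) < 1" if "2 \<le> j" for j
    using s that by (simp add: w power_less_one_iff)
  have prod: "(\<Prod>a\<in>{2..<n+2}. 1 / (1 - complex_of_real (norm (w a)))) = 1 / qpoch_fin (S\<^sup>2) S n" for n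
  proof -
    have "(\<Prod>a\<in>{2..<n+2}. 1 / (1 - complex_of_real (norm (w a)))) =
        (\<Prod>k<n. 1 / (1 - complex_of_real (norm (w (k + 2)))))"
      using prod.shift_bounds_nat_ivl[of "\<lambda>a. 1 / (1 - complex_of_real (norm (w a)))" 0 2 n]
      by (simp only: add_0 lessThan_atLeast0)
    also have "\<dots> = (\<Prod>k<n. 1 / (1 - S\<^sup>2 * S ^ k))"
      by (simp add: w S_def power2_eq_square mult.assoc)
    finally show ?thesis by (simp add: qpoch_fin_def prod_dividef)
  qed
  have bound: "sum (\<lambda>p. norm (mset_weight w p)) F \<le> K" if F: "finite F" "F \<subseteq> no_ones" for F
  proof -
    obtain N where N: "\<And>n. n \<ge> N \<Longrightarrow> F \<subseteq> {p. set_mset p \<subseteq> {2..<n}}" using no_ones_exhaust[OF F] by blast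
    let ?v = "\<lambda>x. complex_of_real (norm (w x))" and ?T = "{p. set_mset p \<subseteq> {2..<N+2}}"
    have "(mset_weight ?v has_sum (\<Prod>a\<in>{2..<N+2}. 1 / (1 - ?v a))) ?T"
      using mset_weight_has_sum_finite[of "{2..<N+2}" ?v] w1 by auto
    then have hs: "(mset_weight ?v has_sum (1 / qpoch_fin (S\<^sup>2) S N)) ?T" unfolding prod .
    then have "((\<lambda>p. Re (mset_weight ?v p)) has_sum Re (1 / qpoch_fin (S\<^sup>2) S N)) ?T"
      by (rule has_sum_Re)
    then have hs': "((\<lambda>p. norm (mset_weight w p)) has_sum Re (1 / qpoch_fin (S\<^sup>2) S N)) ?T"
      by (simp only: norm_mset_weight)
    have "sum (\<lambda>p. norm (mset_weight w p)) F \<le> infsum (\<lambda>p. norm (mset_weight w p)) ?T"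
      using hs' N[of "N + 2"] F(1) by (intro finite_sum_le_infsum) (auto simp: summable_on_def)
    also have "\<dots> = Re (1 / qpoch_fin (S\<^sup>2) S N)" using hs' by (rule infsumI)
    also have "\<dots> \<le> K" using complex_Re_le_cmod K order_trans by blast
    finally show ?thesis .
  qed
  show ?thesis
    by (rule nonneg_bdd_above_summable_on) (use bound in \<open>auto intro!: bdd_aboveI2\<close>)
qed

lemma no_ones_limit:
  assumes s: "norm s < 1" and w: "\<And>j. 2 \<le> j \<Longrightarrow> norm (w j) = norm s ^ j"
  shows "(\<lambda>n. \<Prod>a\<in>{2..<n}. 1 / (1 - w a)) \<longlonglongrightarrow> infsum (mset_weight w) no_ones"
proof -
  have w1: "norm (w j) < 1" if "2 \<le> j" for j
    using s that by (simp add: w power_less_one_iff)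
  have "(\<lambda>n. infsum (mset_weight w) {p. set_mset p \<subseteq> {2..<n}}) \<longlonglongrightarrow> infsum (mset_weight w) no_ones"
  proof (rule infsum_increasing_limit)
    show "mset_weight w abs_summable_on no_ones" by (rule no_ones_abs_summable[OF assms])
    show "{p. set_mset p \<subseteq> {2..<n}} \<subseteq> no_ones" for n by (auto simp: no_ones_def)
    show "\<forall>\<^sub>F n in sequentially. F \<subseteq> {p. set_mset p \<subseteq> {2..<n}}" if "finite F" "F \<subseteq> no_ones" for F
      using no_ones_exhaust[OF that] by (simp add: eventually_sequentially)
  qed
  moreover have "infsum (mset_weight w) {p. set_mset p \<subseteq> {2..<n}} = (\<Prod>a\<in>{2..<n}. 1 / (1 - w a))" for n
    using mset_weight_has_sum_finite[of "{2..<n}" w] w1 by (intro infsumI) auto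
  ultimately show ?thesis by simp
qed

section \<open>The partition sum weighted by the number of ones\<close>

definition crank_weight :: "complex \<Rightarrow> complex \<Rightarrow> nat \<Rightarrow> nat \<Rightarrow> complex" where
  "crank_weight z q k x = q ^ x * (if k < x then z else 1)"

text \<open>For a partition with exactly \<open>k\<close> ones, \<open>z\<close> marks the parts
  larger than \<open>k\<close>. The parts 2 to \<open>k\<close> give
  \<open>(1 - q) / qpoch_fin q q k\<close>; the larger ones give the reciprocal of a tail of
  \<open>qpoch_inf (z * q) q\<close>, and rewriting the tail as a quotient produces the q-binomial
  coefficient.\<close>

lemma no_ones_crank_weight:
  assumes q: "norm q < 1" and z: "norm z = 1" and k: "1 \<le> k"
  shows "(mset_weight (crank_weight z q k) has_sum
    (1 - q) * qbin_coeff (z * q) q k / qpoch_inf (z * q) q) no_ones"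
proof -
  let ?w = "crank_weight z q k"
  have w: "norm (?w j) = norm q ^ j" for j
    using z by (simp add: crank_weight_def norm_mult norm_power)
  have q1: "norm q ^ Suc j < 1" for j using q by (simp add: power_less_one_iff del: power_Suc)
  have nz: "1 - z * q \<noteq> 0 \<and> 1 - q \<noteq> 0"
    using q z by (metis mult_1 norm_mult norm_one order_less_irrefl right_minus_eq)
  have zq: "norm (z * q) < 1" using q z by (simp add: norm_mult)
  have zqk: "norm (z * q ^ Suc k) < 1" unfolding norm_mult norm_power z mult_1 by (rule q1)
  have fin: "(\<Prod>a\<in>{2..<n + k + 1}. 1 - ?w a) = qpoch_fin q q k / (1 - q) * qpoch_fin (z * q ^ Suc k) q n" for n
  proof -
    have "{2..<n + k + 1} = {2..<k + 1} \<union> {k + 1..<n + (k + 1)}" "{2..<k + 1} \<inter> {k + 1..<n + (k + 1)} = {}"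
      using k by auto
    then have "(\<Prod>a\<in>{2..<n + k + 1}. 1 - ?w a) =
        (\<Prod>a\<in>{2..<k + 1}. 1 - ?w a) * (\<Prod>a\<in>{k + 1..<n + (k + 1)}. 1 - ?w a)"
      by (simp add: prod.union_disjoint)
    also have "(\<Prod>a\<in>{k + 1..<n + (k + 1)}. 1 - ?w a) = (\<Prod>i<n. 1 - ?w (i + (k + 1)))"
      using prod.shift_bounds_nat_ivl[of "\<lambda>a. 1 - ?w a" 0 "k + 1" n] by (simp add: lessThan_atLeast0)
    also have "\<dots> = qpoch_fin (z * q ^ Suc k) q n"
      by (simp add: qpoch_fin_def crank_weight_def power_add mult_ac)
    also have "(\<Prod>a\<in>{2..<k + 1}. 1 - ?w a) = (\<Prod>a\<in>{2..<k + 1}. 1 - q ^ a)"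
      by (intro prod.cong) (auto simp: crank_weight_def)
    also have "\<dots> = qpoch_fin q q k / (1 - q)"
    proof -
      have "qpoch_fin q q k = (\<Prod>a\<in>{1..<k + 1}. 1 - q ^ a)"
        using prod.shift_bounds_nat_ivl[of "\<lambda>a. 1 - q ^ a" 0 1 k]
        by (simp add: qpoch_fin_def lessThan_atLeast0)
      also have "\<dots> = (1 - q) * (\<Prod>a\<in>{2..<k + 1}. 1 - q ^ a)"
        using prod.atLeast_Suc_lessThan[of 1 "k + 1" "\<lambda>a. 1 - q ^ a"] k by (simp add: numeral_2_eq_2)
      finally show ?thesis using nz by simp
    qed
    finally show ?thesis .
  qed
  have "(\<lambda>n. \<Prod>a\<in>{2..<n}. 1 / (1 - ?w a)) \<longlonglongrightarrow> infsum (mset_weight ?w) no_ones"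
    using q w by (rule no_ones_limit)
  then have "(\<lambda>n. \<Prod>a\<in>{2..<n + (k + 1)}. 1 / (1 - ?w a)) \<longlonglongrightarrow> infsum (mset_weight ?w) no_ones"
    by (rule LIMSEQ_ignore_initial_segment)
  then have "(\<lambda>n. 1 / (qpoch_fin q q k / (1 - q) * qpoch_fin (z * q ^ Suc k) q n))
      \<longlonglongrightarrow> infsum (mset_weight ?w) no_ones"
    using fin by (simp add: prod_dividef add.assoc)
  moreover have "(\<lambda>n. 1 / (qpoch_fin q q k / (1 - q) * qpoch_fin (z * q ^ Suc k) q n))
      \<longlonglongrightarrow> 1 / (qpoch_fin q q k / (1 - q) * qpoch_inf (z * q ^ Suc k) q)"
    using nz qpoch_fin_nonzero[OF q] qpoch_inf_nonzero[OF q zqk]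
    by (intro tendsto_intros qpoch_fin_LIMSEQ q) auto
  ultimately have I: "infsum (mset_weight ?w) no_ones =
      1 / (qpoch_fin q q k / (1 - q) * qpoch_inf (z * q ^ Suc k) q)"
    by (rule LIMSEQ_unique)
  have "qpoch_inf (z * q) q = qpoch_fin (z * q) q k * qpoch_inf (z * q ^ Suc k) q"
    using qpoch_inf_split[OF q, of "z * q" k] by (simp add: mult.assoc)
  then have "infsum (mset_weight ?w) no_ones = (1 - q) * qbin_coeff (z * q) q k / qpoch_inf (z * q) q"
  proof -
    assume split: "qpoch_inf (z * q) q = qpoch_fin (z * q) q k * qpoch_inf (z * q ^ Suc k) q"
    have "1 / (C / e * B) = e * (A / C) / (A * B)" if "A \<noteq> 0" "e \<noteq> 0" for A B C e :: complex
      using that by (simp add: field_simps)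
    moreover have "qpoch_fin (z * q) q k \<noteq> 0" "1 - q \<noteq> 0"
      using split qpoch_inf_nonzero[OF q zq] nz by auto
    ultimately show ?thesis unfolding I split qbin_coeff_def by blast
  qed
  moreover have "mset_weight ?w abs_summable_on no_ones"
    using q w by (rule no_ones_abs_summable)
  ultimately show ?thesis by (metis abs_summable_summable has_sum_infsum)
qed

text \<open>The operator \<open>w d/dw\<close> applied to the q-binomial theorem supplies the factor
  \<open>k\<close>, which will be the number of ones.\<close>

lemma q_binomial_euler_operator:
  assumes q: "norm q < 1" and w: "norm w < 1" and aw: "norm (a * w) < 1"
  shows "(\<lambda>k. of_nat k * qbin_coeff a q k * w ^ k) sums
    (w * (a * deriv (\<lambda>x. qpoch_inf x q) (a * w) * qpoch_inf w q
          - qpoch_inf (a * w) q * deriv (\<lambda>x. qpoch_inf x q) w) / (qpoch_inf w q)\<^sup>2)"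
proof -
  define f where "f = (\<lambda>w. \<Sum>k. qbin_coeff a q k * w ^ k)"
  let ?d = "deriv (\<lambda>x. qpoch_inf x q)"
  define F' where "F' = (a * ?d (a * w) * qpoch_inf w q - qpoch_inf (a * w) q * ?d w) / (qpoch_inf w q)\<^sup>2"
  have 1: "(f has_field_derivative (\<Sum>k. diffs (qbin_coeff a q) k * w ^ k)) (at w)"
    unfolding f_def by (rule qbin_deriv[OF q w])
  have "((\<lambda>w. qpoch_inf (a * w) q / qpoch_inf w q) has_field_derivative
      (?d (a * w) * a * qpoch_inf w q - qpoch_inf (a * w) q * ?d w) / (qpoch_inf w q * qpoch_inf w q)) (at w)"
  proof (rule DERIV_divide)
    show "((\<lambda>w. qpoch_inf (a * w) q) has_field_derivative ?d (a * w) * a) (at w)"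
      by (rule qpoch_inf_field_derivative[OF q]) (auto intro!: derivative_eq_intros)
    show "((\<lambda>w. qpoch_inf w q) has_field_derivative ?d w) (at w)"
      using qpoch_inf_field_derivative[OF q DERIV_ident, of w UNIV] by simp
  qed (rule qpoch_inf_nonzero[OF q w])
  then have "(f has_field_derivative
      (?d (a * w) * a * qpoch_inf w q - qpoch_inf (a * w) q * ?d w) / (qpoch_inf w q * qpoch_inf w q)) (at w)"
  proof (rule has_field_derivative_transform_within_open)
    show "open (ball (0 :: complex) 1)" by (rule open_ball)
    show "w \<in> ball 0 1" using w by simp
    show "qpoch_inf (a * u) q / qpoch_inf u q = f u" if "u \<in> ball 0 1" for u
      using q_binomial[OF q, of u a] that unfolding f_def by (simp add: sums_iff)
  qed
  from DERIV_unique[OF 1 this] have D: "(\<Sum>k. diffs (qbin_coeff a q) k * w ^ k) = F'"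
    by (simp add: F'_def power2_eq_square mult_ac)
  obtain r where r: "norm w < r" "r < 1" using w dense by blast
  then have r': "norm (complex_of_real r) = r"
    using order.strict_trans1[OF norm_ge_zero[of w] r(1)] by (simp add: norm_of_real)
  have "summable (\<lambda>k. diffs (qbin_coeff a q) k * w ^ k)"
  proof (rule termdiff_converges)
    show "norm w < r" by (rule r)
    show "summable (\<lambda>k. qbin_coeff a q k * x ^ k)" if "norm x < r" for x
      using that r by (intro qbin_summable q) simp
  qed
  then have "(\<lambda>k. diffs (qbin_coeff a q) k * w ^ k) sums F'"
    using D by (simp add: sums_iff)
  then have "(\<lambda>k. w * (diffs (qbin_coeff a q) k * w ^ k)) sums (w * F')" by (rule sums_mult)
  then have "(\<lambda>k. of_nat (Suc k) * qbin_coeff a q (Suc k) * w ^ Suc k) sums (w * F')"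
    by (simp add: diffs_def mult_ac)
  then have "(\<lambda>k. of_nat k * qbin_coeff a q k * w ^ k) sums (w * F' + of_nat 0 * qbin_coeff a q 0 * w ^ 0)"
    by (rule sums_Suc)
  then show ?thesis by (simp add: F'_def)
qed

definition all_parts :: "nat multiset set" where
  "all_parts = {p. \<forall>x\<in>#p. 0 < x}"

lemma bij_betw_split_ones:
  "bij_betw (\<lambda>(k, p). replicate_mset k 1 + p) (UNIV \<times> no_ones) all_parts"
proof (rule bij_betw_byWitness[where f' = "\<lambda>p. (count p 1, filter_mset (\<lambda>x. x \<noteq> 1) p)"])
  have "filter_mset (\<lambda>x. x \<noteq> 1) p = p" "count p 1 = 0" if "p \<in> no_ones" for p
    using that by (auto simp: filter_mset_eq_conv no_ones_def count_eq_zero_iff)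
  then show "\<forall>x\<in>UNIV \<times> no_ones. (\<lambda>p. (count p 1, filter_mset (\<lambda>x. x \<noteq> 1) p))
      ((\<lambda>(k, p). replicate_mset k 1 + p) x) = x"
    by auto
  show "\<forall>p\<in>all_parts. (\<lambda>(k, p). replicate_mset k 1 + p) (count p 1, filter_mset (\<lambda>x. x \<noteq> 1) p) = p"
    by (simp add: filter_mset_neq_split)
  show "(\<lambda>(k, p). replicate_mset k 1 + p) ` (UNIV \<times> no_ones) \<subseteq> all_parts"
    by (force simp: all_parts_def no_ones_def split: if_splits)
  show "(\<lambda>p. (count p 1, filter_mset (\<lambda>x. x \<noteq> 1) p)) ` all_parts \<subseteq> UNIV \<times> no_ones"
    by (force simp: all_parts_def no_ones_def)
qed

lemma finite_partitions_of: "finite (partitions_of n)"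
proof (rule finite_subset)
  show "partitions_of n \<subseteq> mset ` {xs. set xs \<subseteq> {0..n} \<and> length xs \<le> n}"
  proof
    fix p assume p: "p \<in> partitions_of n"
    obtain xs where xs: "p = mset xs" by (metis ex_mset)
    have "x \<le> n" if "x \<in># p" for x
      using p that by (auto simp: partitions_of_def dest!: multi_member_split)
    moreover have "size p \<le> sum_mset p"
    proof -
      have "\<forall>x\<in>#p. 0 < x" using p by (auto simp: partitions_of_def)
      then show ?thesis by (induction p) auto
    qed
    ultimately show "p \<in> mset ` {xs. set xs \<subseteq> {0..n} \<and> length xs \<le> n}"
      using p unfolding xs by (auto simp: partitions_of_def)
  qed
  show "finite (mset ` {xs. set xs \<subseteq> {0..n} \<and> length xs \<le> n})"
    by (intro finite_imageI finite_lists_length_le) simp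
qed

definition ones_term :: "complex \<Rightarrow> complex \<Rightarrow> nat multiset \<Rightarrow> complex" where
  "ones_term z q p = of_nat (ones p) * z powi crank p * q ^ sum_mset p"

lemma crank_weight_prod:
  "mset_weight (crank_weight z q k) p = q ^ sum_mset p * z ^ size (filter_mset (\<lambda>x. k < x) p)"
  unfolding mset_weight_def by (induction p) (auto simp: crank_weight_def power_add)

lemma ones_term_split:
  assumes "p \<in> no_ones" "z \<noteq> 0"
  shows "ones_term z q (replicate_mset k 1 + p) = of_nat k * (q / z) ^ k * mset_weight (crank_weight z q k) p"
proof (cases "k = 0")
  case False
  have c: "count p 1 = 0" using assms by (auto simp: no_ones_def count_eq_zero_iff)
  then have o: "ones (replicate_mset k 1 + p) = k" by (simp add: ones_def)
  have "crank (replicate_mset k 1 + p) = int (size (filter_mset (\<lambda>x. k < x) p)) - int k"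
    using False unfolding crank_def o by simp
  then show ?thesis
    unfolding ones_term_def o crank_weight_prod
    using assms(2) by (simp add: power_int_diff power_add power_divide sum_mset_replicate_mset)
next
  case True
  have "count p 1 = 0" using assms by (auto simp: no_ones_def count_eq_zero_iff)
  then show ?thesis using True by (simp add: ones_term_def ones_def)
qed

lemma ones_term_abs_summable:
  assumes q: "norm q < 1" and z: "norm z = 1"
  shows "ones_term z q abs_summable_on all_parts"
    and "(\<lambda>(k, p). of_nat k * (q / z) ^ k * mset_weight (crank_weight z q k) p) abs_summable_on (UNIV \<times> no_ones)"
proof -
  have z0: "z \<noteq> 0" using z by auto
  let ?v = "\<lambda>x. complex_of_real (norm q) ^ x"
  have a: "mset_weight ?v abs_summable_on no_ones"
    using q by (rule no_ones_abs_summable) (simp add: norm_power)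
  then have as: "(mset_weight ?v has_sum infsum (mset_weight ?v) no_ones) no_ones"
    by (rule has_sum_infsum[OF abs_summable_summable])
  \<comment> \<open>For \<open>a = q\<close> all coefficients \<open>qbin_coeff q q k\<close> equal
    1, so this instance yields the summability of \<open>k * norm q ^ k\<close>.\<close>
  have "(\<lambda>k. of_nat k * qbin_coeff q q k * complex_of_real (norm q) ^ k) sums
     (complex_of_real (norm q) * (q * deriv (\<lambda>x. qpoch_inf x q) (q * complex_of_real (norm q)) * qpoch_inf (complex_of_real (norm q)) q
          - qpoch_inf (q * complex_of_real (norm q)) q * deriv (\<lambda>x. qpoch_inf x q) (complex_of_real (norm q))) / (qpoch_inf (complex_of_real (norm q)) q)\<^sup>2)"
    by (rule q_binomial_euler_operator[OF q]) (use q in \<open>auto simp: norm_mult abs_square_less_1 simp flip: power2_eq_square\<close>)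
  then have "summable (\<lambda>k. of_nat k * complex_of_real (norm q) ^ k)"
    using qpoch_fin_nonzero[OF q] by (simp add: qbin_coeff_def sums_iff)
  then have "summable (\<lambda>k. Re (of_nat k * complex_of_real (norm q) ^ k))" by (rule summable_Re)
  moreover have "Re (of_nat k * complex_of_real (norm q) ^ k) = norm (of_nat k * (q / z) ^ k)" for k
    using z by (simp add: norm_mult norm_power norm_divide flip: of_real_power)
  ultimately have s: "summable (\<lambda>k. norm (of_nat k * (q / z) ^ k))" by simp
  then have b: "(\<lambda>k. of_nat k * (q / z) ^ k) abs_summable_on UNIV"
    by (simp add: summable_on_UNIV_nonneg_real_iff)
  then have bs: "((\<lambda>k. of_nat k * (q / z) ^ k) has_sum infsum (\<lambda>k. of_nat k * (q / z) ^ k) UNIV) UNIV"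
    by (rule has_sum_infsum[OF abs_summable_summable])
  have nrm: "norm (mset_weight (crank_weight z q k) p) = norm (mset_weight ?v p)" for k p
    unfolding mset_weight_def by (induction p) (auto simp: crank_weight_def norm_mult norm_power z)
  show *: "(\<lambda>(k, p). of_nat k * (q / z) ^ k * mset_weight (crank_weight z q k) p) abs_summable_on (UNIV \<times> no_ones)"
    using has_sum_times(2)[OF b a bs as] by (simp add: case_prod_unfold norm_mult nrm)
  also have "?this \<longleftrightarrow> (\<lambda>x. norm (ones_term z q ((\<lambda>(k, p). replicate_mset k 1 + p) x))) summable_on (UNIV \<times> no_ones)"
    by (rule summable_on_cong) (auto simp: ones_term_split[unfolded One_nat_def] z0)
  also have "\<dots> \<longleftrightarrow> ones_term z q abs_summable_on all_parts"
    by (rule summable_on_reindex_bij_betw[OF bij_betw_split_ones])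
  finally show "ones_term z q abs_summable_on all_parts" .
qed

definition ones_gf :: "complex \<Rightarrow> complex \<Rightarrow> complex" where
  "ones_gf z q = infsum (ones_term z q) all_parts"

lemma bij_betw_partitions:
  "bij_betw (\<lambda>(n, p). p) (Sigma UNIV partitions_of) all_parts"
  by (rule bij_betw_byWitness[where f' = "\<lambda>p. (sum_mset p, p)"])
     (auto simp: partitions_of_def all_parts_def)

lemma ones_gf_has_sum:
  assumes q: "norm q < 1" and z: "norm z = 1"
  shows "((\<lambda>n. \<Sum>p\<in>partitions_of n. ones_term z q p) has_sum ones_gf z q) UNIV"
    and "(\<lambda>n. \<Sum>p\<in>partitions_of n. norm (ones_term z q p)) summable_on UNIV"
proof -
  note abs = ones_term_abs_summable(1)[OF q z]
  have "(ones_term z q has_sum ones_gf z q) all_parts"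
    unfolding ones_gf_def using abs_summable_summable[OF abs] by (rule has_sum_infsum)
  then have "((\<lambda>(n, p). ones_term z q p) has_sum ones_gf z q) (Sigma UNIV partitions_of)"
    using has_sum_reindex_bij_betw[OF bij_betw_partitions, of "ones_term z q"]
    by (simp add: case_prod_unfold)
  then show "((\<lambda>n. \<Sum>p\<in>partitions_of n. ones_term z q p) has_sum ones_gf z q) UNIV"
    by (rule has_sum_Sigma') (simp add: finite_partitions_of)
  have "(\<lambda>(n, p). norm (ones_term z q p)) summable_on (Sigma UNIV partitions_of)"
    using abs summable_on_reindex_bij_betw[OF bij_betw_partitions, of "\<lambda>p. norm (ones_term z q p)"]
    by (simp add: case_prod_unfold)
  then obtain S where "((\<lambda>(n, p). norm (ones_term z q p)) has_sum S) (Sigma UNIV partitions_of)"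
    by (auto simp: summable_on_def)
  then have "((\<lambda>n. \<Sum>p\<in>partitions_of n. norm (ones_term z q p)) has_sum S) UNIV"
    by (rule has_sum_Sigma') (simp add: finite_partitions_of)
  then show "(\<lambda>n. \<Sum>p\<in>partitions_of n. norm (ones_term z q p)) summable_on UNIV"
    by (auto simp: summable_on_def)
qed

text \<open>Summation over the number \<open>k\<close> of ones is the differentiated q-binomial
  theorem at \<open>a = z * q\<close>, \<open>w = q / z\<close>. There \<open>a * w = q^2\<close>
  does not depend on \<open>z\<close>, so the first of the two resulting terms is symmetric under
  \<open>z -> 1 / z\<close>.\<close>

lemma ones_gf_eq:
  assumes q: "norm q < 1" and z: "norm z = 1"
  defines "d \<equiv> deriv (\<lambda>x. qpoch_inf x q)"
  shows "ones_gf z q = (1 - q) / (qpoch_inf (z * q) q * qpoch_inf (q / z) q) *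
    (q\<^sup>2 * d (q\<^sup>2) - qpoch_inf (q\<^sup>2) q * (q / z * d (q / z)) / qpoch_inf (q / z) q)"
proof -
  have z0: "z \<noteq> 0" using z by auto
  have qz: "norm (q / z) < 1" "norm (z * q) < 1" using q z by (auto simp: norm_divide norm_mult)
  have aw: "z * q * (q / z) = q\<^sup>2" using z0 by (simp add: power2_eq_square)
  have q2: "norm (q\<^sup>2) < 1" using q by (simp add: norm_power power_less_one_iff)
  let ?t = "\<lambda>(k, p). of_nat k * (q / z) ^ k * mset_weight (crank_weight z q k) p"
  have "(ones_term z q has_sum ones_gf z q) all_parts"
    unfolding ones_gf_def using abs_summable_summable[OF ones_term_abs_summable(1)[OF q z]]
    by (rule has_sum_infsum)
  then have "((\<lambda>x. ones_term z q ((\<lambda>(k, p). replicate_mset k 1 + p) x)) has_sum ones_gf z q) (UNIV \<times> no_ones)"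
    by (subst has_sum_reindex_bij_betw[OF bij_betw_split_ones])
  also have "?this \<longleftrightarrow> (?t has_sum ones_gf z q) (UNIV \<times> no_ones)"
    by (rule has_sum_cong) (auto simp: ones_term_split[unfolded One_nat_def] z0)
  finally have "((\<lambda>k. of_nat k * (q / z) ^ k * ((1 - q) * qbin_coeff (z * q) q k / qpoch_inf (z * q) q))
      has_sum ones_gf z q) UNIV"
  proof (rule has_sum_Sigma')
    fix k :: nat
    show "((\<lambda>p. ?t (k, p)) has_sum of_nat k * (q / z) ^ k * ((1 - q) * qbin_coeff (z * q) q k / qpoch_inf (z * q) q)) no_ones"
    \<comment> \<open>\<open>no_ones_crank_weight\<close> requires at least one 1; for
      \<open>k = 0\<close> the factor \<open>of_nat k\<close> makes both sides 0.\<close>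
    proof (cases "k = 0")
      case False
      then show ?thesis 
        using has_sum_cmult_right[OF no_ones_crank_weight[OF q z, of k], of "of_nat k * (q / z) ^ k"] by simp
    qed simp
  qed
  then have "(\<lambda>k. of_nat k * (q / z) ^ k * ((1 - q) * qbin_coeff (z * q) q k / qpoch_inf (z * q) q))
      sums ones_gf z q"
    by (rule has_sum_imp_sums)
  moreover have "of_nat k * W * (r * c / u) = r / u * (of_nat k * c * W)" for k and W r c u :: complex
    by simp
  ultimately have "(\<lambda>k. (1 - q) / qpoch_inf (z * q) q * (of_nat k * qbin_coeff (z * q) q k * (q / z) ^ k))
      sums ones_gf z q"
    by (simp only:)
  moreover have "(\<lambda>k. (1 - q) / qpoch_inf (z * q) q * (of_nat k * qbin_coeff (z * q) q k * (q / z) ^ k)) sums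
     ((1 - q) / qpoch_inf (z * q) q * (q / z * (z * q * d (z * q * (q / z)) * qpoch_inf (q / z) q
          - qpoch_inf (z * q * (q / z)) q * d (q / z)) / (qpoch_inf (q / z) q)\<^sup>2))"
    unfolding d_def
    by (rule sums_mult, rule q_binomial_euler_operator[OF q qz(1)]) (use q2 aw in simp)
  ultimately have "ones_gf z q = (1 - q) / qpoch_inf (z * q) q * (q / z * (z * q * d (z * q * (q / z)) * qpoch_inf (q / z) q
          - qpoch_inf (z * q * (q / z)) q * d (q / z)) / (qpoch_inf (q / z) q)\<^sup>2)"
    by (rule sums_unique2)
  also have "\<dots> = (1 - q) / (qpoch_inf (z * q) q * qpoch_inf (q / z) q) *
    (q\<^sup>2 * d (q\<^sup>2) - qpoch_inf (q\<^sup>2) q * (q / z * d (q / z)) / qpoch_inf (q / z) q)"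
  proof -
    have "e / u * (w * (a * X * v - Z * Y) / v\<^sup>2) = e / (u * v) * ((a * w) * X - Z * (w * Y) / v)"
      if "v \<noteq> 0" for a e u v w X Y Z :: complex
      using that by (simp add: divide_simps power2_eq_square) (simp add: algebra_simps)
    from this[of "qpoch_inf (q / z) q", OF qpoch_inf_nonzero[OF q qz(1)]] show ?thesis
      unfolding aw[symmetric] .
  qed
  finally show ?thesis .
qed

text \<open>In the difference the symmetric term with \<open>q^2\<close> cancels, and the
  logarithmic derivatives of \<open>qpoch_inf (z * q) q\<close> and
  \<open>qpoch_inf (q / z) q\<close> combine into that of theta. The correction
  \<open>z * theta q z\<close> accounts for the missing factor \<open>1 - z\<close>.\<close>

theorem crank_theta_identity:
  assumes q: "norm q < 1" "q \<noteq> 0" and z: "norm z = 1"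
  shows "(ones_gf z q - ones_gf (1 / z) q) * (theta q z)\<^sup>2 =
    (qpoch_inf q q)\<^sup>2 * ((1 - z) * thetaD q z + z * theta q z)"
proof -
  let ?d = "deriv (\<lambda>x. qpoch_inf x q)"
  have z0: "z \<noteq> 0" using z by auto
  have qz: "norm (q / z) < 1" "norm (z * q) < 1" using q z by (auto simp: norm_divide norm_mult)
  define u v e X Y where "u = qpoch_inf (z * q) q" and "v = qpoch_inf (q / z) q" and "e = qpoch_inf q q"
    and "X = z * q * ?d (z * q)" and "Y = q / z * ?d (q / z)"
  have nz: "u \<noteq> 0" "v \<noteq> 0" unfolding u_def v_def by (simp_all add: qpoch_inf_nonzero q qz)
  have e: "e = (1 - q) * qpoch_inf (q\<^sup>2) q"
    unfolding e_def by (subst qpoch_inf_rec[OF q(1)]) (simp add: power2_eq_square)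
  have G: "ones_gf z q - ones_gf (1 / z) q = e / (u * v) * (X / u - Y / v)"
  proof -
    have "ones_gf z q = (1 - q) / (u * v) * (q\<^sup>2 * ?d (q\<^sup>2) - qpoch_inf (q\<^sup>2) q * Y / v)"
      unfolding ones_gf_eq[OF q(1) z] u_def v_def Y_def ..
    moreover have "ones_gf (1 / z) q = (1 - q) / (v * u) * (q\<^sup>2 * ?d (q\<^sup>2) - qpoch_inf (q\<^sup>2) q * X / u)"
    proof -
      have "norm (1 / z) = 1" using z by (simp add: norm_divide)
      from ones_gf_eq[OF q(1) this] show ?thesis
        using z0 by (simp add: u_def v_def X_def mult.commute)
    qed
    moreover have "r / (u * v) * (S - T * Y / v) - r / (v * u) * (S - T * X / u) =
        r * T / (u * v) * (X / u - Y / v)" for r S T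
    proof -
      have "r / (u * v) * (S - T * Y / v) - r / (v * u) * (S - T * X / u) =
          r / (u * v) * ((S - T * Y / v) - (S - T * X / u))"
        by (simp only: mult.commute[of v u] right_diff_distrib)
      also have "(S - T * Y / v) - (S - T * X / u) = T * (X / u - Y / v)"
        by (simp add: right_diff_distrib)
      finally show ?thesis by simp
    qed
    ultimately show ?thesis unfolding e by (simp only:)
  qed
  have th: "theta q z = (1 - z) * u * v * e"
    unfolding theta_def u_def v_def e_def by (subst qpoch_inf_rec[OF q(1)]) (simp add: mult_ac)
  have D: "?d z = - u + (1 - z) * (?d (z * q) * q)"
  proof -
    have "((\<lambda>x. (1 - x) * qpoch_inf (x * q) q) has_field_derivative
        (0 - 1) * qpoch_inf (z * q) q + (?d (z * q) * q) * (1 - z)) (at z)"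
    proof (intro DERIV_mult DERIV_diff DERIV_const DERIV_ident)
      show "((\<lambda>x. qpoch_inf (x * q) q) has_field_derivative ?d (z * q) * q) (at z)"
        by (rule qpoch_inf_field_derivative[OF q(1)]) (auto intro!: derivative_eq_intros)
    qed
    moreover have "(\<lambda>x. (1 - x) * qpoch_inf (x * q) q) = (\<lambda>x. qpoch_inf x q)"
      by (rule ext, subst mult.commute[of _ q], rule qpoch_inf_rec[OF q(1), symmetric])
    ultimately have "((\<lambda>x. qpoch_inf x q) has_field_derivative
        (0 - 1) * qpoch_inf (z * q) q + (?d (z * q) * q) * (1 - z)) (at z)" by simp
    from DERIV_imp_deriv[OF this] show ?thesis by (simp add: u_def mult.commute)
  qed
  have tD: "thetaD q z = (z * ?d z * v - Y * ((1 - z) * u)) * e"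
  proof -
    have "qpoch_inf z q = (1 - z) * u"
      unfolding u_def by (subst qpoch_inf_rec[OF q(1)]) (simp add: mult.commute)
    then show ?thesis unfolding thetaD_explicit[OF q(1) z0] Y_def v_def e_def by simp
  qed
  have zd: "z * ?d z = - z * u + (1 - z) * X" unfolding D X_def by (simp add: algebra_simps)
  have "e / (u * v) * (X / u - Y / v) * ((1 - z) * u * v * e)\<^sup>2 =
      e\<^sup>2 * ((1 - z) * (((- z * u + (1 - z) * X) * v - Y * ((1 - z) * u)) * e) + z * ((1 - z) * u * v * e))"
  proof -
    have 1: "e / (u * v) * (X / u - Y / v) = e * (X * v - Y * u) / (u * v)\<^sup>2"
      unfolding diff_frac_eq[OF nz] by (simp add: power2_eq_square)
    have 2: "(1 - z) * u * v * e = (u * v) * ((1 - z) * e)" by (simp only: mult_ac)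
    have "e / (u * v) * (X / u - Y / v) * ((1 - z) * u * v * e)\<^sup>2 =
        e * (X * v - Y * u) * ((1 - z) * e)\<^sup>2"
      unfolding 1 2 power_mult_distrib[of "u * v"] using nz by simp
    also have "\<dots> = e\<^sup>2 * ((1 - z) * (((- z * u + (1 - z) * X) * v - Y * ((1 - z) * u)) * e)
        + z * ((1 - z) * u * v * e))"
      by algebra
    finally show ?thesis .
  qed
  then show ?thesis unfolding G th tD zd e_def .
qed

section \<open>Reduction modulo the curve\<close>

fun padd :: "int list \<Rightarrow> int list \<Rightarrow> int list" where
  "padd [] ys = ys"
| "padd (x # xs) [] = x # xs"
| "padd (x # xs) (y # ys) = (x + y) # padd xs ys"

fun pval :: "complex \<Rightarrow> int list \<Rightarrow> complex" where
  "pval t [] = 0"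
| "pval t (c # cs) = of_int c + t * pval t cs"

lemma pval_padd: "pval t (padd xs ys) = pval t xs + pval t ys"
  by (induction xs ys rule: padd.induct) (simp_all add: algebra_simps)

lemma pval_smult: "pval t (map ((*) c) xs) = of_int c * pval t xs"
  by (induction xs) (simp_all add: algebra_simps)

lemma pval_uminus: "pval t (map uminus xs) = - pval t xs"
  by (induction xs) (simp_all add: algebra_simps)

fun vadd :: "int list \<Rightarrow> int list \<Rightarrow> int list" where
  "vadd (x # xs) (y # ys) = (x + y) # vadd xs ys"
| "vadd _ _ = []"

fun monom_val :: "complex list \<Rightarrow> int list \<Rightarrow> complex" where
  "monom_val (b # bs) (e # es) = b powi e * monom_val bs es"
| "monom_val _ _ = 1"

lemma monom_val_vadd:
  assumes "0 \<notin> set bs" "length u = length bs" "length v = length bs"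
  shows "monom_val bs (vadd u v) = monom_val bs u * monom_val bs v"
  using assms
proof (induction bs arbitrary: u v)
  case (Cons b bs)
  then obtain x u' y v' where "u = x # u'" "v = y # v'" by (metis length_Suc_conv)
  with Cons show ?case by (simp add: power_int_add mult_ac)
qed simp

lemma length_vadd: "length (vadd u v) = min (length u) (length v)"
  by (induction u v rule: vadd.induct) auto

type_synonym pair_poly = "int list \<times> int list"

text \<open>A \<open>pair_poly\<close> \<open>(A, B)\<close> stands for \<open>A(t) + B(t) T\<close>. As \<open>t\<^sup>2 T\<^sup>2 = 1 + t - T + t\<^sup>2 T\<close> on the curve,
  these pairs are closed under multiplication by \<open>t\<^sup>2 T\<close>, but not under multiplication by \<open>T\<close>.\<close>

definition ppval :: "complex \<Rightarrow> complex \<Rightarrow> pair_poly \<Rightarrow> complex" where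
  "ppval t T P = pval t (fst P) + pval t (snd P) * T"

definition pp_add :: "pair_poly \<Rightarrow> pair_poly \<Rightarrow> pair_poly" where
  "pp_add P R = (padd (fst P) (fst R), padd (snd P) (snd R))"

definition pp_smult :: "int \<Rightarrow> pair_poly \<Rightarrow> pair_poly" where
  "pp_smult c P = (map ((*) c) (fst P), map ((*) c) (snd P))"

definition pp_t :: "pair_poly \<Rightarrow> pair_poly" where
  "pp_t P = (0 # fst P, 0 # snd P)"

definition pp_m :: "pair_poly \<Rightarrow> pair_poly" where
  "pp_m P = pp_add P (pp_t P)"

definition pp_T :: "pair_poly \<Rightarrow> pair_poly" where
  "pp_T P = (padd (snd P) (0 # snd P),
     padd (0 # 0 # fst P) (padd (0 # 0 # snd P) (map uminus (snd P))))"

definition pp_s :: "pair_poly \<Rightarrow> pair_poly" where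
  "pp_s P = pp_add (pp_T P) (pp_smult (- 1) (pp_t (pp_t P)))"

lemma ppval_add: "ppval t T (pp_add P R) = ppval t T P + ppval t T R"
  by (simp add: ppval_def pp_add_def pval_padd algebra_simps)

lemma ppval_smult: "ppval t T (pp_smult c P) = of_int c * ppval t T P"
  by (simp add: ppval_def pp_smult_def pval_smult algebra_simps)

lemma ppval_t: "ppval t T (pp_t P) = t * ppval t T P"
  by (simp add: ppval_def pp_t_def algebra_simps)

lemma ppval_m: "ppval t T (pp_m P) = (1 + t) * ppval t T P"
  by (simp add: pp_m_def ppval_add ppval_t algebra_simps)

lemma ppval_T:
  assumes "t\<^sup>2 * T\<^sup>2 = 1 + t - T + t\<^sup>2 * T"
  shows "ppval t T (pp_T P) = t\<^sup>2 * T * ppval t T P"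
proof -
  have "ppval t T (pp_T P) = t\<^sup>2 * T * pval t (fst P) + (1 + t - T + t\<^sup>2 * T) * pval t (snd P)"
    by (simp add: ppval_def pp_T_def pval_padd pval_uminus algebra_simps power2_eq_square)
  also have "\<dots> = t\<^sup>2 * T * ppval t T P"
    unfolding assms[symmetric] by (simp add: ppval_def algebra_simps power2_eq_square)
  finally show ?thesis .
qed

lemma ppval_s:
  assumes "t\<^sup>2 * T\<^sup>2 = 1 + t - T + t\<^sup>2 * T"
  shows "ppval t T (pp_s P) = t\<^sup>2 * (T - 1) * ppval t T P"
  by (simp add: pp_s_def ppval_add ppval_smult ppval_t ppval_T[OF assms] algebra_simps power2_eq_square)

fun iter :: "nat \<Rightarrow> ('a \<Rightarrow> 'a) \<Rightarrow> 'a \<Rightarrow> 'a" where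
  "iter 0 f x = x"
| "iter (Suc n) f x = iter n f (f x)"

lemma ppval_iter:
  assumes "\<And>P. ppval t T (f P) = c * ppval t T P"
  shows "ppval t T (iter n f P) = c ^ n * ppval t T P"
  by (induction n arbitrary: P) (simp_all add: assms)

text \<open>A term \<open>(n, v, k, P)\<close> denotes \<open>q\<^sup>n \<zeta>\<^sup>k P(t, T)\<close> times the Laurent monomial with exponent vector \<open>v\<close>
  in \<open>\<eta>, j\<^sub>5, y, t, T, 1 + t, T - 1\<close>, where \<open>y = j\<^sub>4 / j\<^sub>5\<close>.\<close>

type_synonym qterm = "int \<times> int list \<times> int \<times> pair_poly"

text \<open>This is \<open>Q = t^3 (1 + t)^2 / (y^11 T (T - 1)^2)\<close>, the last identity of
  \<open>parametrization\<close>; with it a factor \<open>q ^ 11\<close> is traded for a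
  monomial.\<close>

definition Qvec :: "int list" where "Qvec = [0, 0, - 11, 3, - 1, 2, - 2]"

text \<open>Two reductions by 11 suffice for the data: their exponents are at most 15, so a product
  of two has exponent at most 30.\<close>

fun qnorm :: "qterm \<Rightarrow> qterm" where
  "qnorm (n, v, k, P) =
    (if n < 11 then (n, v, k, P)
     else if n < 22 then (n - 11, vadd Qvec v, k, P)
     else (n - 22, vadd Qvec (vadd Qvec v), k, P))"

fun sterm_mult :: "int \<times> int list \<times> int \<times> int \<Rightarrow> qterm \<Rightarrow> qterm" where
  "sterm_mult (n, v, k, c) (n', v', k', P) =
    qnorm (n + n', vadd v v', if k + k' < 11 then k + k' else k + k' - 11, pp_smult c P)"

definition sterms_mult :: "(int \<times> int list \<times> int \<times> int) list \<Rightarrow> qterm list \<Rightarrow> qterm list" where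
  "sterms_mult xs ys = concat (map (\<lambda>x. map (sterm_mult x) ys) xs)"

fun list_upd :: "int \<Rightarrow> ('a \<Rightarrow> 'a) \<Rightarrow> 'a list \<Rightarrow> 'a list" where
  "list_upd i f [] = []"
| "list_upd i f (x # xs) = (if i = 0 then f x # xs else x # list_upd (i - 1) f xs)"

text \<open>A term is divided by the normalising monomial of the residue class of \<open>n\<close> modulo 11; the extra factor
  \<open>t\<^sup>8\<close> makes multiplication by powers of \<open>T\<close> and \<open>T - 1\<close> possible.\<close>

fun unit_mult :: "int list \<Rightarrow> pair_poly \<Rightarrow> pair_poly" where
  "unit_mult [e, j, y, a, b, c, d] P =
     iter (nat (8 - 2 * (b + d))) pp_t (iter (nat d) pp_s (iter (nat b) pp_T (iter (nat c) pp_m (iter (nat a) pp_t P))))"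
| "unit_mult _ P = P"

fun unit_ok :: "int list \<Rightarrow> bool" where
  "unit_ok [e, j, y, a, b, c, d] \<longleftrightarrow> e = 0 \<and> j = 0 \<and> y = 0 \<and> 0 \<le> a \<and> 0 \<le> b \<and> 0 \<le> c \<and> 0 \<le> d \<and> b + d \<le> 4"
| "unit_ok _ \<longleftrightarrow> False"

fun row_nth :: "int \<Rightarrow> int list list \<Rightarrow> int list" where
  "row_nth i [] = []"
| "row_nth i (x # xs) = (if i = 0 then x else row_nth (i - 1) xs)"

text \<open>The table has one row for each exponent of \<open>q\<close> and, within it, one column
  for each exponent of \<open>\<zeta>\<close>; \<open>Ms\<close> supplies the normalising monomial
  of every row.\<close>

fun add_term :: "int list list \<Rightarrow> qterm \<Rightarrow> pair_poly list list \<Rightarrow> pair_poly list list" where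
  "add_term Ms (n, v, k, P) rs =
    list_upd n (list_upd k (pp_add (unit_mult (vadd v (map uminus (row_nth n Ms))) P))) rs"

fun term_ok :: "int list list \<Rightarrow> qterm \<Rightarrow> bool" where
  "term_ok Ms (n, v, k, P) \<longleftrightarrow> 0 \<le> n \<and> n < 11 \<and> 0 \<le> k \<and> k < 11 \<and> length v = 7 \<and>
     unit_ok (vadd v (map uminus (row_nth n Ms)))"

definition pp_zero :: "pair_poly \<Rightarrow> bool" where
  "pp_zero P \<longleftrightarrow> list_all (\<lambda>x. x = 0) (fst P) \<and> list_all (\<lambda>x. x = 0) (snd P)"

text \<open>The eleven powers of \<open>\<zeta>\<close> sum to 0, so a row of eleven columns
  evaluates to 0 as soon as all of them carry the same polynomial.\<close>

definition row_ok :: "pair_poly list \<Rightarrow> bool" where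
  "row_ok r \<longleftrightarrow> list_all (\<lambda>P. pp_zero (pp_add P (pp_smult (- 1) (hd r)))) r"

definition zero_rows :: "pair_poly list list" where
  "zero_rows = replicate 11 (replicate 11 ([], []))"

definition check :: "int list list \<Rightarrow> qterm list \<Rightarrow> bool" where
  "check Ms X \<longleftrightarrow> length Ms = 11 \<and> list_all (\<lambda>M. length M = 7) Ms \<and> list_all (term_ok Ms) X \<and>
     list_all row_ok (fold (add_term Ms) X zero_rows)"

section \<open>Soundness of the check\<close>

locale level_eleven =
  fixes q \<zeta> e j y t T :: complex
  assumes nz: "q \<noteq> 0" "\<zeta> \<noteq> 0" "e \<noteq> 0" "j \<noteq> 0" "y \<noteq> 0" "t \<noteq> 0" "T \<noteq> 0" "1 + t \<noteq> 0" "T - 1 \<noteq> 0"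
    and curve: "t\<^sup>2 * T\<^sup>2 = 1 + t - T + t\<^sup>2 * T"
    and q_power_11: "q ^ 11 = monom_val [e, j, y, t, T, 1 + t, T - 1] Qvec"
    and \<zeta>_power_11: "\<zeta> ^ 11 = 1"
    and \<zeta>_sum: "(\<Sum>k<11. \<zeta> ^ k) = 0"
begin

abbreviation mon :: "int list \<Rightarrow> complex" where
  "mon \<equiv> monom_val [e, j, y, t, T, 1 + t, T - 1]"

lemma mon_vadd: "length u = 7 \<Longrightarrow> length v = 7 \<Longrightarrow> mon (vadd u v) = mon u * mon v"
  using nz by (intro monom_val_vadd) auto

fun qval :: "qterm \<Rightarrow> complex" where
  "qval (n, v, k, P) = q powi n * mon v * \<zeta> powi k * ppval t T P"

fun sval :: "int \<times> int list \<times> int \<times> int \<Rightarrow> complex" where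
  "sval (n, v, k, c) = q powi n * mon v * \<zeta> powi k * of_int c"

lemma q_powi_11: "q powi n = q powi (n - 11) * mon Qvec"
  using nz(1) power_int_add[of q "n - 11" 11] q_power_11 by simp

lemma \<zeta>_powi_11: "\<zeta> powi n = \<zeta> powi (n - 11)"
  using nz(2) power_int_add[of \<zeta> "n - 11" 11] \<zeta>_power_11 by simp

lemma qval_qnorm:
  assumes "length v = 7"
  shows "qval (qnorm (n, v, k, P)) = qval (n, v, k, P)"
proof -
  have l: "length Qvec = 7" by (simp add: Qvec_def)
  have 1: "q powi n = q powi (n - 11) * mon Qvec" by (rule q_powi_11)
  have 2: "q powi (n - 11) = q powi (n - 22) * mon Qvec"
    using q_powi_11[of "n - 11"] by simp
  show ?thesis
    using assms l 1 2 by (simp add: mon_vadd length_vadd)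
qed

lemma qval_sterm_mult:
  assumes "length v = 7" "length v' = 7"
  shows "qval (sterm_mult (n, v, k, c) (n', v', k', P)) = sval (n, v, k, c) * qval (n', v', k', P)"
proof -
  have "\<zeta> powi (if k + k' < 11 then k + k' else k + k' - 11) = \<zeta> powi k * \<zeta> powi k'"
    using \<zeta>_powi_11[of "k + k'"] nz(2) by (simp add: power_int_add)
  then show ?thesis
    using assms nz(1)
    by (simp only: sterm_mult.simps qval_qnorm length_vadd qval.simps mon_vadd ppval_smult)
       (simp add: power_int_add)
qed

lemma qval_sterms_mult:
  assumes "list_all (\<lambda>x. length (fst (snd x)) = 7) xs" "list_all (\<lambda>x. length (fst (snd x)) = 7) ys"
  shows "sum_list (map qval (sterms_mult xs ys)) = sum_list (map sval xs) * sum_list (map qval ys)"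
  using assms(1)
proof (induction xs)
  case (Cons x xs)
  have "sum_list (map qval (map (sterm_mult x) ys)) = sval x * sum_list (map qval ys)"
    using assms(2) Cons.prems
  proof (induction ys)
    case (Cons z zs)
    obtain n v k c n' v' k' P where "x = (n, v, k, c)" "z = (n', v', k', P)" by (metis prod_cases4)
    with Cons qval_sterm_mult[of v v' n k c n' k' P] show ?case by (simp add: distrib_left)
  qed simp
  with Cons show ?case by (simp add: sterms_mult_def distrib_right)
qed (simp add: sterms_mult_def)

lemma length_list_upd [simp]: "length (list_upd i f xs) = length xs"
  by (induction i f xs rule: list_upd.induct) auto

fun rowval :: "pair_poly list \<Rightarrow> complex" where
  "rowval [] = 0"
| "rowval (P # Ps) = ppval t T P + \<zeta> * rowval Ps"

fun rowsval :: "int list list \<Rightarrow> pair_poly list list \<Rightarrow> complex" where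
  "rowsval (M # Ms) (r # rs) = mon M * rowval r + q * rowsval Ms rs"
| "rowsval _ _ = 0"

lemma rowval_list_upd:
  assumes "0 \<le> k" "k < int (length r)"
  shows "rowval (list_upd k (pp_add P) r) = rowval r + \<zeta> powi k * ppval t T P"
  using assms
proof (induction r arbitrary: k)
  case (Cons R r)
  show ?case
  proof (cases "k = 0")
    case False
    have "\<zeta> * \<zeta> powi (k - 1) = \<zeta> powi k" using nz(2) by (simp add: power_int_diff)
    then show ?thesis using Cons.IH[of "k - 1"] Cons.prems False
      by (simp add: distrib_left flip: mult.assoc)
  qed (simp add: ppval_add)
qed simp

lemma rowsval_list_upd:
  assumes "0 \<le> n" "n < int (length rs)" "length Ms = length rs"
    and "0 \<le> k" "k < 11" "list_all (\<lambda>r. length r = 11) rs"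
  shows "rowsval Ms (list_upd n (list_upd k (pp_add P)) rs) =
    rowsval Ms rs + q powi n * mon (row_nth n Ms) * \<zeta> powi k * ppval t T P"
  using assms
proof (induction rs arbitrary: n Ms)
  case (Cons r rs)
  obtain M Ms' where Ms: "Ms = M # Ms'" using Cons.prems(3) by (cases Ms) auto
  show ?case
  proof (cases "n = 0")
    case True
    then show ?thesis using Cons.prems by (simp add: Ms rowval_list_upd algebra_simps)
  next
    case False
    have "q * q powi (n - 1) = q powi n" using nz(1) by (simp add: power_int_diff)
    then show ?thesis using Cons.IH[of "n - 1" Ms'] Cons.prems False
      by (simp add: Ms distrib_left flip: mult.assoc)
  qed
qed simp

text \<open>Each factor \<open>T\<close> or \<open>T - 1\<close> is applied together with
  \<open>t^2\<close>, which uses up \<open>2 * (b + d)\<close> of the eight factors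
  \<open>t\<close>; the outermost iteration of \<open>pp_t\<close> supplies the others, whence the
  bound \<open>b + d \<le> 4\<close>.\<close>

lemma ppval_unit_mult:
  assumes "unit_ok v"
  shows "ppval t T (unit_mult v P) = t ^ 8 * mon v * ppval t T P"
proof -
  obtain a b c d where v: "v = [0, 0, 0, a, b, c, d]" and nn: "0 \<le> a" "0 \<le> b" "0 \<le> c" "0 \<le> d" "b + d \<le> 4"
    using assms by (cases v rule: unit_ok.cases) auto
  define A B C D where "A = nat a" and "B = nat b" and "C = nat c" and "D = nat d"
  have abcd: "a = int A" "b = int B" "c = int C" "d = int D"
    using nn by (auto simp: A_def B_def C_def D_def)
  have BD: "B + D \<le> 4" using nn abcd by simp
  have n8: "nat (8 - 2 * (int B + int D)) = 8 - 2 * (B + D)" using BD by simp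
  have "t ^ (8 - 2 * (B + D)) * ((t\<^sup>2 * (T - 1)) ^ D * (t\<^sup>2 * T) ^ B) =
      t ^ (8 - 2 * (B + D)) * (t ^ (2 * D) * t ^ (2 * B)) * ((T - 1) ^ D * T ^ B)"
    by (simp add: power_mult_distrib power_mult)
  also have "t ^ (8 - 2 * (B + D)) * (t ^ (2 * D) * t ^ (2 * B)) = t ^ 8"
    using BD by (simp flip: power_add)
  finally have e: "t ^ (8 - 2 * (B + D)) * ((t\<^sup>2 * (T - 1)) ^ D * (t\<^sup>2 * T) ^ B) = t ^ 8 * ((T - 1) ^ D * T ^ B)" .
  have "ppval t T (unit_mult v P) =
     (t ^ (8 - 2 * (B + D)) * ((t\<^sup>2 * (T - 1)) ^ D * (t\<^sup>2 * T) ^ B)) * ((1 + t) ^ C * t ^ A) * ppval t T P"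
    unfolding v abcd unit_mult.simps n8 nat_int
    by (simp only: ppval_iter[OF ppval_t] ppval_iter[OF ppval_m] ppval_iter[OF ppval_T[OF curve]]
        ppval_iter[OF ppval_s[OF curve]] mult.assoc)
  also have "\<dots> = t ^ 8 * mon v * ppval t T P"
    unfolding e v abcd by (simp add: mult_ac)
  finally show ?thesis .
qed

lemma rowsval_add_term:
  assumes ok: "term_ok Ms x" and Ms: "length Ms = 11" "list_all (\<lambda>M. length M = 7) Ms"
    and rs: "length rs = 11" "list_all (\<lambda>r. length r = 11) rs"
  shows "rowsval Ms (add_term Ms x rs) = rowsval Ms rs + t ^ 8 * qval x"
proof -
  obtain n v k P where x: "x = (n, v, k, P)" by (metis prod_cases4)
  let ?M = "row_nth n Ms" and ?w = "vadd v (map uminus (row_nth n Ms))"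
  have n: "0 \<le> n" "n < 11" "0 \<le> k" "k < 11" "length v = 7" "unit_ok ?w" using ok x by auto
  have "row_nth n Ms \<in> set Ms" if "0 \<le> n" "n < int (length Ms)" for n and Ms :: "int list list"
    using that by (induction n Ms rule: row_nth.induct) auto
  then have M: "length ?M = 7" using n Ms by (auto simp: list_all_iff)
  have vv: "vadd u (vadd v (map uminus u)) = v" if "length u = length v" for u v
    using that by (induction u v rule: list_induct2) auto
  have "mon ?M * mon ?w = mon (vadd ?M ?w)" using M n by (subst mon_vadd) (auto simp: length_vadd)
  also have "\<dots> = mon v" using vv[of ?M v] M n by simp
  finally have mv: "mon ?M * mon ?w = mon v" .
  have "rowsval Ms (add_term Ms x rs) =
      rowsval Ms rs + q powi n * mon ?M * \<zeta> powi k * (t ^ 8 * mon ?w * ppval t T P)"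
    unfolding x add_term.simps
    by (subst rowsval_list_upd) (use n rs Ms in \<open>simp_all add: ppval_unit_mult\<close>)
  also have "q powi n * mon ?M * \<zeta> powi k * (t ^ 8 * mon ?w * ppval t T P) =
      t ^ 8 * (q powi n * (mon ?M * mon ?w) * \<zeta> powi k * ppval t T P)"
    by (simp only: mult_ac)
  finally show ?thesis unfolding mv x by simp
qed

lemma add_term_lengths:
  assumes "length rs = 11" "list_all (\<lambda>r. length r = 11) rs"
  shows "length (add_term Ms x rs) = 11" "list_all (\<lambda>r. length r = 11) (add_term Ms x rs)"
proof -
  obtain n v k P where x: "x = (n, v, k, P)" by (metis prod_cases4)
  have "list_all (\<lambda>r. length r = 11) (list_upd i (list_upd k f) rs)" if "list_all (\<lambda>r. length r = 11) rs"
    for i f and rs :: "pair_poly list list"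
    using that by (induction rs arbitrary: i) auto
  then show "length (add_term Ms x rs) = 11" "list_all (\<lambda>r. length r = 11) (add_term Ms x rs)"
    using assms by (auto simp: x)
qed

lemma rowsval_fold:
  assumes "list_all (term_ok Ms) X" "length Ms = 11" "list_all (\<lambda>M. length M = 7) Ms"
    and "length rs = 11" "list_all (\<lambda>r. length r = 11) rs"
  shows "rowsval Ms (fold (add_term Ms) X rs) = rowsval Ms rs + t ^ 8 * sum_list (map qval X) \<and>
    list_all (\<lambda>r. length r = 11) (fold (add_term Ms) X rs)"
  using assms
proof (induction X arbitrary: rs)
  case (Cons x X)
  then show ?case
    using rowsval_add_term[of Ms x rs] add_term_lengths[of rs Ms x] by (simp add: distrib_left)
qed simp

lemma pp_zero_ppval: "pp_zero P \<Longrightarrow> ppval t T P = 0"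
proof -
  have "pval t xs = 0" if "list_all (\<lambda>x. x = 0) xs" for xs using that by (induction xs) auto
  then show "pp_zero P \<Longrightarrow> ppval t T P = 0" by (simp add: pp_zero_def ppval_def)
qed

lemma rowval_row_ok:
  assumes "row_ok r" "length r = 11"
  shows "rowval r = 0"
proof -
  have "rowval r = c * (\<Sum>k<length r. \<zeta> ^ k)" if "list_all (\<lambda>P. ppval t T P = c) r" for c r
    using that
  proof (induction r)
    case (Cons P r)
    have "(\<Sum>k<Suc n. \<zeta> ^ k) = 1 + \<zeta> * (\<Sum>k<n. \<zeta> ^ k)" for n
      by (simp add: sum.lessThan_Suc_shift sum_distrib_left del: sum.lessThan_Suc)
    with Cons show ?case by (simp add: algebra_simps del: sum.lessThan_Suc)
  qed simp
  moreover have "list_all (\<lambda>P. ppval t T P = ppval t T (hd r)) r"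
    using assms(1) unfolding row_ok_def list_all_iff
    by (auto dest!: pp_zero_ppval bspec simp: ppval_add ppval_smult)
  ultimately show ?thesis using assms(2) \<zeta>_sum by simp
qed

text \<open>Evaluated as a whole, the table is \<open>t ^ 8\<close> times the sum of the terms;
  evaluated row by row, it is 0. Nothing is used of the seven numbers beyond the relations of the
  locale, so theta functions do not enter the computation.\<close>

theorem check_sound:
  assumes "check Ms X"
  shows "sum_list (map qval X) = 0"
proof -
  have z: "rowsval Ms zero_rows = 0"
  proof -
    have "rowval (replicate n ([], [])) = 0" for n by (induction n) (simp_all add: ppval_def)
    then have "rowsval Ms (replicate n (replicate m ([], []))) = 0" for n m
      by (induction n arbitrary: Ms) (case_tac Ms; simp)+
    then show ?thesis by (simp add: zero_rows_def)
  qed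
  have "length zero_rows = 11" "list_all (\<lambda>r. length r = 11) zero_rows"
    by (simp_all add: zero_rows_def list_all_iff)
  with rowsval_fold[of Ms X zero_rows] assms
  have f: "rowsval Ms (fold (add_term Ms) X zero_rows) = t ^ 8 * sum_list (map qval X)"
    "list_all (\<lambda>r. length r = 11) (fold (add_term Ms) X zero_rows)"
    by (auto simp: check_def z)
  have "rowsval Ms rs = 0" if "list_all (\<lambda>r. rowval r = 0) rs" for rs Ms
    using that by (induction Ms rs rule: rowsval.induct) auto
  moreover have "list_all (\<lambda>r. rowval r = 0) (fold (add_term Ms) X zero_rows)"
    using assms f(2) rowval_row_ok by (auto simp: check_def list_all_iff)
  ultimately have "t ^ 8 * sum_list (map qval X) = 0" unfolding f(1)[symmetric] by blast
  then show ?thesis using nz(6) by simp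
qed

end

section \<open>Coefficient data\<close>

text \<open>The dissection of \<open>theta q \<zeta>\<close> divided by \<open>\<zeta> ^ 6\<close>.
  The k-th inner list (from 1) pairs the classes \<open>k\<close> and \<open>11 - k\<close>, which
  share the exponent vector of \<open>J k\<close>.\<close>

definition theta_terms :: "(int \<times> int list \<times> int \<times> int) list list" where
  "theta_terms = [
    [(10, [0, 1, 10, - 2, 1, - 2, 2], 1, 1),
     (10, [0, 1, 10, - 2, 1, - 2, 2], 10, - 1)],
    [(6, [0, 1, 6, - 1, 1, - 1, 1], 2, - 1),
     (6, [0, 1, 6, - 1, 1, - 1, 1], 9, 1)],
    [(3, [0, 1, 3, 0, 1, - 1, 0], 3, 1),
     (3, [0, 1, 3, 0, 1, - 1, 0], 8, - 1)],
    [(1, [0, 1, 1, 0, 0, 0, 0], 4, - 1),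
     (1, [0, 1, 1, 0, 0, 0, 0], 7, 1)],
    [(0, [0, 1, 0, 0, 0, 0, 0], 5, 1),
     (0, [0, 1, 0, 0, 0, 0, 0], 6, - 1)]]"

text \<open>The dissection of the crank product
  \<open>(1 - \<zeta>) (q)^2 / theta q \<zeta>\<close>, listed by the residue of the exponent of
  \<open>q\<close>. Up to the power of \<open>q\<close> its monomials are the \<open>Y\<close>
  quotients, and class 6 is empty.\<close>

definition crank_terms :: "(int \<times> int list \<times> int \<times> int) list list" where
  "crank_terms = [
    [(0, [2, - 1, - 10, 2, - 1, 2, - 2], 0, 1)],
    [(1, [2, - 1, - 9, 1, - 2, 2, - 1], 1, 1),
     (1, [2, - 1, - 9, 1, - 2, 2, - 1], 10, 1),
     (1, [2, - 1, - 9, 1, - 2, 2, - 1], 0, - 1)],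
    [(2, [2, - 1, - 8, 2, 0, 1, - 2], 2, 1),
     (2, [2, - 1, - 8, 2, 0, 1, - 2], 9, 1)],
    [(3, [2, - 1, - 7, 1, - 1, 2, - 1], 0, 1),
     (3, [2, - 1, - 7, 1, - 1, 2, - 1], 3, 1),
     (3, [2, - 1, - 7, 1, - 1, 2, - 1], 8, 1)],
    [(4, [2, - 1, - 6, 1, - 1, 1, - 1], 0, 1),
     (4, [2, - 1, - 6, 1, - 1, 1, - 1], 2, 1),
     (4, [2, - 1, - 6, 1, - 1, 1, - 1], 9, 1),
     (4, [2, - 1, - 6, 1, - 1, 1, - 1], 4, 1),
     (4, [2, - 1, - 6, 1, - 1, 1, - 1], 7, 1)],
    [(5, [2, - 1, - 5, 1, - 1, 1, - 1], 2, - 1),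
     (5, [2, - 1, - 5, 1, - 1, 1, - 1], 9, - 1),
     (5, [2, - 1, - 5, 1, - 1, 1, - 1], 4, - 1),
     (5, [2, - 1, - 5, 1, - 1, 1, - 1], 7, - 1)],
    [],
    [(7, [2, - 1, - 3, 0, - 1, 1, 0], 1, 1),
     (7, [2, - 1, - 3, 0, - 1, 1, 0], 10, 1),
     (7, [2, - 1, - 3, 0, - 1, 1, 0], 4, 1),
     (7, [2, - 1, - 3, 0, - 1, 1, 0], 7, 1)],
    [(8, [2, - 1, - 2, 1, 0, 0, 0], 1, 1),
     (8, [2, - 1, - 2, 1, 0, 0, 0], 10, 1),
     (8, [2, - 1, - 2, 1, 0, 0, 0], 3, 1),
     (8, [2, - 1, - 2, 1, 0, 0, 0], 8, 1),
     (8, [2, - 1, - 2, 1, 0, 0, 0], 4, 1),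
     (8, [2, - 1, - 2, 1, 0, 0, 0], 7, 1)],
    [(9, [2, - 1, - 1, 0, 0, 0, 0], 0, - 1),
     (9, [2, - 1, - 1, 0, 0, 0, 0], 4, - 1),
     (9, [2, - 1, - 1, 0, 0, 0, 0], 7, - 1)],
    [(10, [2, - 1, 0, 0, 0, 0, 0], 3, - 1),
     (10, [2, - 1, 0, 0, 0, 0, 0], 8, - 1)]]"

text \<open>For \<open>a = 1, ..., 5\<close> the entries encode
  \<open>(-1)^a * 11 * J a * (22 * le a - (11 - 2 * a))\<close>, as shown in
  \<open>log_deriv_terms\<close>. The last one belongs to class 0, where
  \<open>- 242 = - 22 * 11\<close>.\<close>

definition neg_omega_terms :: "qterm list list" where
  "neg_omega_terms = [
    [(10, [3, 0, - 5, 0, - 2, 1, 0], 1, ([99, 187, 77], [0, 55, 154, 77])),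
     (10, [3, 0, - 5, 0, - 2, 1, 0], 10, ([99, 187, 77], [0, 55, 154, 77]))],
    [(6, [3, 0, - 9, 1, - 2, 2, - 1], 2, ([- 77, - 11, - 33], [0, 11, - 66, - 33])),
     (6, [3, 0, - 9, 1, - 2, 2, - 1], 9, ([- 77, - 11, - 33], [0, 11, - 66, - 33]))],
    [(3, [3, 0, - 12, 2, - 2, 2, - 2], 3, ([55, 77, - 11], [0, - 77, - 22, - 11])),
     (3, [3, 0, - 12, 2, - 2, 2, - 2], 8, ([55, 77, - 11], [0, - 77, - 22, - 11]))],
    [(1, [3, 0, - 14, 2, - 3, 3, - 2], 4, ([- 33, 99, 55], [0, - 99, 110, 55])),
     (1, [3, 0, - 14, 2, - 3, 3, - 2], 7, ([- 33, 99, 55], [0, - 99, 110, 55]))],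
    [(0, [3, 0, - 15, 2, - 3, 3, - 2], 5, ([11, - 33, - 99], [0, 33, 44, - 99])),
     (0, [3, 0, - 15, 2, - 3, 3, - 2], 6, ([11, - 33, - 99], [0, 33, 44, - 99]))],
    [(15, [3, 0, 0, 0, 0, 0, 0], 0, ([- 242], []))]]"

definition odd_terms :: "int \<Rightarrow> int list \<times> pair_poly list \<Rightarrow> qterm list" where
  "odd_terms n d = concat (map2 (\<lambda>b R. [(n, fst d, b, R), (n, fst d, 11 - b, pp_smult (- 1) R)]) [1, 2, 3, 4, 5] (snd d))"

text \<open>Numerators over the common denominator 22. The polynomials are those of the statement
  multiplied by \<open>t^2\<close>, to clear its negative powers of \<open>t\<close>; accordingly
  the vector in row m is that of \<open>V_m / t^2\<close>.\<close>

definition V_data :: "(int list \<times> pair_poly list) list" where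
  "V_data = [
    ([5, - 2, - 25, 3, - 4, 5, - 4], [([0, - 9, - 61, - 95], [0, 0, - 49, 96, - 95]), ([0, - 7, 87, - 47], [0, 0, - 65, - 6, - 47]), ([0, - 5, - 249, 1], [0, 0, 161, - 108, 1]), ([0, - 3, 141, 49], [0, 0, - 97, 32, 49]), ([0, - 1, 47, 97], [0, 0, - 113, - 70, 97])]),
    ([5, - 2, - 24, 2, - 4, 4, - 4], [([0, 0, - 92, - 84, 8], [0, 0, 72, - 142, - 290, - 66]), ([0, 0, - 8, - 223, - 215], [0, 0, 1, 156, 80, - 132]), ([0, 0, 98, 221, 123], [0, 0, - 103, - 96, - 12, 44]), ([0, 0, - 38, - 61, - 23], [0, 0, 35, - 106, - 104, - 22]), ([0, 0, - 174, - 101, 73], [0, 0, 173, 126, 46, 154])]),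
    ([5, - 2, - 23, 3, - 3, 4, - 4], [([0, 4, - 34, 30], [0, 0, 78, - 116, 8]), ([0, - 47, - 145, - 171], [0, 0, - 9, 32, 27]), ([0, - 10, - 36, 46], [0, 0, - 74, 48, - 20]), ([0, - 6, 172, 76], [0, 0, 4, - 68, - 12]), ([0, - 2, - 346, - 136], [0, 0, 82, 58, - 4])]),
    ([5, - 2, - 22, 3, - 3, 4, - 4], [([0, 10, - 153, - 53], [0, - 15, 146, 120]), ([0, - 2, 79, 59], [0, 3, - 126, - 24]), ([0, - 102, 36, - 16], [0, 32, - 134, - 14]), ([0, 18, - 227, - 47], [0, - 27, 166, - 26]), ([0, 6, 247, 65], [0, - 9, - 106, - 170])]),
    ([5, - 2, - 21, 3, - 3, 3, - 4], [([0, 244, 405, 161], [0, - 245, - 270, - 20]), ([0, - 150, - 246, - 96], [0, 104, 164, 48]), ([0, 6, 5, - 1], [0, - 9, - 84, - 60]), ([0, - 58, - 8, 50], [0, - 34, - 156, - 146]), ([0, 10, - 153, - 163], [0, - 15, 102, 142])]),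
    ([5, - 2, - 20, 2, - 2, 3, - 4], [([0, 0, - 30, 206, 198, 32], [0, 0, 0, - 154, - 182, - 32]), ([0, 0, - 5, - 369, - 330, - 35], [0, 0, 0, 176, 252, 35]), ([0, 0, - 68, 112, 110, 8], [0, 0, 0, 22, - 106, - 8]), ([0, 0, 1, - 23, 66, 7], [0, 0, 0, - 132, - 2, - 7]), ([0, 0, - 106, 18, 22, - 16], [0, 0, 0, - 44, - 30, 16])]),
    ([5, - 2, - 19, 2, - 2, 3, - 4], [([0, 0, - 220, - 418, - 132], [0, 0, 198, 132, 132]), ([0, 0, 44, 374, 220], [0, 0, - 88, - 220, - 220]), ([0, 0, 66, - 286, - 154], [0, 0, - 132, 154, 154]), ([0, 0, - 154, 22, - 44], [0, 0, 66, 44, 44]), ([0, 0, 110, 88, 66], [0, 0, 22, - 66, - 66])]),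
    ([5, - 2, - 18, 2, - 2, 3, - 4], [([0, 141, 112, 197, 21], [0, - 141, - 18, - 176, - 21]), ([0, - 92, - 128, - 156, - 24], [0, 92, - 14, 132, 24]), ([0, - 50, - 38, 52, 8], [0, 50, - 76, - 44, - 8]), ([0, 47, 118, - 15, 7], [0, - 47, - 6, 22, - 7]), ([0, 100, - 166, - 104, - 16], [0, - 100, 152, 88, 16])]),
    ([5, - 2, - 17, 1, - 3, 3, - 2], [([0, - 44, - 21, 107, 79], [0, 0, 0, - 107, 4, 79]), ([0, - 88, - 240, - 160, 4], [0, 0, 0, - 82, - 58, 4]), ([0, 110, 179, 79, - 5], [0, 0, 0, 163, 12, - 5]), ([0, - 176, - 95, - 23, - 69], [0, 0, 0, - 219, - 28, - 69]), ([0, 22, - 248, - 246, - 12], [0, 0, 0, 4, - 68, - 12])]),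
    ([5, - 2, - 16, 1, - 3, 3, - 3], [([15, 8, - 10], [- 15, 7, - 58, - 1]), ([- 3, - 50, 2], [3, 47, 60, 97]), ([- 21, 134, 14], [21, - 155, - 64, - 47]), ([16, - 56, 70], [- 16, 72, - 78, - 114]), ([9, - 92, - 248], [- 9, 101, 62, - 49])]),
    ([5, - 2, - 15, 0, - 3, 3, - 2], [([0, 0, 150, 78, - 8], [0, 0, 0, 32, 28, - 8]), ([0, 0, - 184, - 86, - 16], [0, 0, 0, 64, 56, - 16]), ([0, 0, 43, 3, 9], [0, 0, 0, - 157, - 92, 9]), ([0, 0, - 104, 4, 12], [0, 0, 0, - 48, - 42, 12]), ([0, 0, 46, - 160, 4], [0, 0, 0, 226, - 14, 4])])]"

text \<open>Again numerators over 22. The zero row at index 6 reflects the empty class of the crank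
  product.\<close>

definition Y_data :: "(int list \<times> pair_poly list) list" where
  "Y_data = [
    ([2, - 1, - 10, 2, - 1, 2, - 2], [([9], []), ([7], []), ([5], []), ([3], []), ([1], [])]),
    ([2, - 1, - 9, 1, - 2, 2, - 1], [([- 2], []), ([7], []), ([5], []), ([3], []), ([1], [])]),
    ([2, - 1, - 8, 2, 0, 1, - 2], [([- 4], []), ([3], []), ([10], []), ([6], []), ([2], [])]),
    ([2, - 1, - 7, 1, - 1, 2, - 1], [([5], []), ([- 1], []), ([4], []), ([9], []), ([3], [])]),
    ([2, - 1, - 6, 1, - 1, 1, - 1], [([1], []), ([2], []), ([3], []), ([4], []), ([5], [])]),
    ([2, - 1, - 5, 1, - 1, 1, - 1], [([8], []), ([5], []), ([2], []), ([- 1], []), ([- 4], [])]),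
    ([0, 0, 0, 0, 0, 0, 0], [([], []), ([], []), ([], []), ([], []), ([], [])]),
    ([2, - 1, - 3, 0, - 1, 1, 0], [([3], []), ([6], []), ([- 2], []), ([1], []), ([4], [])]),
    ([2, - 1, - 2, 1, 0, 0, 0], [([- 1], []), ([- 2], []), ([- 3], []), ([7], []), ([6], [])]),
    ([2, - 1, - 1, 0, 0, 0, 0], [([- 5], []), ([1], []), ([7], []), ([2], []), ([- 3], [])]),
    ([2, - 1, 0, 0, 0, 0, 0], [([4], []), ([8], []), ([1], []), ([- 6], []), ([- 2], [])])]"

definition V_terms :: "qterm list list" where
  "V_terms = map2 odd_terms [0, 1, 2, 3, 4, 5, 6, 7, 8, 9, 10] V_data"

definition Y_terms :: "qterm list list" where
  "Y_terms = map2 odd_terms [0, 1, 2, 3, 4, 5, 6, 7, 8, 9, 10] Y_data"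

definition neg_euler_terms :: "(int \<times> int list \<times> int \<times> int) list" where
  "neg_euler_terms = [
    (0, [1, 0, - 5, 1, - 1, 1, - 1], 0, - 1),
    (1, [1, 0, - 4, 1, 0, 1, - 1], 0, 1),
    (2, [1, 0, - 3, 0, - 1, 1, 0], 0, 1),
    (5, [1, 0, 0, 0, 0, 0, 0], 0, - 1),
    (7, [1, 0, 2, 0, 1, - 1, 0], 0, - 1),
    (15, [1, 0, 10, - 2, 1, - 2, 2], 0, 1)]"

definition euler_terms :: "qterm list" where
  "euler_terms = [
    (0, [1, 0, - 5, 1, - 1, 1, - 1], 0, ([1], [])),
    (1, [1, 0, - 4, 1, 0, 1, - 1], 0, ([- 1], [])),
    (2, [1, 0, - 3, 0, - 1, 1, 0], 0, ([- 1], [])),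
    (5, [1, 0, 0, 0, 0, 0, 0], 0, ([1], [])),
    (7, [1, 0, 2, 0, 1, - 1, 0], 0, ([1], [])),
    (15, [1, 0, 10, - 2, 1, - 2, 2], 0, ([- 1], []))]"

text \<open>A normalising monomial must agree with all terms of its row in the exponents of \<eta>,
  j_5 and y, and must not exceed them in the other four, so that the quotients pass
  \<open>unit_ok\<close>. The two tables below serve the same purpose.\<close>

definition crank_rows :: "int list list" where
  "crank_rows = [
    [2, 0, - 10, 2, - 2, 1, - 2],
    [2, 0, - 9, 1, - 2, 1, - 2],
    [2, 0, - 8, 1, - 2, 1, - 2],
    [2, 0, - 7, 1, - 1, 0, - 2],
    [2, 0, - 6, 0, - 2, 1, - 1],
    [2, 0, - 5, 1, - 1, 0, - 2],
    [2, 0, - 4, 1, - 1, 1, - 1],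
    [2, 0, - 3, 0, - 1, 0, - 1],
    [2, 0, - 2, 0, - 1, 0, - 1],
    [2, 0, - 1, 0, 0, 0, 0],
    [2, 0, 0, 0, 0, 0, 0]]"

definition Y_rows :: "int list list" where
  "Y_rows = [
    [2, - 1, - 10, 2, - 1, 2, - 2],
    [2, - 1, - 9, 1, - 2, 2, - 1],
    [2, - 1, - 8, 2, 0, 1, - 2],
    [2, - 1, - 7, 1, - 1, 2, - 1],
    [2, - 1, - 6, 1, - 1, 1, - 1],
    [2, - 1, - 5, 1, - 1, 1, - 1],
    [0, 0, 0, 0, 0, 0, 0],
    [2, - 1, - 3, 0, - 1, 1, 0],
    [2, - 1, - 2, 1, 0, 0, 0],
    [2, - 1, - 1, 0, 0, 0, 0],
    [2, - 1, 0, 0, 0, 0, 0]]"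

definition V_rows :: "int list list" where
  "V_rows = [
    [5, - 1, - 25, 3, - 5, 4, - 5],
    [5, - 1, - 24, 2, - 5, 4, - 5],
    [5, - 1, - 23, 2, - 5, 4, - 5],
    [5, - 1, - 22, 3, - 4, 3, - 4],
    [5, - 1, - 21, 2, - 4, 3, - 4],
    [5, - 1, - 20, 2, - 4, 3, - 4],
    [5, - 1, - 19, 2, - 4, 3, - 4],
    [5, - 1, - 18, 1, - 4, 2, - 4],
    [5, - 1, - 17, 1, - 4, 2, - 4],
    [5, - 1, - 16, 1, - 3, 2, - 4],
    [5, - 1, - 15, 0, - 3, 2, - 4]]"

definition zeta5_terms :: "(int \<times> int list \<times> int \<times> int) list" where
  "zeta5_terms = [(0, [0, 0, 0, 0, 0, 0, 0], 5, 1), (0, [0, 0, 0, 0, 0, 0, 0], 6, - 1)]"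

definition one_minus_zeta :: "(int \<times> int list \<times> int \<times> int) list" where
  "one_minus_zeta = [(0, [0, 0, 0, 0, 0, 0, 0], 0, 1), (0, [0, 0, 0, 0, 0, 0, 0], 1, - 1)]"

definition minus_11_one_plus_zeta :: "qterm list" where
  "minus_11_one_plus_zeta = [(0, [0, 0, 0, 0, 0, 0, 0], 0, ([- 11], [])), (0, [0, 0, 0, 0, 0, 0, 0], 1, ([- 11], []))]"

definition qterms_of :: "(int \<times> int list \<times> int \<times> int) list \<Rightarrow> qterm list" where
  "qterms_of xs = map (\<lambda>(n, v, k, c). (n, v, k, ([c], []))) xs"

text \<open>Behind this lies the evaluation of the sum of
  \<open>(11 - 2 * b) * (\<zeta>^b - \<zeta>^(11 - b))\<close> over b = 1, ..., 5 as
  \<open>11 * (1 + \<zeta>) / (1 - \<zeta>)\<close>; the coefficients 9, 7, 5, 3, 1 are visible in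
  the first row of \<open>Y_data\<close>.\<close>

lemma check_Y:
  "check Y_rows (sterms_mult one_minus_zeta (concat Y_terms) @
     sterms_mult (concat crank_terms) minus_11_one_plus_zeta)"
  by code_simp

text \<open>Confirms that \<open>crank_terms\<close> dissects the crank product, with the
  denominator cleared. The factor \<open>\<zeta>^5 - \<zeta>^6\<close> stands for
  \<open>1 - \<zeta>\<close>, since \<open>theta_terms\<close> omits the factor
  \<open>\<zeta>^6\<close> of theta.\<close>

lemma check_crank:
  "check crank_rows (sterms_mult (concat crank_terms) (qterms_of (concat theta_terms)) @
     sterms_mult zeta5_terms (sterms_mult neg_euler_terms euler_terms))"
  by code_simp

text \<open>Residue class \<open>m\<close> collects the products of the \<open>a\<close>-th theta term with the \<open>i\<close>-th term, where
  \<open>i\<close> is the residue of \<open>m - (5 - a) (6 - a) / 2\<close> modulo 11.\<close>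

definition V_class :: "nat list \<Rightarrow> qterm list" where
  "V_class is = concat (map2 (\<lambda>x i. sterms_mult x (V_terms ! i)) theta_terms is) @
     concat (map2 (\<lambda>i y. sterms_mult (crank_terms ! i) y) is neg_omega_terms)"

text \<open>Products of residue classes land in a single residue class, so each of the eleven lists
  fills only one row of the table and the large identity splits into independent
  computations.\<close>

lemma check_V:
  "check V_rows (V_class [1, 5, 8, 10, 0, 7])"
  "check V_rows (V_class [2, 6, 9, 0, 1, 8])"
  "check V_rows (V_class [3, 7, 10, 1, 2, 9])"
  "check V_rows (V_class [4, 8, 0, 2, 3, 10])"
  "check V_rows (V_class [5, 9, 1, 3, 4, 0])"
  "check V_rows (V_class [6, 10, 2, 4, 5, 1])"
  "check V_rows (V_class [7, 0, 3, 5, 6, 2])"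
  "check V_rows (V_class [8, 1, 4, 6, 7, 3])"
  "check V_rows (V_class [9, 2, 5, 7, 8, 4])"
  "check V_rows (V_class [10, 3, 6, 8, 9, 5])"
  "check V_rows (V_class [0, 4, 7, 9, 10, 6])"
  by code_simp+

section \<open>Theta functions of level 11\<close>

locale theta_eleven =
  fixes Q :: complex
  assumes Q: "Q \<noteq> 0" "norm Q < 1"
begin

definition P :: complex where "P = Q ^ 11"
definition J :: "nat \<Rightarrow> complex" where "J a = theta P (Q ^ a)"
definition \<eta> :: complex where "\<eta> = qpoch_inf P P"

lemma P: "P \<noteq> 0" "norm P < 1"
  using Q by (auto simp: P_def norm_power power_less_one_iff)

lemma norm_Q_power: "0 < a \<Longrightarrow> norm (Q ^ a) < 1"
  using Q by (simp add: norm_power power_less_one_iff)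

lemma \<eta>_nonzero: "\<eta> \<noteq> 0"
  unfolding \<eta>_def by (rule qpoch_inf_nonzero[OF P(2) P(2)])

lemma P_div: "a \<le> 11 \<Longrightarrow> P / Q ^ a = Q ^ (11 - a)"
  using Q(1) by (simp add: P_def power_diff)

lemma J_nonzero: "0 < a \<Longrightarrow> a < 11 \<Longrightarrow> J a \<noteq> 0"
  unfolding J_def theta_def
  using \<eta>_nonzero by (simp add: P_div \<eta>_def qpoch_inf_nonzero[OF P(2)] norm_Q_power)

lemma J_reflect: "a \<le> 11 \<Longrightarrow> J (11 - a) = J a"
  unfolding J_def using theta_reflect[OF P(1), of "Q ^ a"] Q(1) by (simp add: P_div)

lemma J_numeral: "J 6 = J 5" "J 7 = J 4" "J 8 = J 3" "J 9 = J 2" "J 10 = J 1"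
  using J_reflect[of 5] J_reflect[of 4] J_reflect[of 3] J_reflect[of 2] J_reflect[of 1] by simp_all

lemma J_Suc: "J (Suc (Suc 0)) = J 2" "J (Suc (Suc (Suc 0))) = J 3"
  by (simp_all add: numeral_2_eq_2 numeral_3_eq_3)

lemma theta_J_eq: "a \<le> 11 \<Longrightarrow> theta_J a 11 Q = J a"
  by (simp add: theta_J_def J_def theta_def P_div flip: P_def)

lemma eta_J_eq: "eta_J 11 Q = \<eta>"
  by (simp add: eta_J_def \<eta>_def P_def)

lemma bracket: "k \<le> i \<Longrightarrow> theta_bracket P (Q ^ i) (Q ^ k) = J (i + k) * J (i - k) / Q ^ i"
  using Q(1) by (simp add: theta_bracket_def J_def power_add power_diff)

lemma pluecker:
  assumes "d \<le> c" "c \<le> b" "b \<le> a"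
  shows "J (a + b) * J (a - b) / Q ^ a * (J (c + d) * J (c - d) / Q ^ c)
    - J (a + c) * J (a - c) / Q ^ a * (J (b + d) * J (b - d) / Q ^ b)
    + J (a + d) * J (a - d) / Q ^ a * (J (b + c) * J (b - c) / Q ^ b) = 0"
  using theta_pluecker[OF P, of "Q ^ a" "Q ^ b" "Q ^ c" "Q ^ d"] assms Q(1) by (simp add: bracket)

text \<open>These are \<open>pluecker\<close> at the exponents (5, 2, 1, 0), (4, 2, 1, 0) and (3, 2,
  1, 0), folded by the reflection of \<open>J\<close>. The first turns \<open>1 + t\<close> into a
  monomial, the second \<open>T - 1\<close>, and the third becomes the equation of the
  curve.\<close>

lemma three_term_relations:
  shows "Q * J 1 ^ 2 * J 3 * J 4 + J 1 * J 3 * J 5 ^ 2 = J 2 ^ 2 * J 4 * J 5"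
    and "Q * J 1 ^ 2 * J 2 * J 5 + J 1 * J 3 * J 4 ^ 2 = J 2 ^ 2 * J 3 * J 5"
    and "Q * J 1 ^ 3 * J 5 + J 1 * J 3 ^ 3 = J 2 ^ 3 * J 4"
proof -
  have "(Q * J 1 ^ 2 * J 3 * J 4 + J 1 * J 3 * J 5 ^ 2 - J 2 ^ 2 * J 4 * J 5) / Q ^ 7 = 0"
    using pluecker[of 0 1 2 5] Q(1) by (simp add: J_numeral J_Suc field_simps power_numeral_reduce)
  then show "Q * J 1 ^ 2 * J 3 * J 4 + J 1 * J 3 * J 5 ^ 2 = J 2 ^ 2 * J 4 * J 5" using Q(1) by simp
  have "(Q * J 1 ^ 2 * J 2 * J 5 + J 1 * J 3 * J 4 ^ 2 - J 2 ^ 2 * J 3 * J 5) / Q ^ 6 = 0"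
    using pluecker[of 0 1 2 4] Q(1) by (simp add: J_numeral J_Suc field_simps power_numeral_reduce)
  then show "Q * J 1 ^ 2 * J 2 * J 5 + J 1 * J 3 * J 4 ^ 2 = J 2 ^ 2 * J 3 * J 5" using Q(1) by simp
  have "(Q * J 1 ^ 3 * J 5 + J 1 * J 3 ^ 3 - J 2 ^ 3 * J 4) / Q ^ 5 = 0"
    using pluecker[of 0 1 2 3] Q(1) by (simp add: J_numeral J_Suc field_simps power_numeral_reduce)
  then show "Q * J 1 ^ 3 * J 5 + J 1 * J 3 ^ 3 = J 2 ^ 3 * J 4" using Q(1) by simp
qed

section \<open>Parametrisation of the theta functions by the curve\<close>

definition t :: complex where "t = Q * J 1 * J 4 / J 5 ^ 2"
definition T :: complex where "T = J 2 ^ 2 * J 5 / (J 1 * J 4 ^ 2)"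
definition y :: complex where "y = J 4 / J 5"

lemma J_nz: "J (Suc 0) \<noteq> 0" "J 1 \<noteq> 0" "J 2 \<noteq> 0" "J 3 \<noteq> 0" "J 4 \<noteq> 0" "J 5 \<noteq> 0"
  by (simp_all add: J_nonzero)

lemma t_T_nonzero: "t \<noteq> 0" "T \<noteq> 0" "y \<noteq> 0"
  using J_nz Q(1) by (simp_all add: t_def T_def y_def)

lemma one_plus_t: "1 + t = J 2 ^ 2 * J 4 / (J 1 * J 3 * J 5)"
proof -
  have "(1 + t) * (J 1 * J 3 * J 5 ^ 2) = J 1 * J 3 * J 5 ^ 2 + Q * J 1 ^ 2 * J 3 * J 4"
    using J_nz by (simp add: t_def distrib_right power2_eq_square)
  also have "\<dots> = J 2 ^ 2 * J 4 * J 5" using three_term_relations(1) by (simp add: add.commute)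
  finally have "J 5 * ((1 + t) * (J 1 * J 3 * J 5)) = J 5 * (J 2 ^ 2 * J 4)"
    by (simp only: power2_eq_square mult_ac)
  then have "(1 + t) * (J 1 * J 3 * J 5) = J 2 ^ 2 * J 4"
    by (subst (asm) mult_left_cancel) (rule J_nz)
  then show ?thesis by (subst eq_divide_eq) (simp add: J_nz)
qed

lemma T_minus_one: "T - 1 = Q * J 1 * J 2 * J 5 / (J 3 * J 4 ^ 2)"
proof -
  have "(T - 1) * (J 1 * J 3 * J 4 ^ 2) = J 2 ^ 2 * J 3 * J 5 - J 1 * J 3 * J 4 ^ 2"
    using J_nz by (simp add: T_def left_diff_distrib power2_eq_square)
  also have "\<dots> = Q * J 1 ^ 2 * J 2 * J 5" using three_term_relations(2) by (simp add: algebra_simps)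
  finally have "J 1 * ((T - 1) * (J 3 * J 4 ^ 2)) = J 1 * (Q * J 1 * J 2 * J 5)"
    by (simp only: power2_eq_square mult_ac)
  then have "(T - 1) * (J 3 * J 4 ^ 2) = Q * J 1 * J 2 * J 5"
    by (subst (asm) mult_left_cancel) (rule J_nz)
  then show ?thesis by (subst eq_divide_eq) (simp add: J_nz)
qed

lemma m_s_nonzero: "1 + t \<noteq> 0" "T - 1 \<noteq> 0"
  unfolding one_plus_t T_minus_one using J_nz Q(1) by simp_all

text \<open>Relative to \<open>J 5\<close>, every \<open>J a\<close> is a monomial in
  \<open>y, t, T, 1 + t, T - 1\<close>, and so is \<open>Q\<close> itself. Products and quotients of
  theta functions thereby become sums and differences of exponent vectors.\<close>

lemma parametrization:
  shows "J 4 = y * J 5"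
    and "J 3 * (1 + t) = T * y ^ 3 * J 5"
    and "J 2 * (t * (1 + t)) = T * (T - 1) * y ^ 6 * J 5"
    and "J 1 * (t\<^sup>2 * (1 + t)\<^sup>2) = T * (T - 1)\<^sup>2 * y ^ 10 * J 5"
    and "Q * (T * (T - 1)\<^sup>2 * y ^ 11) = t ^ 3 * (1 + t)\<^sup>2"
proof -
  define s m where "s = T - 1" and "m = 1 + t"
  have 0: "J 4 = y * J 5" using J_nz by (simp add: y_def)
  have i: "t * J 5 = Q * J 1 * y" using J_nz by (simp add: t_def y_def power2_eq_square)
  have ii: "T * J 1 * y\<^sup>2 * J 5 = J 2 ^ 2"
    using J_nz by (simp add: T_def y_def power2_eq_square)
  have "m * J 1 * J 3 = J 2 ^ 2 * y" using J_nz by (simp add: m_def one_plus_t y_def)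
  then have "J 1 * (J 3 * m) = J 1 * (T * y ^ 3 * J 5)"
    unfolding ii[symmetric] by (simp add: algebra_simps power2_eq_square power3_eq_cube)
  then have iii: "J 3 * m = T * y ^ 3 * J 5" using J_nz by simp
  have "s * J 3 * y ^ 3 = t * J 2"
    using J_nz by (simp add: s_def T_minus_one t_def y_def power2_eq_square power3_eq_cube)
  then have "(t * J 2) * m = (s * J 3 * y ^ 3) * m" by (simp only:)
  then have "J 2 * (t * m) = s * y ^ 3 * (J 3 * m)" by (simp only: mult_ac)
  then have iv: "J 2 * (t * m) = T * s * y ^ 6 * J 5" unfolding iii by (simp add: mult_ac flip: power_add)
  have "(T * y\<^sup>2 * J 5) * (J 1 * (t\<^sup>2 * m\<^sup>2)) = (T * J 1 * y\<^sup>2 * J 5) * (t * m)\<^sup>2"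
    by (simp only: power_mult_distrib mult_ac)
  also have "\<dots> = (J 2 * (t * m))\<^sup>2"
    unfolding ii by (simp only: power_mult_distrib)
  also have "\<dots> = (T * y\<^sup>2 * J 5) * (T * s\<^sup>2 * y ^ 10 * J 5)"
    unfolding iv by (simp add: power_mult_distrib power2_eq_square power_numeral_reduce mult_ac)
  finally have "(T * y\<^sup>2 * J 5) * (J 1 * (t\<^sup>2 * m\<^sup>2)) = (T * y\<^sup>2 * J 5) * (T * s\<^sup>2 * y ^ 10 * J 5)" .
  then have v: "J 1 * (t\<^sup>2 * m\<^sup>2) = T * s\<^sup>2 * y ^ 10 * J 5"
    by (subst (asm) mult_left_cancel) (simp_all add: J_nz t_T_nonzero)
  have "J 5 * (Q * (T * s\<^sup>2 * y ^ 11)) = Q * y * (T * s\<^sup>2 * y ^ 10 * J 5)"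
    by (simp add: power_numeral_reduce mult_ac)
  also have "\<dots> = J 5 * (t ^ 3 * m\<^sup>2)"
    unfolding v[symmetric] using i by (simp add: power_numeral_reduce mult_ac)
  finally have vi: "Q * (T * s\<^sup>2 * y ^ 11) = t ^ 3 * m\<^sup>2" using J_nz by simp
  show "J 4 = y * J 5" "J 3 * (1 + t) = T * y ^ 3 * J 5"
    "J 2 * (t * (1 + t)) = T * (T - 1) * y ^ 6 * J 5"
    "J 1 * (t\<^sup>2 * (1 + t)\<^sup>2) = T * (T - 1)\<^sup>2 * y ^ 10 * J 5"
    "Q * (T * (T - 1)\<^sup>2 * y ^ 11) = t ^ 3 * (1 + t)\<^sup>2"
    using 0 iii iv v vi unfolding s_def m_def by blast+
qed

text \<open>Relative to \<open>A = J 1 * J 3 ^ 3\<close> the other two terms of the third three-term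
  relation are monomials in \<open>t, T, 1 + t, T - 1\<close>.\<close>

lemma curve: "t\<^sup>2 * T\<^sup>2 = 1 + t - T + t\<^sup>2 * T"
proof -
  define A where "A = J 1 * J 3 ^ 3"
  have A: "A \<noteq> 0" using J_nz by (simp add: A_def)
  have a: "J 2 ^ 3 * J 4 * (t * T) = (1 + t)\<^sup>2 * (T - 1) * A"
    unfolding A_def one_plus_t T_minus_one unfolding t_def T_def using J_nz
    by (simp add: divide_simps power2_eq_square power3_eq_cube)
  have b: "Q * J 1 ^ 3 * J 5 * (t * T\<^sup>2) = (1 + t) * (T - 1)\<^sup>2 * A"
    unfolding A_def one_plus_t T_minus_one unfolding t_def T_def using J_nz
    by (simp add: divide_simps power2_eq_square power3_eq_cube)
  have "(Q * J 1 ^ 3 * J 5 * (t * T\<^sup>2)) + A * (t * T\<^sup>2) = (J 2 ^ 3 * J 4 * (t * T)) * T"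
    using three_term_relations(3) unfolding A_def by (simp add: power2_eq_square flip: distrib_right)
  then have "A * ((1 + t) * (T - 1)\<^sup>2 + t * T\<^sup>2 - (1 + t)\<^sup>2 * (T - 1) * T) = 0"
    unfolding a b by (simp add: algebra_simps)
  then have "(1 + t) * (T - 1)\<^sup>2 + t * T\<^sup>2 - (1 + t)\<^sup>2 * (T - 1) * T = 0" using A by simp
  then show ?thesis by algebra
qed

section \<open>Linear relations between logarithmic derivatives\<close>

abbreviation le :: "nat \<Rightarrow> complex" where
  "le a \<equiv> theta_log_deriv P (Q ^ a)"

lemma le_reflect: "0 < a \<Longrightarrow> a < 11 \<Longrightarrow> le (11 - a) = - le a"
  using thetaD_reflect[OF P(2,1), of "Q ^ a"] theta_reflect[OF P(1), of "Q ^ a"] Q(1)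
  by (simp add: theta_log_deriv_def P_div)

lemma le_numeral: "le 6 = - le 5" "le 7 = - le 4" "le 8 = - le 3" "le 9 = - le 2"
  using le_reflect[of 5] le_reflect[of 4] le_reflect[of 3] le_reflect[of 2] by simp_all

text \<open>\<open>theta_log_deriv_relation\<close> at \<open>x = Q^5\<close>,
  \<open>y = Q^k\<close>, \<open>z = 1\<close>. With this \<open>x\<close> the indices
  \<open>5 + k\<close> and \<open>5 - k\<close> stay between 1 and 9, and
  \<open>theta P (x^2)\<close> is \<open>J 10 = J 1\<close>.\<close>

lemma le_relation:
  assumes k: "0 < k" "k < 5"
  shows "le (5 + k) + le (5 - k) - 2 * le 5 =
    - J 1 * \<eta> ^ 3 * J k ^ 2 * Q ^ (5 - k) / (J (5 + k) * J (5 - k) * J 5 ^ 2)"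
proof -
  have e: "Q ^ 5 * Q ^ k = Q ^ (5 + k)" "Q ^ 5 / Q ^ k = Q ^ (5 - k)" "Q ^ 5 * Q ^ 0 = Q ^ 5" "Q ^ 5 / Q ^ 0 = Q ^ 5"
    using k Q(1) by (simp_all add: power_add power_diff)
  have nz: "J (5 + k) \<noteq> 0" "J (5 - k) \<noteq> 0" "J 5 \<noteq> 0" using k by (simp_all add: J_nonzero)
  have b: "theta_bracket P (Q ^ 5) (Q ^ k) = J (5 + k) * J (5 - k) / Q ^ 5"
    "theta_bracket P (Q ^ 5) (Q ^ 0) = J 5 * J 5 / Q ^ 5" "theta_bracket P (Q ^ k) (Q ^ 0) = J k * J k / Q ^ k"
    using k bracket[of k 5] bracket[of 0 5] bracket[of 0 k] by simp_all
  have J10: "theta P ((Q ^ 5)\<^sup>2) = J 1"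
    using J_numeral(5) by (simp add: J_def flip: power_mult)
  have "theta_bracket P (Q ^ 5) (Q ^ k) * theta_bracket P (Q ^ 5) (Q ^ 0) *
      (theta_log_deriv P (Q ^ 5 * Q ^ k) + theta_log_deriv P (Q ^ 5 / Q ^ k)
        - theta_log_deriv P (Q ^ 5 * Q ^ 0) - theta_log_deriv P (Q ^ 5 / Q ^ 0)) =
      - theta P ((Q ^ 5)\<^sup>2) * qpoch_inf P P ^ 3 / Q ^ 5 * theta_bracket P (Q ^ k) (Q ^ 0)"
  proof (rule theta_log_deriv_relation[OF P])
    show "theta P (Q ^ 5 * Q ^ k) \<noteq> 0" "theta P (Q ^ 5 / Q ^ k) \<noteq> 0"
      "theta P (Q ^ 5 * Q ^ 0) \<noteq> 0" "theta P (Q ^ 5 / Q ^ 0) \<noteq> 0"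
      unfolding e J_def[symmetric] by (rule nz)+
  qed (use Q in simp_all)
  then have H: "(J (5 + k) * J (5 - k) / Q ^ 5) * (J 5 * J 5 / Q ^ 5) * (le (5 + k) + le (5 - k) - le 5 - le 5) =
      - J 1 * \<eta> ^ 3 / Q ^ 5 * (J k * J k / Q ^ k)"
    unfolding b J10 e \<eta>_def[symmetric] .
  have "(le (5 + k) + le (5 - k) - 2 * le 5) * (J (5 + k) * J (5 - k) * J 5 ^ 2) =
      Q ^ 5 * Q ^ 5 * ((J (5 + k) * J (5 - k) / Q ^ 5) * (J 5 * J 5 / Q ^ 5) * (le (5 + k) + le (5 - k) - le 5 - le 5))"
    using Q(1) by (simp add: power2_eq_square)
  also have "\<dots> = - J 1 * \<eta> ^ 3 * J k ^ 2 * (Q ^ 5 / Q ^ k)"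
  proof -
    have "c * c * (A / c * (B / d)) = A * B * (c / d)" if "c \<noteq> 0" for A B c d :: complex
      using that by simp
    from this[of "Q ^ 5"] show ?thesis unfolding H power2_eq_square[of "J k"] using Q(1) by simp
  qed
  finally have "(le (5 + k) + le (5 - k) - 2 * le 5) * (J (5 + k) * J (5 - k) * J 5 ^ 2) =
      - J 1 * \<eta> ^ 3 * J k ^ 2 * Q ^ (5 - k)" unfolding e .
  moreover have "J (5 + k) * J (5 - k) * J 5 ^ 2 \<noteq> 0" using nz by simp
  ultimately show ?thesis by (intro eq_divide_imp)
qed

text \<open>The four instances of \<open>le_relation\<close> leave one degree of freedom among five
  unknowns. Here \<open>x = Q\<close>, \<open>y = Q^5\<close>, \<open>z = 1\<close>, so
  \<open>x / y = Q^(-4)\<close> leaves the range of indices; inversion contributes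
  \<open>1 - le 4\<close>, hence the constant that fixes all values.\<close>

lemma le_wrap_relation:
  "1 - le 5 - le 4 - 2 * le 1 = J 2 * \<eta> ^ 3 * J 5 / (J 4 * J 1 ^ 2)"
proof -
  have Q4: "Q * Q ^ 5 = Q ^ 6" "Q / Q ^ 5 = 1 / Q ^ 4" "(Q ^ 1)\<^sup>2 = Q ^ 2"
    using Q(1) by (simp_all add: power_numeral_reduce)
  have th: "theta P (1 / Q ^ 4) = - J 4 / Q ^ 4"
    unfolding J_def by (rule theta_inverse[OF P]) (use Q in simp)
  have D: "thetaD P (1 / Q ^ 4) = (thetaD P (Q ^ 4) - J 4) / Q ^ 4"
    unfolding J_def by (rule thetaD_inverse[OF P(2,1)]) (use Q in simp)
  have le4: "theta_log_deriv P (1 / Q ^ 4) = 1 - le 4"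
    unfolding theta_log_deriv_def th D using J_nz Q(1)
    by (simp add: field_simps flip: J_def)
  have e: "Q ^ 1 * Q ^ 5 = Q ^ 6" "Q ^ 1 / Q ^ 5 = 1 / Q ^ 4" "Q ^ 1 * Q ^ 0 = Q ^ 1" "Q ^ 1 / Q ^ 0 = Q ^ 1"
    using Q4 by simp_all
  have b: "theta_bracket P (Q ^ 1) (Q ^ 5) = J 5 * (- J 4 / Q ^ 4) / Q"
    "theta_bracket P (Q ^ 1) (Q ^ 0) = J 1 * J 1 / Q" "theta_bracket P (Q ^ 5) (Q ^ 0) = J 5 * J 5 / Q ^ 5"
    using bracket[of 0 1] bracket[of 0 5] J_numeral(1)
    by (simp_all add: theta_bracket_def Q4 th flip: J_def)
  have J2: "theta P ((Q ^ 1)\<^sup>2) = J 2" by (simp add: J_def)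
  have "theta_bracket P (Q ^ 1) (Q ^ 5) * theta_bracket P (Q ^ 1) (Q ^ 0) *
      (theta_log_deriv P (Q ^ 1 * Q ^ 5) + theta_log_deriv P (Q ^ 1 / Q ^ 5)
        - theta_log_deriv P (Q ^ 1 * Q ^ 0) - theta_log_deriv P (Q ^ 1 / Q ^ 0)) =
      - theta P ((Q ^ 1)\<^sup>2) * qpoch_inf P P ^ 3 / Q ^ 1 * theta_bracket P (Q ^ 5) (Q ^ 0)"
  proof (rule theta_log_deriv_relation[OF P])
    show "theta P (Q ^ 1 * Q ^ 5) \<noteq> 0" "theta P (Q ^ 1 * Q ^ 0) \<noteq> 0" "theta P (Q ^ 1 / Q ^ 0) \<noteq> 0"
      unfolding e J_def[symmetric] by (simp_all add: J_nonzero)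
    show "theta P (Q ^ 1 / Q ^ 5) \<noteq> 0" unfolding e th using J_nz Q(1) by simp
  qed (use Q in simp_all)
  then have H: "(J 5 * (- J 4 / Q ^ 4) / Q) * (J 1 * J 1 / Q) * (- le 5 + (1 - le 4) - le 1 - le 1) =
      - J 2 * \<eta> ^ 3 / Q ^ 1 * (J 5 * J 5 / Q ^ 5)"
    unfolding e b J2 le4 le_numeral \<eta>_def[symmetric] .
  have "J 5 * ((1 - le 5 - le 4 - 2 * le 1) * (J 4 * J 1 ^ 2)) =
      - (Q ^ 6 * ((J 5 * (- J 4 / Q ^ 4) / Q) * (J 1 * J 1 / Q) * (- le 5 + (1 - le 4) - le 1 - le 1)))"
  proof -
    have "J5 * (X * (J4 * J1 ^ 2)) = - (Q ^ 6 * ((J5 * (- J4 / Q ^ 4) / Q) * (J1 * J1 / Q) * X))" for J5 J4 J1 X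
      using Q(1) by (simp add: divide_simps power2_eq_square power_numeral_reduce)
    moreover have "1 - le 5 - le 4 - 2 * le 1 = - le 5 + (1 - le 4) - le 1 - le 1" by simp
    ultimately show ?thesis by (simp only:)
  qed
  also have "\<dots> = J 5 * (J 2 * \<eta> ^ 3 * J 5)"
    unfolding H using Q(1) by (simp add: divide_simps power_numeral_reduce)
  finally have "(1 - le 5 - le 4 - 2 * le 1) * (J 4 * J 1 ^ 2) = J 2 * \<eta> ^ 3 * J 5"
    by (subst (asm) mult_left_cancel) (rule J_nz)
  moreover have "J 4 * J 1 ^ 2 \<noteq> 0" using J_nz by simp
  ultimately show ?thesis by (intro eq_divide_imp)
qed

end

section \<open>Dissections of theta, its derivative and the Euler product\<close>

locale root_eleven = theta_eleven "q ^ 11" for q :: complex +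
  fixes \<zeta> :: complex
  assumes q: "q \<noteq> 0" "norm q < 1" and \<zeta>: "\<zeta> ^ 11 = 1" "\<zeta> \<noteq> 1"
begin

lemma \<zeta>_nonzero: "\<zeta> \<noteq> 0" using \<zeta>(1) by auto

lemma norm_\<zeta>: "norm \<zeta> = 1"
proof -
  have "norm \<zeta> ^ 11 = 1 ^ 11" using \<zeta>(1) by (metis norm_one norm_power power_one)
  then show ?thesis by (rule power_eq_imp_eq_base) simp_all
qed

lemma \<zeta>_sum: "(\<Sum>k<11. \<zeta> ^ k) = 0"
proof -
  have "(1 - \<zeta>) * (\<Sum>k<11. \<zeta> ^ k) = 1 - \<zeta> ^ 11" by (rule one_diff_power_eq[symmetric])
  then show ?thesis using \<zeta> by simp
qed

lemma theta_\<zeta>_nonzero: "theta q \<zeta> \<noteq> 0"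
proof -
  have "qpoch_inf \<zeta> q \<noteq> 0"
  proof
    assume "qpoch_inf \<zeta> q = 0"
    then obtain k where k: "\<zeta> * q ^ k = 1" using qpoch_inf_0_iff[OF q(2)] by blast
    then have "norm q ^ k = 1" using norm_\<zeta> by (metis mult_1 norm_mult norm_one norm_power)
    then have "k = 0" using q(2) power_less_one_iff[of "norm q" k] by (cases "k = 0") auto
    with k show False using \<zeta>(2) by simp
  qed
  moreover have "norm (q / \<zeta>) < 1" using q(2) norm_\<zeta> by (simp add: norm_divide)
  ultimately show ?thesis using qpoch_inf_nonzero[OF q(2)] q(2) by (simp add: theta_def)
qed

lemma P_eq: "q ^ 121 = P" by (simp add: P_def flip: power_mult)

text \<open>Starting at \<open>- 5\<close> makes \<open>11 * s + 55\<close> equal to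
  \<open>11 * a\<close> with \<open>a = s + 5\<close> between 0 and 10, so at
  \<open>z ^ 11 = 1\<close> the inner functions are exactly the \<open>J a\<close>.\<close>

lemma theta_dissection_11:
  assumes "z \<noteq> 0"
  shows "theta q z = (\<Sum>a<11. q powi itri (int a - 5) * (- z) powi (int a - 5) * theta P (z ^ 11 * (q ^ 11) ^ a))"
proof -
  have "theta q z = (\<Sum>s\<in>{- 5..- 5 + 10}. q powi itri s * (- z) powi s * theta (q ^ 121) (z ^ 11 * q powi (11 * s + 55)))"
    by (rule theta_dissection[OF q assms])
  also have "\<dots> = (\<Sum>a<11. q powi itri (int a - 5) * (- z) powi (int a - 5) * theta P (z ^ 11 * (q ^ 11) ^ a))"
  proof (rule sum.reindex_bij_witness[of _ "\<lambda>a. int a - 5" "\<lambda>s. nat (s + 5)"])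
    fix s :: int assume s: "s \<in> {- 5..- 5 + 10}"
    then have "11 * s + 55 = int (11 * nat (s + 5))" by simp
    then have "q powi (11 * s + 55) = (q ^ 11) ^ nat (s + 5)"
      by (simp only: power_int_of_nat power_mult)
    then show "q powi itri (int (nat (s + 5)) - 5) * (- z) powi (int (nat (s + 5)) - 5) *
        theta P (z ^ 11 * (q ^ 11) ^ nat (s + 5)) =
      q powi itri s * (- z) powi s * theta (q ^ 121) (z ^ 11 * q powi (11 * s + 55))"
      using s by (simp add: P_eq)
  qed auto
  finally show ?thesis .
qed

lemma theta_\<zeta>: "theta q \<zeta> = (\<Sum>a<11. q powi itri (int a - 5) * (- \<zeta>) powi (int a - 5) * J a)"
  using theta_dissection_11[OF \<zeta>_nonzero] by (simp add: \<zeta>(1) J_def)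

text \<open>The dissection has to be differentiated as a function of \<open>z\<close> before
  \<open>z ^ 11 = 1\<close> is imposed; the inner argument \<open>z ^ 11\<close> contributes the
  factor 11.\<close>

lemma thetaD_\<zeta>:
  "thetaD q \<zeta> = (\<Sum>a<11. q powi itri (int a - 5) * (- \<zeta>) powi (int a - 5) *
     (of_int (int a - 5) * J a + 11 * thetaD P ((q ^ 11) ^ a)))"
proof -
  have deriv_term: "((\<lambda>z. c * (- z) powi s * theta P (z ^ 11 * (q ^ 11) ^ a)) has_field_derivative
      (c * (- \<zeta>) powi s * (of_int s * J a + 11 * thetaD P ((q ^ 11) ^ a))) / \<zeta>) (at \<zeta>)" for c s a
  proof -
    have neg: "(- z) powi s = (-1) powi s * z powi s" for z :: complex
      using power_int_mult_distrib[of "-1" z s] by simp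
    have neg_fun: "(\<lambda>z. c * (- z) powi s) = (\<lambda>z. c * ((-1) powi s * z powi s))"
      by (rule ext, subst neg, rule refl)
    have "((\<lambda>z. z powi s) has_field_derivative of_int s * \<zeta> powi (s - 1) * 1) (at \<zeta>)"
      by (rule DERIV_power_int[OF DERIV_ident]) (simp add: \<zeta>_nonzero)
    then have 1: "((\<lambda>z. c * (- z) powi s) has_field_derivative
        c * ((-1) powi s * (of_int s * \<zeta> powi (s - 1) * 1))) (at \<zeta>)"
      unfolding neg_fun by (intro DERIV_cmult)
    have 2: "((\<lambda>z. theta P (z ^ 11 * (q ^ 11) ^ a)) has_field_derivative
        thetaD P (\<zeta> ^ 11 * (q ^ 11) ^ a) / (\<zeta> ^ 11 * (q ^ 11) ^ a) * (11 * \<zeta> ^ 10 * (q ^ 11) ^ a)) (at \<zeta>)"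
      by (rule theta_chain[OF P(2)]) (use q \<zeta>_nonzero in \<open>auto intro!: derivative_eq_intros\<close>)
    have s1: "\<zeta> powi (s - 1) = \<zeta> powi s / \<zeta>" using \<zeta>_nonzero by (simp add: power_int_diff)
    have z10: "\<zeta> ^ 10 = 1 / \<zeta>" using \<zeta>(1) \<zeta>_nonzero by (simp add: field_simps power_numeral_reduce)
    have qa: "(q ^ 11) ^ a \<noteq> 0" using q by simp
    have "c * ((-1) powi s * (of_int s * \<zeta> powi (s - 1) * 1)) * theta P (\<zeta> ^ 11 * (q ^ 11) ^ a) +
        thetaD P (\<zeta> ^ 11 * (q ^ 11) ^ a) / (\<zeta> ^ 11 * (q ^ 11) ^ a) * (11 * \<zeta> ^ 10 * (q ^ 11) ^ a) * (c * (- \<zeta>) powi s) =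
       (c * (- \<zeta>) powi s * (of_int s * J a + 11 * thetaD P ((q ^ 11) ^ a))) / \<zeta>"
    proof -
      have "c * (m * (i * (Z / w) * 1)) * X + D / x * (11 * (1 / w) * x) * (c * (m * Z)) =
          (c * (m * Z) * (i * X + 11 * D)) / w" if "x \<noteq> 0" for m i Z w X D x :: complex
        using that by (cases "w = 0") (simp_all add: field_simps)
      from this[OF qa] show ?thesis unfolding s1 z10 neg[of \<zeta>] \<zeta>(1) mult_1 J_def .
    qed
    with DERIV_mult[OF 1 2] show ?thesis by (simp only:)
  qed
  have "((\<lambda>z. \<Sum>a<11. q powi itri (int a - 5) * (- z) powi (int a - 5) * theta P (z ^ 11 * (q ^ 11) ^ a))
      has_field_derivative (\<Sum>a<11. (q powi itri (int a - 5) * (- \<zeta>) powi (int a - 5) *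
        (of_int (int a - 5) * J a + 11 * thetaD P ((q ^ 11) ^ a))) / \<zeta>)) (at \<zeta>)"
    by (rule DERIV_sum) (rule deriv_term)
  then have "(theta q has_field_derivative (\<Sum>a<11. (q powi itri (int a - 5) * (- \<zeta>) powi (int a - 5) *
        (of_int (int a - 5) * J a + 11 * thetaD P ((q ^ 11) ^ a))) / \<zeta>)) (at \<zeta>)"
  proof (rule has_field_derivative_transform_within_open)
    show "open (- {0 :: complex})" by (intro open_Compl closed_singleton)
    show "\<zeta> \<in> - {0}" using \<zeta>_nonzero by simp
  qed (simp add: theta_dissection_11)
  from thetaD_eqI[OF this] show ?thesis
    using \<zeta>_nonzero by (simp add: sum_divide_distrib[symmetric])
qed

lemma thetaD_J:
  "0 < a \<Longrightarrow> a < 11 \<Longrightarrow> thetaD P ((q ^ 11) ^ a) = J a * le a"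
  using J_nonzero[of a] by (simp add: theta_log_deriv_def J_def)

text \<open>The Euler product is \<open>theta (q ^ 3) q\<close>, dissected with residues from -3 to
  7. The exponents \<open>3 * itri s + s\<close> at \<open>s = 2 + a\<close> and
  \<open>s = 2 - a\<close> differ by \<open>11 * a\<close>, so the quintuple product joins these two
  classes to \<open>\<eta> * J (2 * a) / J a\<close>; the central class \<open>s = 2\<close> gives
  \<open>q ^ 5 * \<eta>\<close>.\<close>

lemma qpoch_dissection:
  "qpoch_inf q q = \<eta> * (J 4 / J 2 - q * (J 2 / J 1) - q ^ 2 * (J 5 / J 3) + q ^ 5
     + q ^ 7 * (J 3 / J 4) - q ^ 15 * (J 1 / J 5))"
proof -
  have q3: "q ^ 3 \<noteq> 0" "norm (q ^ 3) < 1" using q by (auto simp: norm_power power_less_one_iff)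
  have P3: "(q ^ 3) ^ 121 = P ^ 3" by (simp add: P_def flip: power_mult)
  let ?X = "\<lambda>s :: int. (q ^ 3) powi itri s * (- q) powi s * theta (P ^ 3) (q ^ 11 * (q ^ 3) powi (11 * s + 55))"
  have arg: "q ^ 11 * (q ^ 3) powi (11 * s + 55) = (q ^ 11) powi (16 + 3 * s)" for s
  proof -
    have "q ^ 11 * (q ^ 3) powi (11 * s + 55) = q powi (11 + 3 * (11 * s + 55))"
      using q by (simp add: power_int_add power_int_mult)
    also have "\<dots> = q powi (11 * (16 + 3 * s))" by (simp add: algebra_simps)
    also have "\<dots> = (q ^ 11) powi (16 + 3 * s)" by (simp only: power_int_mult power_int_numeral)
    finally show ?thesis .
  qed
  have pair: "theta (P ^ 3) ((q ^ 11) powi (22 - 3 * int a)) + (q ^ 11) ^ a * theta (P ^ 3) ((q ^ 11) powi (22 + 3 * int a)) =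
      \<eta> * J (2 * a) / J a" if "0 < a" "a \<le> 5" for a
  proof -
    have x: "(q ^ 11) ^ a \<noteq> 0" using q by simp
    have "(q ^ 11) powi (22 - 3 * int a) = P\<^sup>2 / ((q ^ 11) ^ a) ^ 3"
      "(q ^ 11) powi (22 + 3 * int a) = P\<^sup>2 * ((q ^ 11) ^ a) ^ 3"
    proof -
      have "P\<^sup>2 = (q ^ 11) powi 22" by (simp add: P_def flip: power_mult)
      moreover have "((q ^ 11) ^ a) ^ 3 = (q ^ 11) powi (3 * int a)"
        using power_int_of_nat[of "q ^ 11" "3 * a"] by (simp add: mult.commute flip: power_mult)
      ultimately show "(q ^ 11) powi (22 - 3 * int a) = P\<^sup>2 / ((q ^ 11) ^ a) ^ 3"
        "(q ^ 11) powi (22 + 3 * int a) = P\<^sup>2 * ((q ^ 11) ^ a) ^ 3"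
        using q power_int_diff[of "q ^ 11" 22 "3 * int a"] power_int_add[of "q ^ 11" 22 "3 * int a"] by simp_all
    qed
    note pw = this
    have "J a * (theta (P ^ 3) (P\<^sup>2 / ((q ^ 11) ^ a) ^ 3) + (q ^ 11) ^ a * theta (P ^ 3) (P\<^sup>2 * ((q ^ 11) ^ a) ^ 3)) =
        \<eta> * J (2 * a)"
    proof -
      have "((q ^ 11) ^ a)\<^sup>2 = (q ^ 11) ^ (2 * a)" by (rule power_even_eq[symmetric])
      then show ?thesis using quintuple_product[OF P x] unfolding J_def \<eta>_def by simp
    qed
    then show ?thesis unfolding pw using J_nonzero[of a] that by (simp add: eq_divide_eq mult.commute)
  qed
  have mid: "theta (P ^ 3) ((q ^ 11) powi 22) = \<eta>"
  proof -
    have "(q ^ 11) powi 22 = P\<^sup>2" by (simp add: P_def flip: power_mult)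
    then show ?thesis using theta_cube_base(2)[OF P] by (simp add: \<eta>_def)
  qed
  have co: "(q ^ 3) powi itri s * (- q) powi s = (-1) powi s * q powi (3 * itri s + s)" for s
    using q power_int_mult_distrib[of "-1" q s] by (simp add: power_int_add power_int_mult)
  have "qpoch_inf q q = theta (q ^ 3) q" using theta_cube_base(1)[OF q] by simp
  also have "\<dots> = (\<Sum>s\<in>{- 3..- 3 + 10}. ?X s)"
    unfolding P3[symmetric] by (rule theta_dissection[OF q3 q(1)])
  also have "\<dots> = ?X 2 + (\<Sum>a\<in>{1..5}. ?X (2 - int a) + ?X (2 + int a))"
  proof -
    have "{- 3..- 3 + 10 :: int} = {-3, -2, -1, 0, 1, 2, 3, 4, 5, 6, 7}" by (auto, presburger)
    moreover have "{1..5 :: nat} = {1, 2, 3, 4, 5}" by auto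
    ultimately show ?thesis by (simp add: algebra_simps)
  qed
  also have "(\<Sum>a\<in>{1..5}. ?X (2 - int a) + ?X (2 + int a)) =
      (\<Sum>a\<in>{1..5}. (-1) ^ a * q powi (3 * itri (2 - int a) + (2 - int a)) * (\<eta> * J (2 * a) / J a))"
  proof (rule sum.cong[OF refl])
    fix a :: nat assume a: "a \<in> {1..5}"
    have "3 * itri (2 + int a) + (2 + int a) = 3 * itri (2 - int a) + (2 - int a) + 11 * int a"
      using two_itri[of "2 + int a"] two_itri[of "2 - int a"] by (simp add: algebra_simps)
    then have "q powi (3 * itri (2 + int a) + (2 + int a)) =
        q powi (3 * itri (2 - int a) + (2 - int a)) * q powi (11 * int a)"
      using q by (simp only: power_int_add simp_thms)
    also have "q powi (11 * int a) = (q ^ 11) ^ a" by (simp add: power_int_mult)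
    finally have e: "q powi (3 * itri (2 + int a) + (2 + int a)) =
        q powi (3 * itri (2 - int a) + (2 - int a)) * (q ^ 11) ^ a" .
    have sg: "(-1 :: complex) powi (2 - int a) = (-1) ^ a" "(-1 :: complex) powi (2 + int a) = (-1) ^ a"
      by (cases "even a"; simp add: power_int_add power_int_diff)+
    have e2: "16 + 3 * (2 - int a) = 22 - 3 * int a" "16 + 3 * (2 + int a) = 22 + 3 * int a" by simp_all
    have "?X (2 - int a) + ?X (2 + int a) = (-1) ^ a * q powi (3 * itri (2 - int a) + (2 - int a)) *
        (theta (P ^ 3) ((q ^ 11) powi (22 - 3 * int a)) + (q ^ 11) ^ a * theta (P ^ 3) ((q ^ 11) powi (22 + 3 * int a)))"
      unfolding co arg e sg e2 by (simp only: distrib_left mult_ac)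
    also have "\<dots> = (-1) ^ a * q powi (3 * itri (2 - int a) + (2 - int a)) * (\<eta> * J (2 * a) / J a)"
      using pair[of a] a by simp
    finally show "?X (2 - int a) + ?X (2 + int a) =
        (-1) ^ a * q powi (3 * itri (2 - int a) + (2 - int a)) * (\<eta> * J (2 * a) / J a)" .
  qed
  also have "?X 2 = q ^ 5 * \<eta>"
    unfolding co arg using mid by (simp add: itri_def)
  also have "(\<Sum>a\<in>{1..5}. (-1) ^ a * q powi (3 * itri (2 - int a) + (2 - int a)) * (\<eta> * J (2 * a) / J a)) =
      \<eta> * (J 4 / J 2 - q * (J 2 / J 1) - q ^ 2 * (J 5 / J 3) + q ^ 7 * (J 3 / J 4) - q ^ 15 * (J 1 / J 5))"
  proof -
    have "{1..5 :: nat} = {1, 2, 3, 4, 5}" by auto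
    then show ?thesis by (simp add: itri_def J_numeral J_Suc algebra_simps)
  qed
  finally show ?thesis by (simp add: algebra_simps)
qed

end

section \<open>Monomial calculus for the theta functions\<close>

lemma monom_val_uminus: "length v = length bs \<Longrightarrow> monom_val bs (map uminus v) = inverse (monom_val bs v)"
proof (induction bs arbitrary: v)
  case (Cons b bs)
  then obtain x v' where "v = x # v'" by (metis length_Suc_conv)
  with Cons show ?case by (simp add: power_int_minus)
qed simp

lemma monom_val_smult: "length v = length bs \<Longrightarrow> monom_val bs (map ((*) (int n)) v) = monom_val bs v ^ n"
proof (induction bs arbitrary: v)
  case (Cons b bs)
  then obtain x v' where "v = x # v'" by (metis length_Suc_conv)
  moreover have "b powi (int n * x) = (b powi x) ^ n"
    using power_int_mult[of b x "int n"] by (simp add: mult.commute)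
  ultimately show ?case using Cons by (simp add: power_mult_distrib)
qed simp

context theta_eleven
begin

definition mono :: "int list \<Rightarrow> complex" where
  "mono = monom_val [\<eta>, J 5, y, t, T, 1 + t, T - 1]"

lemma mono_eq: "mono [a, b, c, d, e, f, g] =
    \<eta> powi a * (J 5 powi b * (y powi c * (t powi d * (T powi e * ((1 + t) powi f * (T - 1) powi g)))))"
  by (simp add: mono_def)

lemma mono_vadd: "length u = 7 \<Longrightarrow> length v = 7 \<Longrightarrow> mono (vadd u v) = mono u * mono v"
  unfolding mono_def using \<eta>_nonzero J_nz t_T_nonzero m_s_nonzero by (intro monom_val_vadd) auto

lemma mono_mult: "length u = 7 \<Longrightarrow> length v = 7 \<Longrightarrow> mono u * mono v = mono (vadd u v)"
  by (rule mono_vadd[symmetric])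

lemma mono_power: "length u = 7 \<Longrightarrow> mono u ^ n = mono (map ((*) (int n)) u)"
  unfolding mono_def by (rule monom_val_smult[symmetric]) simp

lemma mono_divide: "length u = 7 \<Longrightarrow> length v = 7 \<Longrightarrow> mono u / mono v = mono (vadd u (map uminus v))"
  by (simp add: mono_vadd divide_inverse) (simp add: mono_def monom_val_uminus del: monom_val.simps)

lemma mono_Qvec: "mono Qvec = Q"
proof -
  have "X = inverse (Y ^ 11) * (t' ^ 3 * (inverse T' * (m\<^sup>2 * inverse (s\<^sup>2))))"
    if "X * (T' * s\<^sup>2 * Y ^ 11) = t' ^ 3 * m\<^sup>2" "Y \<noteq> 0" "T' \<noteq> 0" "s \<noteq> 0" for X Y T' s t' m :: complex
    using that by (simp add: field_simps)
  from this[OF parametrization(5)] show ?thesis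
    using t_T_nonzero m_s_nonzero by (simp add: Qvec_def mono_eq power_int_minus)
qed

text \<open>A rewrite rule \<open>Q = mono Qvec\<close> would loop, because \<open>mono\<close> depends on \<open>Q\<close>.\<close>

lemma mono_mult_Q:
  assumes "length u = 7"
  shows "mono u * Q = mono (vadd u Qvec)" "mono u * Q ^ n = mono (vadd u (map ((*) (int n)) Qvec))"
    "Q * mono u = mono (vadd Qvec u)"
proof -
  have l: "length Qvec = 7" by (simp add: Qvec_def)
  show "mono u * Q = mono (vadd u Qvec)" "Q * mono u = mono (vadd Qvec u)"
    using assms l by (simp_all only: mono_vadd mono_Qvec)
  have "Q ^ n = mono (map ((*) (int n)) Qvec)" using mono_power[OF l, of n] unfolding mono_Qvec .
  then show "mono u * Q ^ n = mono (vadd u (map ((*) (int n)) Qvec))"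
    using assms l by (simp only: mono_vadd length_map)
qed

lemma mono_J:
  "J (Suc 0) = mono [0, 1, 10, - 2, 1, - 2, 2]"
  "J 1 = mono [0, 1, 10, - 2, 1, - 2, 2]" "J 2 = mono [0, 1, 6, - 1, 1, - 1, 1]"
  "J 3 = mono [0, 1, 3, 0, 1, - 1, 0]" "J 4 = mono [0, 1, 1, 0, 0, 0, 0]"
  "J 5 = mono [0, 1, 0, 0, 0, 0, 0]" "\<eta> = mono [1, 0, 0, 0, 0, 0, 0]"
proof -
  note nz = t_T_nonzero m_s_nonzero
  show "J 4 = mono [0, 1, 1, 0, 0, 0, 0]" "J 5 = mono [0, 1, 0, 0, 0, 0, 0]" "\<eta> = mono [1, 0, 0, 0, 0, 0, 0]"
    using parametrization(1) by (simp_all add: mono_eq)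
  have "X = j * (Y * (T' * inverse m))" if "X * m = T' * Y * j" "m \<noteq> 0" for X Y T' m j :: complex
    using that by (simp add: field_simps)
  from this[OF parametrization(2)] show "J 3 = mono [0, 1, 3, 0, 1, - 1, 0]"
    using nz by (simp add: mono_eq power_int_minus)
  have "X = j * (Y * (inverse t' * (T' * (inverse m * s))))"
    if "X * (t' * m) = T' * s * Y * j" "m \<noteq> 0" "t' \<noteq> 0" for X Y T' m j s t' :: complex
    using that by (simp add: field_simps)
  from this[OF parametrization(3)] show "J 2 = mono [0, 1, 6, - 1, 1, - 1, 1]"
    using nz by (simp add: mono_eq power_int_minus)
  have "X = j * (Y * (inverse (t'\<^sup>2) * (T' * (inverse (m\<^sup>2) * s\<^sup>2))))"
    if "X * (t'\<^sup>2 * m\<^sup>2) = T' * s\<^sup>2 * Y * j" "m \<noteq> 0" "t' \<noteq> 0" for X Y T' m j s t' :: complex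
    using that by (simp add: field_simps)
  from this[OF parametrization(4)] show J1: "J 1 = mono [0, 1, 10, - 2, 1, - 2, 2]"
    using nz by (simp add: mono_eq power_int_minus)
  then show "J (Suc 0) = mono [0, 1, 10, - 2, 1, - 2, 2]" by simp
qed

lemmas mono_arith = mono_mult mono_power mono_divide length_vadd

text \<open>The common monomial of all logarithmic derivative relations: divided by it, their
  right-hand sides become polynomials in \<open>t\<close> and \<open>T\<close>.\<close>

abbreviation w :: complex where "w \<equiv> mono [3, - 1, - 15, 2, - 3, 3, - 2]"

text \<open>Divided by \<open>w\<close>, each theta quotient is a monomial in
  \<open>t, T, 1 + t, T - 1\<close> with negative exponents only at the last two. The curve removes
  these: \<open>t^2 * T^2 / (1 + t) = 1 - T + t * T\<close> and
  \<open>t / (T - 1) = 1 + t^2 * T\<close>.\<close>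

lemma log_deriv_system:
  shows "le 4 - 3 * le 5 = - (w * (t\<^sup>2 * (1 - T + t * T)))"
    and "le 3 - le 4 - 2 * le 5 = - (w * (t ^ 3 * T\<^sup>2))"
    and "le 2 - le 3 - 2 * le 5 = - (w * ((1 - T + t * T) * (1 + t\<^sup>2 * T)))"
    and "le 1 - le 2 - 2 * le 5 = - (w * (t * T * (1 + t\<^sup>2 * T)))"
    and "1 - le 5 - le 4 - 2 * le 1 = w * (T\<^sup>2 * (1 + t\<^sup>2 * T))"
proof -
  define m s where "m = 1 + t" and "s = T - 1"
  have nz: "t \<noteq> 0" "T \<noteq> 0" "m \<noteq> 0" "s \<noteq> 0" using t_T_nonzero m_s_nonzero by (simp_all add: m_def s_def)
  have "m * (1 - T + t * T) = t\<^sup>2 * T\<^sup>2" unfolding m_def curve by (simp add: algebra_simps power2_eq_square)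
  then have u: "t\<^sup>2 * T\<^sup>2 / m = 1 - T + t * T" using nz by (simp add: field_simps)
  have "s * (1 + t\<^sup>2 * T) = t\<^sup>2 * T\<^sup>2 - t\<^sup>2 * T + T - 1"
    by (simp add: s_def algebra_simps power2_eq_square)
  then have "s * (1 + t\<^sup>2 * T) = t" unfolding curve by simp
  then have v: "t / s = 1 + t\<^sup>2 * T" using nz by (simp add: field_simps)
  have ratio: "mono (vadd [3, - 1, - 15, 2, - 3, 3, - 2] [0, 0, 0, a, b, c, d]) =
      w * (t powi a * (T powi b * (m powi c * s powi d)))" for a b c d
    by (subst mono_vadd) (simp_all add: mono_eq m_def s_def)
  have e: "J 1 * \<eta> ^ 3 * J 1 ^ 2 * Q ^ 4 / (J 5 * J 4 * J 5 ^ 2) = mono [3, - 1, - 15, 6, - 1, 2, - 2]"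
    unfolding mono_J by (simp add: mono_arith mono_mult_Q Qvec_def)
  have r: "mono [3, - 1, - 15, 6, - 1, 2, - 2] = w * (t\<^sup>2 * (t\<^sup>2 * T\<^sup>2 / m))"
  proof -
    define W where "W = w"
    have "mono [3, - 1, - 15, 6, - 1, 2, - 2] = W * (t powi 4 * (T powi 2 * (m powi (- 1) * s powi 0)))"
      using ratio[of 4 2 "- 1" 0] unfolding W_def by simp
    also have "\<dots> = W * (t\<^sup>2 * (t\<^sup>2 * T\<^sup>2 / m))"
      using nz by (simp add: power_int_minus field_simps power_numeral_reduce)
    finally show ?thesis unfolding W_def .
  qed
  have "le (5 + 1) + le (5 - 1) - 2 * le 5 = - (J 1 * \<eta> ^ 3 * J 1 ^ 2 * Q ^ (5 - 1) / (J (5 + 1) * J (5 - 1) * J 5 ^ 2))"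
    using le_relation[of 1] by simp
  also have "J 1 * \<eta> ^ 3 * J 1 ^ 2 * Q ^ (5 - 1) / (J (5 + 1) * J (5 - 1) * J 5 ^ 2) = J 1 * \<eta> ^ 3 * J 1 ^ 2 * Q ^ 4 / (J 5 * J 4 * J 5 ^ 2)"
    by (simp add: J_numeral)
  finally have h: "le (5 + 1) + le (5 - 1) - 2 * le 5 = - (w * (t\<^sup>2 * (t\<^sup>2 * T\<^sup>2 / m)))" unfolding e r .
  show "le 4 - 3 * le 5 = - (w * (t\<^sup>2 * (1 - T + t * T)))"
    using h unfolding u by (simp add: le_numeral)
  have e: "J 1 * \<eta> ^ 3 * J 2 ^ 2 * Q ^ 3 / (J 4 * J 3 * J 5 ^ 2) = mono [3, - 1, - 15, 5, - 1, 3, - 2]"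
    unfolding mono_J by (simp add: mono_arith mono_mult_Q Qvec_def)
  have r: "mono [3, - 1, - 15, 5, - 1, 3, - 2] = w * (t ^ 3 * T\<^sup>2)"
  proof -
    define W where "W = w"
    have "mono [3, - 1, - 15, 5, - 1, 3, - 2] = W * (t powi 3 * (T powi 2 * (m powi 0 * s powi 0)))"
      using ratio[of 3 2 0 0] unfolding W_def by simp
    also have "\<dots> = W * (t ^ 3 * T\<^sup>2)"
      using nz by (simp add: power_int_minus field_simps power_numeral_reduce)
    finally show ?thesis unfolding W_def .
  qed
  have "le (5 + 2) + le (5 - 2) - 2 * le 5 = - (J 1 * \<eta> ^ 3 * J 2 ^ 2 * Q ^ (5 - 2) / (J (5 + 2) * J (5 - 2) * J 5 ^ 2))"
    using le_relation[of 2] by simp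
  also have "J 1 * \<eta> ^ 3 * J 2 ^ 2 * Q ^ (5 - 2) / (J (5 + 2) * J (5 - 2) * J 5 ^ 2) = J 1 * \<eta> ^ 3 * J 2 ^ 2 * Q ^ 3 / (J 4 * J 3 * J 5 ^ 2)"
    by (simp add: J_numeral)
  finally have h: "le (5 + 2) + le (5 - 2) - 2 * le 5 = - (w * (t ^ 3 * T\<^sup>2))" unfolding e r .
  show "le 3 - le 4 - 2 * le 5 = - (w * (t ^ 3 * T\<^sup>2))"
    using h  by (simp add: le_numeral)
  have e: "J 1 * \<eta> ^ 3 * J 3 ^ 2 * Q ^ 2 / (J 3 * J 2 * J 5 ^ 2) = mono [3, - 1, - 15, 5, - 1, 2, - 3]"
    unfolding mono_J by (simp add: mono_arith mono_mult_Q Qvec_def)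
  have r: "mono [3, - 1, - 15, 5, - 1, 2, - 3] = w * ((t\<^sup>2 * T\<^sup>2 / m) * (t / s))"
  proof -
    define W where "W = w"
    have "mono [3, - 1, - 15, 5, - 1, 2, - 3] = W * (t powi 3 * (T powi 2 * (m powi (- 1) * s powi (- 1))))"
      using ratio[of 3 2 "- 1" "- 1"] unfolding W_def by simp
    also have "\<dots> = W * ((t\<^sup>2 * T\<^sup>2 / m) * (t / s))"
      using nz by (simp add: power_int_minus field_simps power_numeral_reduce)
    finally show ?thesis unfolding W_def .
  qed
  have "le (5 + 3) + le (5 - 3) - 2 * le 5 = - (J 1 * \<eta> ^ 3 * J 3 ^ 2 * Q ^ (5 - 3) / (J (5 + 3) * J (5 - 3) * J 5 ^ 2))"
    using le_relation[of 3] by simp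
  also have "J 1 * \<eta> ^ 3 * J 3 ^ 2 * Q ^ (5 - 3) / (J (5 + 3) * J (5 - 3) * J 5 ^ 2) = J 1 * \<eta> ^ 3 * J 3 ^ 2 * Q ^ 2 / (J 3 * J 2 * J 5 ^ 2)"
    by (simp add: J_numeral)
  finally have h: "le (5 + 3) + le (5 - 3) - 2 * le 5 = - (w * ((t\<^sup>2 * T\<^sup>2 / m) * (t / s)))" unfolding e r .
  show "le 2 - le 3 - 2 * le 5 = - (w * ((1 - T + t * T) * (1 + t\<^sup>2 * T)))"
    using h unfolding u v by (simp add: le_numeral)
  have e: "J 1 * \<eta> ^ 3 * J 4 ^ 2 * Q ^ 1 / (J 2 * J 1 * J 5 ^ 2) = mono [3, - 1, - 15, 4, - 2, 3, - 3]"
    unfolding mono_J by (simp add: mono_arith mono_mult_Q Qvec_def)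
  have r: "mono [3, - 1, - 15, 4, - 2, 3, - 3] = w * (t * T * (t / s))"
  proof -
    define W where "W = w"
    have "mono [3, - 1, - 15, 4, - 2, 3, - 3] = W * (t powi 2 * (T powi 1 * (m powi 0 * s powi (- 1))))"
      using ratio[of 2 1 0 "- 1"] unfolding W_def by simp
    also have "\<dots> = W * (t * T * (t / s))"
      using nz by (simp add: power_int_minus field_simps power_numeral_reduce)
    finally show ?thesis unfolding W_def .
  qed
  have "le (5 + 4) + le (5 - 4) - 2 * le 5 = - (J 1 * \<eta> ^ 3 * J 4 ^ 2 * Q ^ (5 - 4) / (J (5 + 4) * J (5 - 4) * J 5 ^ 2))"
    using le_relation[of 4] by simp
  also have "J 1 * \<eta> ^ 3 * J 4 ^ 2 * Q ^ (5 - 4) / (J (5 + 4) * J (5 - 4) * J 5 ^ 2) = J 1 * \<eta> ^ 3 * J 4 ^ 2 * Q ^ 1 / (J 2 * J 1 * J 5 ^ 2)"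
    by (simp add: J_numeral)
  finally have h: "le (5 + 4) + le (5 - 4) - 2 * le 5 = - (w * (t * T * (t / s)))" unfolding e r .
  show "le 1 - le 2 - 2 * le 5 = - (w * (t * T * (1 + t\<^sup>2 * T)))"
    using h unfolding v by (simp add: le_numeral)
  have e: "J 2 * \<eta> ^ 3 * J 5 / (J 4 * J 1 ^ 2) = mono [3, - 1, - 15, 3, - 1, 3, - 3]"
    unfolding mono_J by (simp add: mono_arith mono_mult_Q Qvec_def)
  have r: "mono [3, - 1, - 15, 3, - 1, 3, - 3] = w * (T\<^sup>2 * (t / s))"
  proof -
    define W where "W = w"
    have "mono [3, - 1, - 15, 3, - 1, 3, - 3] = W * (t powi 1 * (T powi 2 * (m powi 0 * s powi (- 1))))"
      using ratio[of 1 2 0 "- 1"] unfolding W_def by simp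
    also have "\<dots> = W * (T\<^sup>2 * (t / s))"
      using nz by (simp add: power_int_minus field_simps power_numeral_reduce)
    finally show ?thesis unfolding W_def .
  qed
  show "1 - le 5 - le 4 - 2 * le 1 = w * (T\<^sup>2 * (1 + t\<^sup>2 * T))"
    using le_wrap_relation unfolding e r v .
qed

text \<open>The first four relations express \<open>le 4, le 3, le 2, le 1\<close> as 3, 5, 7, 9
  times \<open>le 5\<close> plus known terms. In the fifth the coefficient of \<open>le 5\<close> is
  then \<open>1 + 3 + 2 * 9 = 22\<close>, the origin of 22 and of the odd shifts.\<close>

lemma log_deriv_values:
  shows "22 * le 5 - 1 = w * (- 1 + 3 * t + 9 * t\<^sup>2 + (- 3 * t - 4 * t\<^sup>2 + 9 * t ^ 3) * T)"
    and "22 * le 4 - 3 = w * (- 3 + 9 * t + 5 * t\<^sup>2 + (- 9 * t + 10 * t\<^sup>2 + 5 * t ^ 3) * T)"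
    and "22 * le 3 - 5 = w * (- 5 - 7 * t + t\<^sup>2 + (7 * t + 2 * t\<^sup>2 + t ^ 3) * T)"
    and "22 * le 2 - 7 = w * (- 7 - t - 3 * t\<^sup>2 + (t - 6 * t\<^sup>2 - 3 * t ^ 3) * T)"
    and "22 * le 1 - 9 = w * (- 9 - 17 * t - 7 * t\<^sup>2 + (- 5 * t - 14 * t\<^sup>2 - 7 * t ^ 3) * T)"
proof -
  define W where "W = w"
  note L = log_deriv_system[folded W_def]
  have c: "t * t * (T * T) = 1 + t - T + t * t * T" using curve by (simp add: power2_eq_square)
  show 5: "22 * le 5 - 1 = w * (- 1 + 3 * t + 9 * t\<^sup>2 + (- 3 * t - 4 * t\<^sup>2 + 9 * t ^ 3) * T)"
  proof -
    \<comment> \<open>The fifth relation contains \<open>le 4 + 2 * le 1\<close>. The first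
      right-hand side enters both, the next three only \<open>le 1\<close>; hence the weights 3, 2,
      2, 2.\<close>
    have "22 * le 5 - 1 = W * (3 * (t\<^sup>2 * (1 - T + t * T)) + 2 * (t ^ 3 * T\<^sup>2)
        + 2 * ((1 - T + t * T) * (1 + t\<^sup>2 * T)) + 2 * (t * T * (1 + t\<^sup>2 * T)) - T\<^sup>2 * (1 + t\<^sup>2 * T))"
      using L by algebra
    also have "3 * (t\<^sup>2 * (1 - T + t * T)) + 2 * (t ^ 3 * T\<^sup>2)
        + 2 * ((1 - T + t * T) * (1 + t\<^sup>2 * T)) + 2 * (t * T * (1 + t\<^sup>2 * T)) - T\<^sup>2 * (1 + t\<^sup>2 * T) =
        - 1 + 3 * t + 9 * t\<^sup>2 + (- 3 * t - 4 * t\<^sup>2 + 9 * t ^ 3) * T"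
      using c by algebra
    finally show ?thesis unfolding W_def .
  qed
  show 4: "22 * le 4 - 3 = w * (- 3 + 9 * t + 5 * t\<^sup>2 + (- 9 * t + 10 * t\<^sup>2 + 5 * t ^ 3) * T)"
    using L(1) 5[folded W_def] c unfolding W_def[symmetric] by algebra
  show 3: "22 * le 3 - 5 = w * (- 5 - 7 * t + t\<^sup>2 + (7 * t + 2 * t\<^sup>2 + t ^ 3) * T)"
    using L(2) 5[folded W_def] 4[folded W_def] c unfolding W_def[symmetric] by algebra
  show 2: "22 * le 2 - 7 = w * (- 7 - t - 3 * t\<^sup>2 + (t - 6 * t\<^sup>2 - 3 * t ^ 3) * T)"
    using L(3) 5[folded W_def] 3[folded W_def] c unfolding W_def[symmetric] by algebra
  show "22 * le 1 - 9 = w * (- 9 - 17 * t - 7 * t\<^sup>2 + (- 5 * t - 14 * t\<^sup>2 - 7 * t ^ 3) * T)"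
    using L(4) 5[folded W_def] 2[folded W_def] c unfolding W_def[symmetric] by algebra
qed

end

section \<open>The dissection at roots of unity\<close>

lemma sum_lessThan_11:
  fixes f :: "nat \<Rightarrow> complex"
  shows "(\<Sum>a<11. f a) = f 0 + f 1 + f 2 + f 3 + f 4 + f 5 + f 6 + f 7 + f 8 + f 9 + f 10"
  by (simp add: eval_nat_numeral)

lemma lengths_terms:
  "list_all (\<lambda>x. length (fst (snd x)) = 7) (concat theta_terms)"
  "list_all (\<lambda>x. length (fst (snd x)) = 7) (concat crank_terms)"
  "list_all (\<lambda>x. length (fst (snd x)) = 7) (qterms_of (concat theta_terms))"
  "list_all (\<lambda>x. length (fst (snd x)) = 7) zeta5_terms"
  "list_all (\<lambda>x. length (fst (snd x)) = 7) one_minus_zeta"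
  "list_all (\<lambda>x. length (fst (snd x)) = 7) minus_11_one_plus_zeta"
  "list_all (\<lambda>x. length (fst (snd x)) = 7) (concat Y_terms)"
  "list_all (\<lambda>x. length (fst (snd x)) = 7) neg_euler_terms"
  "list_all (\<lambda>x. length (fst (snd x)) = 7) euler_terms"
  "list_all (\<lambda>x. length (fst (snd x)) = 7) (sterms_mult neg_euler_terms euler_terms)"
  by code_simp+

lemma lengths_term_lists:
  "list_all (list_all (\<lambda>x. length (fst (snd x)) = 7)) theta_terms"
  "list_all (list_all (\<lambda>x. length (fst (snd x)) = 7)) crank_terms"
  "list_all (list_all (\<lambda>x. length (fst (snd x)) = 7)) V_terms"
  "list_all (list_all (\<lambda>x. length (fst (snd x)) = 7)) neg_omega_terms"
  "length theta_terms = 5" "length crank_terms = 11" "length V_terms = 11" "length neg_omega_terms = 6"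
  "length V_data = 11" "length Y_data = 11" "length Y_terms = 11"
  "list_all (\<lambda>d. length (snd d) = 5) V_data" "list_all (\<lambda>d. length (snd d) = 5) Y_data"
  by code_simp+

lemma list5_eq: "length xs = 5 \<Longrightarrow> xs = [xs ! 0, xs ! 1, xs ! 2, xs ! 3, xs ! 4]"
  by (auto simp: numeral_eq_Suc length_Suc_conv)

lemma list6_eq: "length xs = 6 \<Longrightarrow> xs = [xs ! 0, xs ! 1, xs ! 2, xs ! 3, xs ! 4, xs ! 5]"
  by (auto simp: numeral_eq_Suc length_Suc_conv)

lemma sum_list_map_concat:
  "sum_list (map f (concat xss)) = (\<Sum>i<length xss. sum_list (map f (xss ! i)))" for f :: "'a \<Rightarrow> complex"
  by (induction xss) (simp_all add: sum.lessThan_Suc_shift del: sum.lessThan_Suc)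

lemma V_terms_nth: "i < 11 \<Longrightarrow> V_terms ! i = odd_terms (int i) (V_data ! i)"
  and Y_terms_nth: "i < 11 \<Longrightarrow> Y_terms ! i = odd_terms (int i) (Y_data ! i)"
proof -
  have "[0, 1, 2, 3, 4, 5, 6, 7, 8, 9, 10] = map int [0..<11]" by (simp add: upt_conv_Cons)
  then show "i < 11 \<Longrightarrow> V_terms ! i = odd_terms (int i) (V_data ! i)"
    "i < 11 \<Longrightarrow> Y_terms ! i = odd_terms (int i) (Y_data ! i)"
    unfolding V_terms_def Y_terms_def using lengths_term_lists by simp_all
qed

context theta_eleven
begin

definition component :: "nat \<Rightarrow> nat \<Rightarrow> complex" where
  "component i b = (mono (fst (V_data ! i)) * ppval t T (snd (V_data ! i) ! (b - 1)) +
     mono (fst (Y_data ! i)) * ppval t T (snd (Y_data ! i) ! (b - 1))) / 22"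

end

context root_eleven
begin

sublocale eng: level_eleven q \<zeta> \<eta> "J 5" y t T
proof
  show "q ^ 11 = monom_val [\<eta>, J 5, y, t, T, 1 + t, T - 1] Qvec"
    using mono_Qvec by (simp only: mono_def)
qed (use q \<zeta>_nonzero \<eta>_nonzero J_nz t_T_nonzero m_s_nonzero curve \<zeta>(1) \<zeta>_sum in simp_all)

lemma eng_mon: "eng.mon v = mono v"
  by (simp only: mono_def)

text \<open>Modulo 11 the exponent \<open>a - 5\<close> is \<open>a + 6\<close>; this extracts the
  common factor \<open>\<zeta> ^ 6\<close> and leaves nonnegative powers.\<close>

lemma minus_\<zeta>_powi: "(- \<zeta>) powi (int a - 5) = - (\<zeta> ^ 6 * ((- 1) ^ a * \<zeta> ^ a))"
proof -
  have "(- \<zeta>) powi (int a - 5) = (- \<zeta>) ^ a / (- \<zeta>) ^ 5"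
    using \<zeta>_nonzero by (simp add: power_int_diff)
  also have "(- \<zeta>) ^ a = (- 1) ^ a * \<zeta> ^ a" by (rule power_minus)
  also have "(- 1) ^ a * \<zeta> ^ a / (- \<zeta>) ^ 5 = - (\<zeta> ^ 6 * ((- 1) ^ a * \<zeta> ^ a)) * (\<zeta> ^ 11 / \<zeta> ^ 11)"
    using \<zeta>_nonzero \<zeta>(1) by (simp add: divide_simps power_numeral_reduce)
  finally show ?thesis using \<zeta>(1) by simp
qed

lemma J_0: "J 0 = 0"
  by (simp add: J_def theta_1[OF P(2)])

lemma itri_values:
  "itri (- 5) = 15" "itri (- 4) = 10" "itri (- 3) = 6" "itri (- 2) = 3" "itri (- 1) = 1"
  "itri 2 = 1" "itri 3 = 3" "itri 4 = 6" "itri 5 = 10"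
  by (simp_all add: itri_def)

abbreviation theta_part :: complex where
  "theta_part \<equiv> q ^ 10 * J 1 * (\<zeta> ^ 1 - \<zeta> ^ 10) - q ^ 6 * J 2 * (\<zeta> ^ 2 - \<zeta> ^ 9)
     + q ^ 3 * J 3 * (\<zeta> ^ 3 - \<zeta> ^ 8) - q * J 4 * (\<zeta> ^ 4 - \<zeta> ^ 7) + J 5 * (\<zeta> ^ 5 - \<zeta> ^ 6)"

lemma sval_theta_terms: "sum_list (map eng.sval (concat theta_terms)) = theta_part"
  by (simp add: theta_terms_def eng_mon mono_J(2-6)[symmetric] algebra_simps del: monom_val.simps One_nat_def)

lemma theta_eq_theta_part: "theta q \<zeta> = \<zeta> ^ 6 * theta_part"
proof -
  define z where "z a = \<zeta> ^ a" for a
  have "theta q \<zeta> = (\<Sum>a<11. q powi itri (int a - 5) * - (z 6 * ((- 1) ^ a * z a)) * J a)"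
    unfolding theta_\<zeta> minus_\<zeta>_powi z_def by (rule refl)
  also have "\<dots> = z 6 * (q ^ 10 * J 1 * (z 1 - z 10) - q ^ 6 * J 2 * (z 2 - z 9)
     + q ^ 3 * J 3 * (z 3 - z 8) - q * J 4 * (z 4 - z 7) + J 5 * (z 5 - z 6))"
    unfolding sum_lessThan_11
    by (simp add: itri_values J_0 J_numeral algebra_simps del: One_nat_def)
  finally show ?thesis unfolding z_def .
qed

lemma le_10: "le 10 = - le 1"
  using le_reflect[of 1] by simp

lemma log_deriv_terms:
  "mono [3, 0, - 5, 0, - 2, 1, 0] * ppval t T ([99, 187, 77], [0, 55, 154, 77]) = - 11 * (J 1 * (22 * le 1 - 9))"
  "mono [3, 0, - 9, 1, - 2, 2, - 1] * ppval t T ([- 77, - 11, - 33], [0, 11, - 66, - 33]) = 11 * (J 2 * (22 * le 2 - 7))"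
  "mono [3, 0, - 12, 2, - 2, 2, - 2] * ppval t T ([55, 77, - 11], [0, - 77, - 22, - 11]) = - 11 * (J 3 * (22 * le 3 - 5))"
  "mono [3, 0, - 14, 2, - 3, 3, - 2] * ppval t T ([- 33, 99, 55], [0, - 99, 110, 55]) = 11 * (J 4 * (22 * le 4 - 3))"
  "mono [3, 0, - 15, 2, - 3, 3, - 2] * ppval t T ([11, - 33, - 99], [0, 33, 44, - 99]) = - 11 * (J 5 * (22 * le 5 - 1))"
proof -
  have v: "mono [3, 0, - 5, 0, - 2, 1, 0] = w * J 1" "mono [3, 0, - 9, 1, - 2, 2, - 1] = w * J 2"
    "mono [3, 0, - 12, 2, - 2, 2, - 2] = w * J 3" "mono [3, 0, - 14, 2, - 3, 3, - 2] = w * J 4"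
    "mono [3, 0, - 15, 2, - 3, 3, - 2] = w * J 5"
    unfolding mono_J by (simp_all add: mono_arith)
  show "mono [3, 0, - 5, 0, - 2, 1, 0] * ppval t T ([99, 187, 77], [0, 55, 154, 77]) = - 11 * (J 1 * (22 * le 1 - 9))"
    "mono [3, 0, - 9, 1, - 2, 2, - 1] * ppval t T ([- 77, - 11, - 33], [0, 11, - 66, - 33]) = 11 * (J 2 * (22 * le 2 - 7))"
    "mono [3, 0, - 12, 2, - 2, 2, - 2] * ppval t T ([55, 77, - 11], [0, - 77, - 22, - 11]) = - 11 * (J 3 * (22 * le 3 - 5))"
    "mono [3, 0, - 14, 2, - 3, 3, - 2] * ppval t T ([- 33, 99, 55], [0, - 99, 110, 55]) = 11 * (J 4 * (22 * le 4 - 3))"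
    "mono [3, 0, - 15, 2, - 3, 3, - 2] * ppval t T ([11, - 33, - 99], [0, 33, 44, - 99]) = - 11 * (J 5 * (22 * le 5 - 1))"
    unfolding log_deriv_values v
    by (simp_all only: ppval_def fst_conv snd_conv pval.simps of_int_numeral of_int_neg_numeral of_int_0) algebra+
qed

lemma qval_neg_omega_terms:
  "sum_list (map eng.qval (concat neg_omega_terms)) =
    - 11 * (q ^ 10 * J 1 * (22 * le 1 - 9) * (\<zeta> ^ 1 + \<zeta> ^ 10)) + 11 * (q ^ 6 * J 2 * (22 * le 2 - 7) * (\<zeta> ^ 2 + \<zeta> ^ 9))
    - 11 * (q ^ 3 * J 3 * (22 * le 3 - 5) * (\<zeta> ^ 3 + \<zeta> ^ 8)) + 11 * (q * J 4 * (22 * le 4 - 3) * (\<zeta> ^ 4 + \<zeta> ^ 7))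
    - 11 * (J 5 * (22 * le 5 - 1) * (\<zeta> ^ 5 + \<zeta> ^ 6)) - 242 * q ^ 15 * \<eta> ^ 3"
proof -
  have e: "mono [3, 0, 0, 0, 0, 0, 0] = \<eta> ^ 3" unfolding mono_J(7) by (simp add: mono_arith)
  have c: "ppval t T ([- 242], []) = - 242" by (simp add: ppval_def)
  have r: "a * m * c * p = a * c * (m * p)" for a m c p :: complex by simp
  have "sum_list (map eng.qval (concat neg_omega_terms)) =
    q ^ 10 * \<zeta> ^ 1 * (- 11 * (J 1 * (22 * le 1 - 9))) + (q ^ 10 * \<zeta> ^ 10 * (- 11 * (J 1 * (22 * le 1 - 9))) +
    (q ^ 6 * \<zeta> ^ 2 * (11 * (J 2 * (22 * le 2 - 7))) + (q ^ 6 * \<zeta> ^ 9 * (11 * (J 2 * (22 * le 2 - 7))) +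
    (q ^ 3 * \<zeta> ^ 3 * (- 11 * (J 3 * (22 * le 3 - 5))) + (q ^ 3 * \<zeta> ^ 8 * (- 11 * (J 3 * (22 * le 3 - 5))) +
    (q ^ 1 * \<zeta> ^ 4 * (11 * (J 4 * (22 * le 4 - 3))) + (q ^ 1 * \<zeta> ^ 7 * (11 * (J 4 * (22 * le 4 - 3))) +
    (q ^ 0 * \<zeta> ^ 5 * (- 11 * (J 5 * (22 * le 5 - 1))) + (q ^ 0 * \<zeta> ^ 6 * (- 11 * (J 5 * (22 * le 5 - 1))) +
    (q ^ 15 * \<zeta> ^ 0 * (\<eta> ^ 3 * - 242) + 0))))))))))"
    unfolding neg_omega_terms_def log_deriv_terms[symmetric]
    by (simp only: concat.simps append.simps list.map sum_list.Cons sum_list.Nil eng.qval.simps eng_mon r e c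
        power_int_numeral power_int_0_right power_int_1_right power_0 power_one_right)
  also have "\<dots> = - 11 * (q ^ 10 * J 1 * (22 * le 1 - 9) * (\<zeta> ^ 1 + \<zeta> ^ 10)) + 11 * (q ^ 6 * J 2 * (22 * le 2 - 7) * (\<zeta> ^ 2 + \<zeta> ^ 9))
    - 11 * (q ^ 3 * J 3 * (22 * le 3 - 5) * (\<zeta> ^ 3 + \<zeta> ^ 8)) + 11 * (q * J 4 * (22 * le 4 - 3) * (\<zeta> ^ 4 + \<zeta> ^ 7))
    - 11 * (J 5 * (22 * le 5 - 1) * (\<zeta> ^ 5 + \<zeta> ^ 6)) - 242 * q ^ 15 * \<eta> ^ 3"
    unfolding power_0 power_one_right by algebra
  finally show ?thesis .
qed

text \<open>Write the index of class \<open>a\<close> as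
  \<open>a - 5 = 1/2 - (11 - 2 * a) / 2\<close>. After multiplication by 22 the half yields
  \<open>11 * theta q \<zeta>\<close>, and the remainder combines with \<open>11 * le a\<close> into
  \<open>11 * (22 * le a - (11 - 2 * a))\<close>. Class 0, where \<open>J 0 = 0\<close>, contributes
  only through \<open>thetaD P 1 = - \<eta> ^ 3\<close>.\<close>

lemma thetaD_eq_neg_omega:
  "22 * thetaD q \<zeta> = 11 * theta q \<zeta> - \<zeta> ^ 6 * sum_list (map eng.qval (concat neg_omega_terms))"
proof -
  define z where "z a = \<zeta> ^ a" for a
  define L where "L a = le a" for a
  define D where "D a = thetaD P ((q ^ 11) ^ a)" for a
  have D0: "D 0 = - (\<eta> ^ 3)" unfolding D_def \<eta>_def using thetaD_1[OF P(2)] by simp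
  have D: "D 1 = J 1 * L 1" "D 2 = J 2 * L 2" "D 3 = J 3 * L 3" "D 4 = J 4 * L 4" "D 5 = J 5 * L 5"
    "D 6 = - (J 5 * L 5)" "D 7 = - (J 4 * L 4)" "D 8 = - (J 3 * L 3)" "D 9 = - (J 2 * L 2)" "D 10 = - (J 1 * L 1)"
    unfolding D_def L_def by (simp_all only: thetaD_J J_numeral le_numeral le_10) (simp_all only: thetaD_J J_numeral le_numeral le_10 flip: mult_minus_right)
  have z0: "z 0 = 1" by (simp add: z_def)
  have sg: "(-1 :: complex) ^ 0 = 1" "(-1 :: complex) ^ 1 = -1" "(-1 :: complex) ^ 2 = 1" "(-1 :: complex) ^ 3 = -1"
    "(-1 :: complex) ^ 4 = 1" "(-1 :: complex) ^ 5 = -1" "(-1 :: complex) ^ 6 = 1" "(-1 :: complex) ^ 7 = -1"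
    "(-1 :: complex) ^ 8 = 1" "(-1 :: complex) ^ 9 = -1" "(-1 :: complex) ^ 10 = 1" by simp_all
  have "22 * thetaD q \<zeta> = 22 * (\<Sum>a<11. q powi itri (int a - 5) * - (z 6 * ((- 1) ^ a * z a)) * (of_int (int a - 5) * J a + 11 * D a))"
    unfolding thetaD_\<zeta> minus_\<zeta>_powi z_def D_def by (rule refl)
  also have "\<dots> = 22 * (z 6 * (q ^ 15 * (11 * - (\<eta> ^ 3)) * - 1 + q ^ 10 * z 1 * (- 4 * J 1 + 11 * (J 1 * L 1))
     - q ^ 6 * z 2 * (- 3 * J 2 + 11 * (J 2 * L 2)) + q ^ 3 * z 3 * (- 2 * J 3 + 11 * (J 3 * L 3))
     - q * z 4 * (- J 4 + 11 * (J 4 * L 4)) + z 5 * (11 * (J 5 * L 5)) - z 6 * (J 5 - 11 * (J 5 * L 5))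
     + q * z 7 * (2 * J 4 - 11 * (J 4 * L 4)) - q ^ 3 * z 8 * (3 * J 3 - 11 * (J 3 * L 3))
     + q ^ 6 * z 9 * (4 * J 2 - 11 * (J 2 * L 2)) - q ^ 10 * z 10 * (5 * J 1 - 11 * (J 1 * L 1))))"
    unfolding sum_lessThan_11 sg D D0 z0 J_0 J_numeral
    by (simp add: itri_values algebra_simps del: One_nat_def)
  also have "\<dots> = 11 * (z 6 * (q ^ 10 * J 1 * (z 1 - z 10) - q ^ 6 * J 2 * (z 2 - z 9)
     + q ^ 3 * J 3 * (z 3 - z 8) - q * J 4 * (z 4 - z 7) + J 5 * (z 5 - z 6))) - z 6 * (
    - 11 * (q ^ 10 * J 1 * (22 * L 1 - 9) * (z 1 + z 10)) + 11 * (q ^ 6 * J 2 * (22 * L 2 - 7) * (z 2 + z 9))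
    - 11 * (q ^ 3 * J 3 * (22 * L 3 - 5) * (z 3 + z 8)) + 11 * (q * J 4 * (22 * L 4 - 3) * (z 4 + z 7))
    - 11 * (J 5 * (22 * L 5 - 1) * (z 5 + z 6)) - 242 * q ^ 15 * \<eta> ^ 3)"
    by (simp add: algebra_simps del: One_nat_def)
  finally show ?thesis unfolding theta_eq_theta_part qval_neg_omega_terms z_def L_def .
qed

lemma qval_euler_terms: "sum_list (map eng.qval euler_terms) = qpoch_inf q q"
  and sval_neg_euler_terms: "sum_list (map eng.sval neg_euler_terms) = - qpoch_inf q q"
proof -
  have m: "mono [1, 0, - 5, 1, - 1, 1, - 1] = \<eta> * (J 4 / J 2)" "mono [1, 0, - 4, 1, 0, 1, - 1] = \<eta> * (J 2 / J 1)"
    "mono [1, 0, - 3, 0, - 1, 1, 0] = \<eta> * (J 5 / J 3)" "mono [1, 0, 0, 0, 0, 0, 0] = \<eta>"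
    "mono [1, 0, 2, 0, 1, - 1, 0] = \<eta> * (J 3 / J 4)" "mono [1, 0, 10, - 2, 1, - 2, 2] = \<eta> * (J 1 / J 5)"
    unfolding mono_J by (simp_all add: mono_arith)
  show "sum_list (map eng.qval euler_terms) = qpoch_inf q q"
    unfolding qpoch_dissection euler_terms_def
    by (simp add: eng_mon m ppval_def algebra_simps del: monom_val.simps One_nat_def)
  show "sum_list (map eng.sval neg_euler_terms) = - qpoch_inf q q"
    unfolding qpoch_dissection neg_euler_terms_def
    by (simp add: eng_mon m algebra_simps del: monom_val.simps One_nat_def)
qed

lemma qval_qterms_of: "sum_list (map eng.qval (qterms_of xs)) = sum_list (map eng.sval xs)"
  by (induction xs) (auto simp: qterms_of_def ppval_def)

lemma crank_times_theta:
  "sum_list (map eng.sval (concat crank_terms)) * theta q \<zeta> = (1 - \<zeta>) * (qpoch_inf q q)\<^sup>2"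
proof -
  have "sum_list (map eng.sval zeta5_terms) = \<zeta> ^ 5 - \<zeta> ^ 6" by (simp add: zeta5_terms_def)
  then have "sum_list (map eng.sval (concat crank_terms)) * theta_part +
      (\<zeta> ^ 5 - \<zeta> ^ 6) * (- qpoch_inf q q * qpoch_inf q q) = 0"
    using eng.check_sound[OF check_crank] unfolding map_append sum_list.append
    by (simp only: eng.qval_sterms_mult lengths_terms qval_qterms_of qval_euler_terms sval_neg_euler_terms sval_theta_terms)
  moreover have "\<zeta> ^ 6 * (\<zeta> ^ 5 - \<zeta> ^ 6) = 1 - \<zeta>"
  proof -
    have "\<zeta> ^ 6 * (\<zeta> ^ 5 - \<zeta> ^ 6) = \<zeta> ^ 11 - \<zeta> * \<zeta> ^ 11" by (simp add: power_numeral_reduce algebra_simps)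
    then show ?thesis by (simp add: \<zeta>(1))
  qed
  moreover have "C * (x * th) = r * e\<^sup>2" if "C * th + s * (- e * e) = 0" "x * s = r" for C x th r e s :: complex
    using that by algebra
  ultimately show ?thesis unfolding theta_eq_theta_part by blast
qed

lemma qval_Y_terms:
  "(1 - \<zeta>) * sum_list (map eng.qval (concat Y_terms)) = 11 * (1 + \<zeta>) * sum_list (map eng.sval (concat crank_terms))"
proof -
  have "sum_list (map eng.sval one_minus_zeta) = 1 - \<zeta>" "sum_list (map eng.qval minus_11_one_plus_zeta) = - 11 * (1 + \<zeta>)"
    by (simp_all add: one_minus_zeta_def minus_11_one_plus_zeta_def ppval_def)
  then have "(1 - \<zeta>) * sum_list (map eng.qval (concat Y_terms)) +
      sum_list (map eng.sval (concat crank_terms)) * (- 11 * (1 + \<zeta>)) = 0"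
    using eng.check_sound[OF check_Y] unfolding map_append sum_list.append
    by (simp only: eng.qval_sterms_mult lengths_terms)
  then show ?thesis by algebra
qed

lemma qval_V_class:
  assumes "a < 11" "b < 11" "c < 11" "d < 11" "e < 11" "f < 11"
  shows "sum_list (map eng.qval (V_class [a, b, c, d, e, f])) =
    (let h = (\<lambda>k. sum_list (map eng.sval (theta_terms ! k))); V = (\<lambda>i. sum_list (map eng.qval (V_terms ! i)));
         C = (\<lambda>i. sum_list (map eng.sval (crank_terms ! i))); N = (\<lambda>k. sum_list (map eng.qval (neg_omega_terms ! k)))
     in h 0 * V a + (h 1 * V b + (h 2 * V c + (h 3 * V d + h 4 * V e))) +
        (C a * N 0 + (C b * N 1 + (C c * N 2 + (C d * N 3 + (C e * N 4 + C f * N 5))))))"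
proof -
  have l: "list_all (\<lambda>x. length (fst (snd x)) = 7) (theta_terms ! k)" if "k < 5" for k
    using lengths_term_lists(1,5) that by (simp add: list_all_length)
  have l2: "list_all (\<lambda>x. length (fst (snd x)) = 7) (crank_terms ! k)"
    "list_all (\<lambda>x. length (fst (snd x)) = 7) (V_terms ! k)" if "k < 11" for k
    using lengths_term_lists(2,3,6,7) that by (simp_all add: list_all_length)
  have l3: "list_all (\<lambda>x. length (fst (snd x)) = 7) (neg_omega_terms ! k)" if "k < 6" for k
    using lengths_term_lists(4,8) that by (simp add: list_all_length)
  have tv: "sum_list (map eng.qval (sterms_mult (theta_terms ! k) (V_terms ! i))) =
      sum_list (map eng.sval (theta_terms ! k)) * sum_list (map eng.qval (V_terms ! i))" if "k < 5" "i < 11" for k i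
    by (rule eng.qval_sterms_mult[OF l[OF that(1)] l2(2)[OF that(2)]])
  have cn: "sum_list (map eng.qval (sterms_mult (crank_terms ! i) (neg_omega_terms ! k))) =
      sum_list (map eng.sval (crank_terms ! i)) * sum_list (map eng.qval (neg_omega_terms ! k))" if "k < 6" "i < 11" for k i
    by (rule eng.qval_sterms_mult[OF l2(1)[OF that(2)] l3[OF that(1)]])
  have 1: "map2 (\<lambda>x i. sterms_mult x (V_terms ! i)) theta_terms [a, b, c, d, e, f] =
      [sterms_mult (theta_terms ! 0) (V_terms ! a), sterms_mult (theta_terms ! 1) (V_terms ! b),
       sterms_mult (theta_terms ! 2) (V_terms ! c), sterms_mult (theta_terms ! 3) (V_terms ! d),
       sterms_mult (theta_terms ! 4) (V_terms ! e)]"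
    by (subst list5_eq[OF lengths_term_lists(5)]) (simp only: zip_Cons_Cons zip_Nil list.map prod.case)
  have 2: "map2 (\<lambda>i y. sterms_mult (crank_terms ! i) y) [a, b, c, d, e, f] neg_omega_terms =
      [sterms_mult (crank_terms ! a) (neg_omega_terms ! 0), sterms_mult (crank_terms ! b) (neg_omega_terms ! 1),
       sterms_mult (crank_terms ! c) (neg_omega_terms ! 2), sterms_mult (crank_terms ! d) (neg_omega_terms ! 3),
       sterms_mult (crank_terms ! e) (neg_omega_terms ! 4), sterms_mult (crank_terms ! f) (neg_omega_terms ! 5)]"
    by (subst list6_eq[OF lengths_term_lists(8)]) (simp only: zip_Cons_Cons zip_Nil list.map prod.case)
  have k: "(0::nat) < 5" "(1::nat) < 5" "(2::nat) < 5" "(3::nat) < 5" "(4::nat) < 5"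
    "(0::nat) < 6" "(1::nat) < 6" "(2::nat) < 6" "(3::nat) < 6" "(4::nat) < 6" "(5::nat) < 6" by simp_all
  show ?thesis
    unfolding V_class_def 1 2 Let_def
    by (simp only: concat.simps map_append sum_list.append append_Nil2 tv cn k assms)
qed

text \<open>In each of the six positions the lists of \<open>check_V\<close> run through all
  residues 0 to 10 once, so adding the eleven identities restores the two complete products.\<close>

lemma V_theta_crank_omega:
  "theta_part * sum_list (map eng.qval (concat V_terms)) +
    sum_list (map eng.sval (concat crank_terms)) * sum_list (map eng.qval (concat neg_omega_terms)) = 0"
proof -
  define h V C N where "h k = sum_list (map eng.sval (theta_terms ! k))" and "V i = sum_list (map eng.qval (V_terms ! i))"
    and "C i = sum_list (map eng.sval (crank_terms ! i))" and "N k = sum_list (map eng.qval (neg_omega_terms ! k))" for k i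
  define E where "E a b c d e f = h 0 * V a + (h 1 * V b + (h 2 * V c + (h 3 * V d + h 4 * V e))) +
        (C a * N 0 + (C b * N 1 + (C c * N 2 + (C d * N 3 + (C e * N 4 + C f * N 5)))))" for a b c d e f
  have E: "E a b c d e f = 0"
    if "check V_rows (V_class [a, b, c, d, e, f])" "a < 11" "b < 11" "c < 11" "d < 11" "e < 11" "f < 11" for a b c d e f
    using eng.check_sound[OF that(1)] unfolding qval_V_class[OF that(2-)] Let_def E_def h_def V_def C_def N_def .
  have Es: "E 1 5 8 10 0 7 = 0" "E 2 6 9 0 1 8 = 0" "E 3 7 10 1 2 9 = 0" "E 4 8 0 2 3 10 = 0" "E 5 9 1 3 4 0 = 0"
    "E 6 10 2 4 5 1 = 0" "E 7 0 3 5 6 2 = 0" "E 8 1 4 6 7 3 = 0" "E 9 2 5 7 8 4 = 0" "E 10 3 6 8 9 5 = 0" "E 0 4 7 9 10 6 = 0"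
    by (rule E, rule check_V; simp)+
  have s: "theta_part = h 0 + h 1 + h 2 + h 3 + h 4"
    unfolding sval_theta_terms[symmetric] sum_list_map_concat lengths_term_lists h_def by (simp add: eval_nat_numeral)
  have s': "sum_list (map eng.qval (concat neg_omega_terms)) = N 0 + N 1 + N 2 + N 3 + N 4 + N 5"
    unfolding sum_list_map_concat lengths_term_lists N_def by (simp add: eval_nat_numeral)
  have "theta_part * sum_list (map eng.qval (concat V_terms)) +
    sum_list (map eng.sval (concat crank_terms)) * sum_list (map eng.qval (concat neg_omega_terms)) =
    E 1 5 8 10 0 7 + E 2 6 9 0 1 8 + E 3 7 10 1 2 9 + E 4 8 0 2 3 10 + E 5 9 1 3 4 0 +
    E 6 10 2 4 5 1 + E 7 0 3 5 6 2 + E 8 1 4 6 7 3 + E 9 2 5 7 8 4 + E 10 3 6 8 9 5 + E 0 4 7 9 10 6"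
    unfolding s s'
    unfolding sum_list_map_concat lengths_term_lists sum_lessThan_11 E_def V_def[symmetric] C_def[symmetric]
    by (simp only: distrib_left distrib_right add_ac)
  then show ?thesis unfolding Es by simp
qed

text \<open>All denominators are cleared by \<open>(1 - \<zeta>) * X^2\<close>. It is nonzero,
  because theta vanishes only at powers of \<open>q\<close> and \<open>\<zeta>\<close> is a point of
  norm 1 other than 1.\<close>

theorem ones_gf_difference:
  "22 * (ones_gf \<zeta> q - ones_gf (1 / \<zeta>) q) =
    sum_list (map eng.qval (concat V_terms)) + sum_list (map eng.qval (concat Y_terms))"
proof -
  define G th e D C N SV SY where "G = ones_gf \<zeta> q - ones_gf (1 / \<zeta>) q" and "th = theta_part" and "e = qpoch_inf q q"
    and "D = thetaD q \<zeta>" and "C = sum_list (map eng.sval (concat crank_terms))"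
    and "N = sum_list (map eng.qval (concat neg_omega_terms))" and "SV = sum_list (map eng.qval (concat V_terms))"
    and "SY = sum_list (map eng.qval (concat Y_terms))"
  define X where "X = theta q \<zeta>"
  have f: "G * X\<^sup>2 = e\<^sup>2 * ((1 - \<zeta>) * D + \<zeta> * X)" "22 * D = 11 * X - \<zeta> ^ 6 * N" "C * X = (1 - \<zeta>) * e\<^sup>2"
    "th * SV + C * N = 0" "X = \<zeta> ^ 6 * th" "(1 - \<zeta>) * SY = 11 * (1 + \<zeta>) * C"
    unfolding G_def th_def e_def D_def C_def N_def SV_def SY_def X_def
    by (rule crank_theta_identity[OF q(2,1) norm_\<zeta>] thetaD_eq_neg_omega crank_times_theta V_theta_crank_omega
        theta_eq_theta_part qval_Y_terms)+
  have "(1 - \<zeta>) * X\<^sup>2 * (22 * G) = (1 - \<zeta>) * X\<^sup>2 * (SV + SY)"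
  proof -
    have "X * SV = - (\<zeta> ^ 6 * C * N)" using f(4,5) by algebra
    moreover have "22 * (G * X\<^sup>2) = e\<^sup>2 * (11 * (1 + \<zeta>) * X - (1 - \<zeta>) * (\<zeta> ^ 6 * N))" using f(1,2) by algebra
    ultimately show ?thesis using f(3,6) by algebra
  qed
  moreover have "(1 - \<zeta>) * X\<^sup>2 \<noteq> 0" using \<zeta>(2) theta_\<zeta>_nonzero by (simp add: X_def)
  ultimately have "22 * G = SV + SY" by (simp only: mult_cancel_left simp_thms)
  then show ?thesis unfolding G_def SV_def SY_def .
qed

lemma qval_odd_terms:
  assumes "length (snd d) = 5"
  shows "sum_list (map eng.qval (odd_terms (int n) d)) =
    q ^ n * (\<Sum>b\<in>{1..5}. (\<zeta> ^ b - \<zeta> ^ (11 - b)) * (mono (fst d) * ppval t T (snd d ! (b - 1))))"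
proof -
  have s: "{1..5 :: nat} = {1, 2, 3, 4, 5}" by auto
  have pr: "eng.qval (int n, v, b, R) + eng.qval (int n, v, 11 - b, pp_smult (- 1) R) =
      q ^ n * ((\<zeta> powi b - \<zeta> powi (11 - b)) * (mono v * ppval t T R))" for v b R
    by (simp add: eng_mon ppval_smult algebra_simps del: monom_val.simps)
  obtain v R1 R2 R3 R4 R5 where d: "d = (v, [R1, R2, R3, R4, R5])"
    using list5_eq[OF assms] by (metis prod.collapse)
  have "sum_list (map eng.qval (odd_terms (int n) d)) =
      (eng.qval (int n, v, 1, R1) + eng.qval (int n, v, 11 - 1, pp_smult (- 1) R1)) +
      (eng.qval (int n, v, 2, R2) + eng.qval (int n, v, 11 - 2, pp_smult (- 1) R2)) +
      (eng.qval (int n, v, 3, R3) + eng.qval (int n, v, 11 - 3, pp_smult (- 1) R3)) +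
      (eng.qval (int n, v, 4, R4) + eng.qval (int n, v, 11 - 4, pp_smult (- 1) R4)) +
      (eng.qval (int n, v, 5, R5) + eng.qval (int n, v, 11 - 5, pp_smult (- 1) R5))"
    unfolding d odd_terms_def fst_conv snd_conv
    by (simp only: zip_Cons_Cons zip_Nil list.map prod.case concat.simps append.simps sum_list.Cons sum_list.Nil
        add.assoc add_0_right)
  also have "\<dots> = q ^ n * (\<Sum>b\<in>{1..5}. (\<zeta> ^ b - \<zeta> ^ (11 - b)) * (mono v * ppval t T ([R1, R2, R3, R4, R5] ! (b - 1))))"
    unfolding pr s by (simp add: distrib_left)
  finally show ?thesis unfolding d by simp
qed

theorem ones_gf_dissection:
  "ones_gf \<zeta> q - ones_gf (1 / \<zeta>) q =
    (\<Sum>i<11. q ^ i * (\<Sum>b\<in>{1..5}. (\<zeta> ^ b - \<zeta> ^ (11 - b)) * component i b))"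
proof -
  have V: "sum_list (map eng.qval (V_terms ! i)) =
      q ^ i * (\<Sum>b\<in>{1..5}. (\<zeta> ^ b - \<zeta> ^ (11 - b)) * (mono (fst (V_data ! i)) * ppval t T (snd (V_data ! i) ! (b - 1))))"
    and Y: "sum_list (map eng.qval (Y_terms ! i)) =
      q ^ i * (\<Sum>b\<in>{1..5}. (\<zeta> ^ b - \<zeta> ^ (11 - b)) * (mono (fst (Y_data ! i)) * ppval t T (snd (Y_data ! i) ! (b - 1))))"
    if "i < 11" for i
  proof -
    have "length (snd (V_data ! i)) = 5" "length (snd (Y_data ! i)) = 5"
      using lengths_term_lists that by (simp_all add: list_all_length)
    then show "sum_list (map eng.qval (V_terms ! i)) =
      q ^ i * (\<Sum>b\<in>{1..5}. (\<zeta> ^ b - \<zeta> ^ (11 - b)) * (mono (fst (V_data ! i)) * ppval t T (snd (V_data ! i) ! (b - 1))))"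
      "sum_list (map eng.qval (Y_terms ! i)) =
      q ^ i * (\<Sum>b\<in>{1..5}. (\<zeta> ^ b - \<zeta> ^ (11 - b)) * (mono (fst (Y_data ! i)) * ppval t T (snd (Y_data ! i) ! (b - 1))))"
      by (simp_all only: V_terms_nth[OF that] Y_terms_nth[OF that] qval_odd_terms)
  qed
  have "22 * (ones_gf \<zeta> q - ones_gf (1 / \<zeta>) q) =
      (\<Sum>i<11. sum_list (map eng.qval (V_terms ! i)) + sum_list (map eng.qval (Y_terms ! i)))"
    unfolding ones_gf_difference sum_list_map_concat lengths_term_lists by (simp only: sum.distrib)
  also have "\<dots> = (\<Sum>i<11. 22 * (q ^ i * (\<Sum>b\<in>{1..5}. (\<zeta> ^ b - \<zeta> ^ (11 - b)) * component i b)))"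
  proof (rule sum.cong[OF refl])
    fix i :: nat assume i: "i \<in> {..<11}"
    have "c * (x * A) + c * (x * B) = c * (x * (22 * ((A + B) / 22)))" for c x A B :: complex
      by (simp add: distrib_left)
    show "sum_list (map eng.qval (V_terms ! i)) + sum_list (map eng.qval (Y_terms ! i)) =
        22 * (q ^ i * (\<Sum>b\<in>{1..5}. (\<zeta> ^ b - \<zeta> ^ (11 - b)) * component i b))"
      using i unfolding component_def
      by (simp add: V Y sum_distrib_left sum.distrib[symmetric] distrib_left add_divide_distrib mult_ac)
  qed
  also have "\<dots> = 22 * (\<Sum>i<11. q ^ i * (\<Sum>b\<in>{1..5}. (\<zeta> ^ b - \<zeta> ^ (11 - b)) * component i b))"
    by (rule sum_distrib_left[symmetric])
  finally have "22 * (ones_gf \<zeta> q - ones_gf (1 / \<zeta>) q) =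
      22 * (\<Sum>i<11. q ^ i * (\<Sum>b\<in>{1..5}. (\<zeta> ^ b - \<zeta> ^ (11 - b)) * component i b))" .
  then show ?thesis by (rule mult_left_cancel[THEN iffD1, rotated]) simp
qed

end

section \<open>Separation of the components\<close>

lemma M_omega_le: "M_omega r m n \<le> (\<Sum>p\<in>partitions_of n. ones p)"
  unfolding M_omega_def by (rule sum_mono2[OF finite_partitions_of]) auto

lemma M_omega_11: "M_omega 11 11 n = M_omega 0 11 n"
  by (simp add: M_omega_def cong_def)

definition M_diff :: "int \<Rightarrow> nat \<Rightarrow> complex" where
  "M_diff b n = of_nat (M_omega b 11 n) - of_nat (M_omega (11 - b) 11 n)"

lemma M_diff_reflect: "M_diff (11 - b) n = - M_diff b n"
  by (simp add: M_diff_def)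

lemma M_diff_0: "M_diff 0 n = 0"
  by (simp add: M_diff_def M_omega_11)

lemma f_comp_M_diff: "f_comp m b q = (\<Sum>n. M_diff b (11 * n + m) * q ^ n)"
  by (simp add: f_comp_def M_diff_def)

text \<open>Each \<open>M_omega\<close> is at most the total number of ones in the partitions of
  \<open>n\<close>, so the absolute series for \<open>z = 1\<close> dominates all of these at
  once.\<close>

lemma summable_norm_M_diff:
  fixes q :: complex
  assumes "norm q < 1"
  shows "summable (\<lambda>n. norm (M_diff b n * q ^ n))"
proof (rule summable_comparison_test')
  show "summable (\<lambda>n. \<Sum>p\<in>partitions_of n. norm (ones_term 1 q p))"
    using ones_gf_has_sum(2)[OF assms, of 1] by (intro summable_on_imp_summable) simp
  fix n :: nat
  have bound: "norm (of_nat x - of_nat y :: complex) \<le> real S" if "x \<le> S" "y \<le> S" for x y S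
  proof -
    have "norm (complex_of_real (real x - real y)) \<le> real S" unfolding norm_of_real using that by linarith
    then show ?thesis by simp
  qed
  have "norm (M_diff b n) \<le> real (\<Sum>p\<in>partitions_of n. ones p)"
    unfolding M_diff_def by (rule bound[OF M_omega_le M_omega_le])
  moreover have "(\<Sum>p\<in>partitions_of n. norm (ones_term 1 q p)) = real (\<Sum>p\<in>partitions_of n. ones p) * norm q ^ n"
  proof -
    have "(\<Sum>p\<in>partitions_of n. norm (ones_term 1 q p)) = (\<Sum>p\<in>partitions_of n. real (ones p) * norm q ^ n)"
      by (rule sum.cong) (simp_all add: ones_term_def partitions_of_def norm_mult norm_power)
    then show ?thesis by (simp add: sum_distrib_right)
  qed
  ultimately show "norm (norm (M_diff b n * q ^ n)) \<le> (\<Sum>p\<in>partitions_of n. norm (ones_term 1 q p))"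
    by (simp add: norm_mult norm_power mult_right_mono)
qed

lemma suminf_dissection_11:
  fixes c :: "nat \<Rightarrow> complex"
  assumes "summable (\<lambda>n. norm (c n * q ^ n))" and q: "q \<noteq> 0"
  shows "(\<Sum>n. c n * q ^ n) = (\<Sum>m<11. q ^ m * (\<Sum>n. c (11 * n + m) * (q ^ 11) ^ n))"
    and "summable (\<lambda>n. c (11 * n + m) * (q ^ 11) ^ n)"
proof -
  have S: "summable (\<lambda>n. c (11 * n + m) * q ^ (11 * n + m))" for m
  proof -
    have "inj (\<lambda>n. 11 * n + m)" by (rule injI) simp
    from summable_reindex[OF assms(1) this] show ?thesis
      by (intro summable_norm_cancel[of "\<lambda>n. c (11 * n + m) * q ^ (11 * n + m)"]) (simp add: o_def)
  qed
  have e: "c (11 * n + m) * q ^ (11 * n + m) = q ^ m * (c (11 * n + m) * (q ^ 11) ^ n)" for n m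
    by (simp add: power_add power_mult)
  have S': "summable (\<lambda>n. c (11 * n + m) * (q ^ 11) ^ n)" for m
    using S[of m] q unfolding e by (subst (asm) summable_cmult_iff) simp
  then show "summable (\<lambda>n. c (11 * n + m) * (q ^ 11) ^ n)" .
  have b: "(\<Sum>i\<in>{n * 11..<n * 11 + 11}. c i * q ^ i) = (\<Sum>m<11. c (11 * n + m) * q ^ (11 * n + m))" for n
  proof -
    have "(\<Sum>i\<in>{0 + n * 11..<11 + n * 11}. c i * q ^ i) = (\<Sum>m\<in>{0..<11}. c (m + n * 11) * q ^ (m + n * 11))"
      by (rule sum.shift_bounds_nat_ivl)
    then show ?thesis by (simp only: atLeast0LessThan add_0_left add.commute mult.commute)
  qed
  have "(\<lambda>n. c n * q ^ n) sums (\<Sum>n. c n * q ^ n)"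
    by (rule summable_sums[OF summable_norm_cancel[OF assms(1)]])
  from sums_group[OF this, of 11] have "(\<lambda>n. \<Sum>m<11. c (11 * n + m) * q ^ (11 * n + m)) sums (\<Sum>n. c n * q ^ n)"
    by (simp add: b)
  then have "(\<Sum>n. c n * q ^ n) = (\<Sum>n. \<Sum>m<11. c (11 * n + m) * q ^ (11 * n + m))"
    by (rule sums_unique)
  also have "\<dots> = (\<Sum>m<11. \<Sum>n. c (11 * n + m) * q ^ (11 * n + m))"
    by (rule suminf_sum) (rule S)
  also have "\<dots> = (\<Sum>m<11. q ^ m * (\<Sum>n. c (11 * n + m) * (q ^ 11) ^ n))"
  proof (rule sum.cong[OF refl])
    fix m
    show "(\<Sum>n. c (11 * n + m) * q ^ (11 * n + m)) = q ^ m * (\<Sum>n. c (11 * n + m) * (q ^ 11) ^ n)"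
      unfolding e by (rule suminf_mult) (rule S')
  qed
  finally show "(\<Sum>n. c n * q ^ n) = (\<Sum>m<11. q ^ m * (\<Sum>n. c (11 * n + m) * (q ^ 11) ^ n))" .
qed

lemma root_of_unity_powi:
  fixes z :: complex
  assumes "z ^ 11 = 1"
  shows "z powi c = (\<Sum>b<11. z ^ b * (if [c = int b] (mod 11) then 1 else 0))"
proof -
  have z: "z \<noteq> 0" using assms by auto
  define k where "k = nat (c mod 11)"
  have k: "k < 11" "int k = c mod 11" by (auto simp: k_def nat_less_iff)
  have "z powi c = z powi (11 * (c div 11) + c mod 11)" by simp
  also have "\<dots> = z powi (11 * (c div 11)) * z powi (c mod 11)" by (rule power_int_add) (simp add: z)
  also have "\<dots> = z powi int k" using assms by (simp add: k(2) power_int_mult)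
  also have "\<dots> = (\<Sum>b<11. if b = k then z ^ b else 0)" using k(1) by simp
  also have "\<dots> = (\<Sum>b<11. z ^ b * (if [c = int b] (mod 11) then 1 else 0))"
  proof (rule sum.cong[OF refl])
    fix b :: nat assume "b \<in> {..<11}"
    then have "[c = int b] (mod 11) \<longleftrightarrow> b = k" using k by (auto simp: cong_def)
    then show "(if b = k then z ^ b else 0) = z ^ b * (if [c = int b] (mod 11) then 1 else 0)" by simp
  qed
  finally show ?thesis .
qed

lemma sum_ones_term:
  assumes "z ^ 11 = 1"
  shows "(\<Sum>p\<in>partitions_of n. ones_term z q p) = (\<Sum>b<11. z ^ b * (of_nat (M_omega (int b) 11 n) * q ^ n))"
    and "(\<Sum>p\<in>partitions_of n. ones_term (1 / z) q p) = (\<Sum>b<11. z ^ b * (of_nat (M_omega (11 - int b) 11 n) * q ^ n))"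
proof -
  have main: "(\<Sum>p\<in>partitions_of n. ones_term x q p) = (\<Sum>b<11. z ^ b * (of_nat (M_omega (r b) 11 n) * q ^ n))"
    if "\<And>c. x powi c = (\<Sum>b<11. z ^ b * (if [c = r b] (mod 11) then 1 else 0))" for x r
  proof -
    have "(\<Sum>p\<in>partitions_of n. ones_term x q p) =
        (\<Sum>p\<in>partitions_of n. \<Sum>b<11. z ^ b * (if [crank p = r b] (mod 11) then of_nat (ones p) * q ^ n else 0))"
      by (rule sum.cong) (auto simp: ones_term_def partitions_of_def that sum_distrib_left sum_distrib_right intro!: sum.cong)
    also have "\<dots> = (\<Sum>b<11. \<Sum>p\<in>partitions_of n. z ^ b * (if [crank p = r b] (mod 11) then of_nat (ones p) * q ^ n else 0))"
      by (rule sum.swap)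
    also have "\<dots> = (\<Sum>b<11. z ^ b * (of_nat (M_omega (r b) 11 n) * q ^ n))"
    proof (rule sum.cong[OF refl])
      fix b
      have "(\<Sum>p\<in>partitions_of n. z ^ b * (if [crank p = r b] (mod 11) then of_nat (ones p) * q ^ n else 0)) =
          z ^ b * (\<Sum>p\<in>partitions_of n. if [crank p = r b] (mod 11) then of_nat (ones p) * q ^ n else 0)"
        by (rule sum_distrib_left[symmetric])
      also have "(\<Sum>p\<in>partitions_of n. if [crank p = r b] (mod 11) then of_nat (ones p) * q ^ n else 0) =
          (\<Sum>p | p \<in> partitions_of n \<and> [crank p = r b] (mod 11). of_nat (ones p) * q ^ n)"
        by (rule sum.inter_filter[symmetric]) (rule finite_partitions_of)
      finally show "(\<Sum>p\<in>partitions_of n. z ^ b * (if [crank p = r b] (mod 11) then of_nat (ones p) * q ^ n else 0)) =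
          z ^ b * (of_nat (M_omega (r b) 11 n) * q ^ n)"
        by (simp add: M_omega_def sum_distrib_right)
    qed
    finally show ?thesis .
  qed
  show "(\<Sum>p\<in>partitions_of n. ones_term z q p) = (\<Sum>b<11. z ^ b * (of_nat (M_omega (int b) 11 n) * q ^ n))"
    by (rule main) (rule root_of_unity_powi[OF assms])
  have neg: "[- c = int b] (mod 11) \<longleftrightarrow> [c = 11 - int b] (mod 11)" for c b
  proof -
    have "(11 :: int) dvd x \<longleftrightarrow> 11 dvd - x - 11" for x by presburger
    moreover have "- c - int b = - (c - (11 - int b)) - 11" by simp
    ultimately show ?thesis unfolding cong_iff_dvd_diff by metis
  qed
  show "(\<Sum>p\<in>partitions_of n. ones_term (1 / z) q p) = (\<Sum>b<11. z ^ b * (of_nat (M_omega (11 - int b) 11 n) * q ^ n))"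
  proof (rule main)
    fix c
    have "(1 / z) powi c = z powi (- c)" by (simp add: power_int_minus divide_inverse power_int_inverse)
    then show "(1 / z) powi c = (\<Sum>b<11. z ^ b * (if [c = 11 - int b] (mod 11) then 1 else 0))"
      unfolding root_of_unity_powi[OF assms] neg .
  qed
qed

text \<open>At a root of unity the power \<open>z powi crank\<close> sees the crank only modulo 11.
  The residues \<open>b\<close> and \<open>11 - b\<close> carry opposite differences and residue 0
  carries none, which leaves b = 1, ..., 5.\<close>

lemma ones_gf_difference_f_comp:
  assumes q: "norm q < 1" "q \<noteq> 0" and z: "z ^ 11 = 1"
  shows "ones_gf z q - ones_gf (1 / z) q =
    (\<Sum>m<11. q ^ m * (\<Sum>b\<in>{1..5}. (z ^ b - z ^ (11 - b)) * f_comp m (int b) (q ^ 11)))"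
proof -
  have nz: "norm z = 1"
  proof -
    have "norm z ^ 11 = 1 ^ 11" using z by (metis norm_one norm_power power_one)
    then show ?thesis by (rule power_eq_imp_eq_base) simp_all
  qed
  note S = summable_norm_M_diff[OF q(1)]
  have "(\<lambda>n. (\<Sum>p\<in>partitions_of n. ones_term z q p) - (\<Sum>p\<in>partitions_of n. ones_term (1 / z) q p)) sums
      (ones_gf z q - ones_gf (1 / z) q)"
    using nz by (intro sums_diff has_sum_imp_sums ones_gf_has_sum q) (simp_all add: norm_divide)
  moreover have "(\<Sum>p\<in>partitions_of n. ones_term z q p) - (\<Sum>p\<in>partitions_of n. ones_term (1 / z) q p) =
      (\<Sum>b<11. z ^ b * (M_diff (int b) n * q ^ n))" for n
    unfolding sum_ones_term[OF z] sum_subtractf[symmetric] by (simp add: M_diff_def algebra_simps)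
  ultimately have "(\<lambda>n. \<Sum>b<11. z ^ b * (M_diff (int b) n * q ^ n)) sums (ones_gf z q - ones_gf (1 / z) q)" by simp
  moreover have "(\<lambda>n. \<Sum>b<11. z ^ b * (M_diff (int b) n * q ^ n)) sums (\<Sum>b<11. z ^ b * (\<Sum>n. M_diff (int b) n * q ^ n))"
    by (intro sums_sum sums_mult summable_sums summable_norm_cancel[OF S])
  ultimately have "ones_gf z q - ones_gf (1 / z) q = (\<Sum>b<11. z ^ b * (\<Sum>n. M_diff (int b) n * q ^ n))"
    by (rule sums_unique2)
  also have "\<dots> = (\<Sum>b<11. z ^ b * (\<Sum>m<11. q ^ m * f_comp m (int b) (q ^ 11)))"
    unfolding suminf_dissection_11(1)[OF S q(2)] f_comp_M_diff by (rule refl)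
  also have "\<dots> = (\<Sum>m<11. q ^ m * (\<Sum>b<11. z ^ b * f_comp m (int b) (q ^ 11)))"
    unfolding sum_distrib_left by (subst sum.swap) (simp add: mult.left_commute)
  finally have outer: "ones_gf z q - ones_gf (1 / z) q = (\<Sum>m<11. q ^ m * (\<Sum>b<11. z ^ b * f_comp m (int b) (q ^ 11)))" .
  have inner: "(\<Sum>b<11. z ^ b * f_comp m (int b) (q ^ 11)) =
      (\<Sum>b\<in>{1..5}. (z ^ b - z ^ (11 - b)) * f_comp m (int b) (q ^ 11))" for m
  proof -
    define F where "F b = f_comp m b (q ^ 11)" for b
    have reflect: "F (11 - b) = - F b" for b
      unfolding F_def f_comp_M_diff M_diff_reflect
      using suminf_minus[OF suminf_dissection_11(2)[OF S q(2)]] by simp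
    have F: "F 0 = 0" "F 6 = - F 5" "F 7 = - F 4" "F 8 = - F 3" "F 9 = - F 2" "F 10 = - F 1"
    proof -
      show "F 0 = 0" unfolding F_def f_comp_M_diff M_diff_0 by simp
      show "F 6 = - F 5" "F 7 = - F 4" "F 8 = - F 3" "F 9 = - F 2" "F 10 = - F 1"
        using reflect[of 5] reflect[of 4] reflect[of 3] reflect[of 2] reflect[of 1] by simp_all
    qed
    have s: "{1..5 :: nat} = {1, 2, 3, 4, 5}" by auto
    show ?thesis unfolding sum_lessThan_11 s F_def[symmetric]
      by (simp add: F algebra_simps)
  qed
  show ?thesis unfolding outer inner by (rule refl)
qed

text \<open>A polynomial of degree at most 10 with eleven distinct zeros vanishes
  identically.\<close>

lemma coefficients_zero_of_roots_of_unity: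
  fixes a :: "nat \<Rightarrow> complex"
  assumes "\<And>z. z ^ 11 = 1 \<Longrightarrow> (\<Sum>k<11. a k * z ^ k) = 0" and "k < 11"
  shows "a k = 0"
proof (rule ccontr)
  assume "a k \<noteq> 0"
  moreover have "k \<le> 10" using assms(2) by simp
  ultimately have r: "finite {z. (\<Sum>i\<le>10. a i * z ^ i) = 0}" "card {z. (\<Sum>i\<le>10. a i * z ^ i) = 0} \<le> 10"
    using polyfun_rootbound by blast+
  have i: "{..10 :: nat} = {..<11}" by auto
  have "{z. z ^ 11 = 1} \<subseteq> {z. (\<Sum>i\<le>10. a i * z ^ i) = 0}"
  proof
    fix z :: complex assume "z \<in> {z. z ^ 11 = 1}"
    then have "z ^ 11 = 1" unfolding mem_Collect_eq .
    from assms(1)[OF this] show "z \<in> {z. (\<Sum>i\<le>10. a i * z ^ i) = 0}" unfolding mem_Collect_eq i .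
  qed
  from le_trans[OF card_mono[OF r(1) this] r(2)] have "card {z :: complex. z ^ 11 = 1} \<le> 10" .
  moreover have "card {z :: complex. z ^ 11 = 1} = 11" using card_roots_unity_eq[of 11] by (simp only: zero_less_numeral)
  ultimately show False by linarith
qed

text \<open>Replacing \<open>q\<close> by \<open>w * q\<close> with \<open>w ^ 11 = 1\<close> leaves
  \<open>Q\<close>, and hence all components, unchanged. The relation is thus a polynomial in
  \<open>w\<close> whose coefficients separate \<open>m\<close>; the same argument in
  \<open>z\<close> then separates \<open>b\<close>.\<close>

theorem f_comp_eq_component:
  assumes Q: "Q \<noteq> 0" "norm Q < 1" and m: "m < 11" and b: "1 \<le> b" "b \<le> 5"
  shows "f_comp m (int b) Q = theta_eleven.component Q m b"
proof -
  obtain q where q: "q ^ 11 = Q"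
  proof -
    have "exp (ln Q / 11) ^ 11 = exp (of_nat 11 * (ln Q / 11))" by (rule exp_of_nat_mult[symmetric])
    also have "\<dots> = Q" using Q(1) by simp
    finally have "exp (ln Q / 11) ^ 11 = Q" .
    then show ?thesis by (rule that)
  qed
  have q0: "q \<noteq> 0" using q Q(1) by auto
  have q1: "norm q < 1"
  proof (rule ccontr)
    assume "\<not> norm q < 1"
    then have "1 \<le> norm q ^ 11" by (intro one_le_power) simp
    then show False using q Q(2) by (simp flip: norm_power)
  qed
  define g where "g m b = f_comp m (int b) Q - theta_eleven.component Q m b" for m b
  define H where "H z m = (\<Sum>b\<in>{1..5}. (z ^ b - z ^ (11 - b)) * g m b)" for z m
  have rel: "(\<Sum>m<11. (w * q) ^ m * H z m) = 0" if w: "w ^ 11 = 1" and z: "z ^ 11 = 1" for w z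
  proof (cases "z = 1")
    \<comment> \<open>The value \<open>z = 1\<close> is excluded from \<open>root_eleven\<close>,
      but there every factor \<open>z ^ b - z ^ (11 - b)\<close> is 0.\<close>
    case True
    then show ?thesis by (simp add: H_def)
  next
    case False
    have w1: "w \<noteq> 0" "norm w = 1"
    proof -
      show "w \<noteq> 0" using w by auto
      have "norm w ^ 11 = 1 ^ 11" using w by (metis norm_one norm_power power_one)
      then show "norm w = 1" by (rule power_eq_imp_eq_base) simp_all
    qed
    have wq: "(w * q) ^ 11 = Q" using w q by (simp add: power_mult_distrib)
    have wq1: "norm (w * q) < 1" "w * q \<noteq> 0" using w1 q0 q1 by (simp_all add: norm_mult)
    have "theta_eleven ((w * q) ^ 11)" unfolding wq using Q by unfold_locales
    then have "root_eleven (w * q) z"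
      unfolding root_eleven_def root_eleven_axioms_def using wq1 z False by blast
    from root_eleven.ones_gf_dissection[OF this] ones_gf_difference_f_comp[OF wq1 z]
    have "(\<Sum>m<11. (w * q) ^ m * (\<Sum>b\<in>{1..5}. (z ^ b - z ^ (11 - b)) * f_comp m (int b) Q)) =
        (\<Sum>m<11. (w * q) ^ m * (\<Sum>b\<in>{1..5}. (z ^ b - z ^ (11 - b)) * theta_eleven.component Q m b))"
      unfolding wq by simp
    then show ?thesis
      unfolding H_def g_def right_diff_distrib sum_subtractf by simp
  qed
  have H: "H z m = 0" if "z ^ 11 = 1" for z
  proof -
    define A where "A k = q ^ k * H z k" for k
    have "A m = 0"
    proof (rule coefficients_zero_of_roots_of_unity[of A m])
      fix w :: complex assume "w ^ 11 = 1"
      have "(\<Sum>k<11. A k * w ^ k) = (\<Sum>k<11. (w * q) ^ k * H z k)"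
        unfolding A_def by (simp only: power_mult_distrib mult_ac)
      then show "(\<Sum>k<11. A k * w ^ k) = 0" using rel[OF \<open>w ^ 11 = 1\<close> that] by (rule trans)
    qed (rule m)
    then show ?thesis using q0 by (simp add: A_def)
  qed
  \<comment> \<open>The coefficients of \<open>H z m\<close> as a polynomial in \<open>z\<close>: no
    constant term, and antisymmetric under \<open>k -> 11 - k\<close>.\<close>
  define a where "a k = (if k = 0 then 0 else if k \<le> 5 then g m k else - g m (11 - k))" for k :: nat
  have "a b = 0"
  proof (rule coefficients_zero_of_roots_of_unity[of a b])
    fix z :: complex assume "z ^ 11 = 1"
    have s: "{1..5 :: nat} = {1, 2, 3, 4, 5}" by auto
    have "(\<Sum>k<11. a k * z ^ k) = H z m"
      unfolding sum_lessThan_11 H_def s by (simp add: a_def algebra_simps)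
    then show "(\<Sum>k<11. a k * z ^ k) = 0" using H[OF \<open>z ^ 11 = 1\<close>] by simp
  qed (use b in simp)
  then show ?thesis using b by (simp add: a_def g_def)
qed

section \<open>Translation to the functions of the statement\<close>

context theta_eleven
begin

lemma theta_J_values:
  "theta_J 1 11 Q = J 1" "theta_J 2 11 Q = J 2" "theta_J 3 11 Q = J 3" "theta_J 4 11 Q = J 4" "theta_J 5 11 Q = J 5"
  by (rule theta_J_eq; simp)+

lemma t_fun_eq: "t_fun Q = t" and T_fun_eq: "T_fun Q = T"
  by (simp_all only: t_fun_def t_def T_fun_def T_def theta_J_values)

lemma mono_mult_t_square: "mono [a, b, c, d, e, f, g] * t\<^sup>2 = mono [a, b, c, d + 2, e, f, g]"
  using t_T_nonzero by (simp add: mono_eq power_int_add)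

text \<open>The factor \<open>t^2\<close> undoes the scaling of \<open>V_data\<close>.\<close>

lemma V_eq_mono:
  "V0 Q = mono [5, - 2, - 25, 3, - 4, 5, - 4] * t\<^sup>2"
  "V1 Q = mono [5, - 2, - 24, 2, - 4, 4, - 4] * t\<^sup>2"
  "V2 Q = mono [5, - 2, - 23, 3, - 3, 4, - 4] * t\<^sup>2"
  "V3 Q = mono [5, - 2, - 22, 3, - 3, 4, - 4] * t\<^sup>2"
  "V4 Q = mono [5, - 2, - 21, 3, - 3, 3, - 4] * t\<^sup>2"
  "V5 Q = mono [5, - 2, - 20, 2, - 2, 3, - 4] * t\<^sup>2"
  "V6 Q = mono [5, - 2, - 19, 2, - 2, 3, - 4] * t\<^sup>2"
  "V7 Q = mono [5, - 2, - 18, 2, - 2, 3, - 4] * t\<^sup>2"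
  "V8 Q = mono [5, - 2, - 17, 1, - 3, 3, - 2] * t\<^sup>2"
  "V9 Q = mono [5, - 2, - 16, 1, - 3, 3, - 3] * t\<^sup>2"
  "V10 Q = mono [5, - 2, - 15, 0, - 3, 3, - 2] * t\<^sup>2"
  unfolding mono_mult_t_square V0_def V1_def V2_def V3_def V4_def V5_def V6_def V7_def V8_def V9_def V10_def theta_J_values eta_J_eq mono_J
  by (simp_all add: mono_arith mono_mult_Q Qvec_def)

lemma Y_eq_mono:
  "Y0 Q = mono [2, - 1, - 10, 2, - 1, 2, - 2]"
  "Y1 Q = mono [2, - 1, - 9, 1, - 2, 2, - 1]"
  "Y2 Q = mono [2, - 1, - 8, 2, 0, 1, - 2]"
  "Y3 Q = mono [2, - 1, - 7, 1, - 1, 2, - 1]"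
  "Y4 Q = mono [2, - 1, - 6, 1, - 1, 1, - 1]"
  "Y5 Q = mono [2, - 1, - 5, 1, - 1, 1, - 1]"
  "Y7 Q = mono [2, - 1, - 3, 0, - 1, 1, 0]"
  "Y8 Q = mono [2, - 1, - 2, 1, 0, 0, 0]"
  "Y9 Q = mono [2, - 1, - 1, 0, 0, 0, 0]"
  "Y10 Q = mono [2, - 1, 0, 0, 0, 0, 0]"
  unfolding Y0_def Y1_def Y2_def Y3_def Y4_def Y5_def Y7_def Y8_def Y9_def Y10_def theta_J_values eta_J_eq mono_J
  by (simp_all add: mono_arith mono_mult_Q Qvec_def)

text \<open>Division by \<open>t\<close> or \<open>t^2\<close> is the only one in the statement that
  involves functions. With \<open>V\<close> in the form \<open>X * t^2\<close> it disappears, and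
  polynomial expressions in \<open>t\<close> and \<open>T\<close> remain.\<close>

lemma cancel_t:
  "c * (X * t\<^sup>2) / t = c * X * t" "c * (X * t\<^sup>2) * T / t = c * X * T * t"
  "c * (X * t\<^sup>2) / t\<^sup>2 = c * X" "c * (X * t\<^sup>2) * T / t\<^sup>2 = c * X * T"
  using t_T_nonzero(1) by (simp_all add: power2_eq_square)

lemma V_data_nth:
  "V_data ! 0 = ([5, - 2, - 25, 3, - 4, 5, - 4], [([0, - 9, - 61, - 95], [0, 0, - 49, 96, - 95]), ([0, - 7, 87, - 47], [0, 0, - 65, - 6, - 47]), ([0, - 5, - 249, 1], [0, 0, 161, - 108, 1]), ([0, - 3, 141, 49], [0, 0, - 97, 32, 49]), ([0, - 1, 47, 97], [0, 0, - 113, - 70, 97])])"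
  "V_data ! 1 = ([5, - 2, - 24, 2, - 4, 4, - 4], [([0, 0, - 92, - 84, 8], [0, 0, 72, - 142, - 290, - 66]), ([0, 0, - 8, - 223, - 215], [0, 0, 1, 156, 80, - 132]), ([0, 0, 98, 221, 123], [0, 0, - 103, - 96, - 12, 44]), ([0, 0, - 38, - 61, - 23], [0, 0, 35, - 106, - 104, - 22]), ([0, 0, - 174, - 101, 73], [0, 0, 173, 126, 46, 154])])"
  "V_data ! 2 = ([5, - 2, - 23, 3, - 3, 4, - 4], [([0, 4, - 34, 30], [0, 0, 78, - 116, 8]), ([0, - 47, - 145, - 171], [0, 0, - 9, 32, 27]), ([0, - 10, - 36, 46], [0, 0, - 74, 48, - 20]), ([0, - 6, 172, 76], [0, 0, 4, - 68, - 12]), ([0, - 2, - 346, - 136], [0, 0, 82, 58, - 4])])"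
  "V_data ! 3 = ([5, - 2, - 22, 3, - 3, 4, - 4], [([0, 10, - 153, - 53], [0, - 15, 146, 120]), ([0, - 2, 79, 59], [0, 3, - 126, - 24]), ([0, - 102, 36, - 16], [0, 32, - 134, - 14]), ([0, 18, - 227, - 47], [0, - 27, 166, - 26]), ([0, 6, 247, 65], [0, - 9, - 106, - 170])])"
  "V_data ! 4 = ([5, - 2, - 21, 3, - 3, 3, - 4], [([0, 244, 405, 161], [0, - 245, - 270, - 20]), ([0, - 150, - 246, - 96], [0, 104, 164, 48]), ([0, 6, 5, - 1], [0, - 9, - 84, - 60]), ([0, - 58, - 8, 50], [0, - 34, - 156, - 146]), ([0, 10, - 153, - 163], [0, - 15, 102, 142])])"
  "V_data ! 5 = ([5, - 2, - 20, 2, - 2, 3, - 4], [([0, 0, - 30, 206, 198, 32], [0, 0, 0, - 154, - 182, - 32]), ([0, 0, - 5, - 369, - 330, - 35], [0, 0, 0, 176, 252, 35]), ([0, 0, - 68, 112, 110, 8], [0, 0, 0, 22, - 106, - 8]), ([0, 0, 1, - 23, 66, 7], [0, 0, 0, - 132, - 2, - 7]), ([0, 0, - 106, 18, 22, - 16], [0, 0, 0, - 44, - 30, 16])])"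
  "V_data ! 6 = ([5, - 2, - 19, 2, - 2, 3, - 4], [([0, 0, - 220, - 418, - 132], [0, 0, 198, 132, 132]), ([0, 0, 44, 374, 220], [0, 0, - 88, - 220, - 220]), ([0, 0, 66, - 286, - 154], [0, 0, - 132, 154, 154]), ([0, 0, - 154, 22, - 44], [0, 0, 66, 44, 44]), ([0, 0, 110, 88, 66], [0, 0, 22, - 66, - 66])])"
  "V_data ! 7 = ([5, - 2, - 18, 2, - 2, 3, - 4], [([0, 141, 112, 197, 21], [0, - 141, - 18, - 176, - 21]), ([0, - 92, - 128, - 156, - 24], [0, 92, - 14, 132, 24]), ([0, - 50, - 38, 52, 8], [0, 50, - 76, - 44, - 8]), ([0, 47, 118, - 15, 7], [0, - 47, - 6, 22, - 7]), ([0, 100, - 166, - 104, - 16], [0, - 100, 152, 88, 16])])"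
  "V_data ! 8 = ([5, - 2, - 17, 1, - 3, 3, - 2], [([0, - 44, - 21, 107, 79], [0, 0, 0, - 107, 4, 79]), ([0, - 88, - 240, - 160, 4], [0, 0, 0, - 82, - 58, 4]), ([0, 110, 179, 79, - 5], [0, 0, 0, 163, 12, - 5]), ([0, - 176, - 95, - 23, - 69], [0, 0, 0, - 219, - 28, - 69]), ([0, 22, - 248, - 246, - 12], [0, 0, 0, 4, - 68, - 12])])"
  "V_data ! 9 = ([5, - 2, - 16, 1, - 3, 3, - 3], [([15, 8, - 10], [- 15, 7, - 58, - 1]), ([- 3, - 50, 2], [3, 47, 60, 97]), ([- 21, 134, 14], [21, - 155, - 64, - 47]), ([16, - 56, 70], [- 16, 72, - 78, - 114]), ([9, - 92, - 248], [- 9, 101, 62, - 49])])"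
  "V_data ! 10 = ([5, - 2, - 15, 0, - 3, 3, - 2], [([0, 0, 150, 78, - 8], [0, 0, 0, 32, 28, - 8]), ([0, 0, - 184, - 86, - 16], [0, 0, 0, 64, 56, - 16]), ([0, 0, 43, 3, 9], [0, 0, 0, - 157, - 92, 9]), ([0, 0, - 104, 4, 12], [0, 0, 0, - 48, - 42, 12]), ([0, 0, 46, - 160, 4], [0, 0, 0, 226, - 14, 4])])"
  by (simp_all add: V_data_def)

lemma Y_data_nth:
  "Y_data ! 0 = ([2, - 1, - 10, 2, - 1, 2, - 2], [([9], []), ([7], []), ([5], []), ([3], []), ([1], [])])"
  "Y_data ! 1 = ([2, - 1, - 9, 1, - 2, 2, - 1], [([- 2], []), ([7], []), ([5], []), ([3], []), ([1], [])])"
  "Y_data ! 2 = ([2, - 1, - 8, 2, 0, 1, - 2], [([- 4], []), ([3], []), ([10], []), ([6], []), ([2], [])])"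
  "Y_data ! 3 = ([2, - 1, - 7, 1, - 1, 2, - 1], [([5], []), ([- 1], []), ([4], []), ([9], []), ([3], [])])"
  "Y_data ! 4 = ([2, - 1, - 6, 1, - 1, 1, - 1], [([1], []), ([2], []), ([3], []), ([4], []), ([5], [])])"
  "Y_data ! 5 = ([2, - 1, - 5, 1, - 1, 1, - 1], [([8], []), ([5], []), ([2], []), ([- 1], []), ([- 4], [])])"
  "Y_data ! 6 = ([0, 0, 0, 0, 0, 0, 0], [([], []), ([], []), ([], []), ([], []), ([], [])])"
  "Y_data ! 7 = ([2, - 1, - 3, 0, - 1, 1, 0], [([3], []), ([6], []), ([- 2], []), ([1], []), ([4], [])])"
  "Y_data ! 8 = ([2, - 1, - 2, 1, 0, 0, 0], [([- 1], []), ([- 2], []), ([- 3], []), ([7], []), ([6], [])])"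
  "Y_data ! 9 = ([2, - 1, - 1, 0, 0, 0, 0], [([- 5], []), ([1], []), ([7], []), ([2], []), ([- 3], [])])"
  "Y_data ! 10 = ([2, - 1, 0, 0, 0, 0, 0], [([4], []), ([8], []), ([1], []), ([- 6], []), ([- 2], [])])"
  by (simp_all add: Y_data_def)

lemma f_comp_values:
  assumes "m < 11"
  shows
    "f_comp m 1 Q = (mono (fst (V_data ! m)) * ppval t T (snd (V_data ! m) ! 0) +
      mono (fst (Y_data ! m)) * ppval t T (snd (Y_data ! m) ! 0)) / 22"
    "f_comp m 2 Q = (mono (fst (V_data ! m)) * ppval t T (snd (V_data ! m) ! 1) +
      mono (fst (Y_data ! m)) * ppval t T (snd (Y_data ! m) ! 1)) / 22"
    "f_comp m 3 Q = (mono (fst (V_data ! m)) * ppval t T (snd (V_data ! m) ! 2) +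
      mono (fst (Y_data ! m)) * ppval t T (snd (Y_data ! m) ! 2)) / 22"
    "f_comp m 4 Q = (mono (fst (V_data ! m)) * ppval t T (snd (V_data ! m) ! 3) +
      mono (fst (Y_data ! m)) * ppval t T (snd (Y_data ! m) ! 3)) / 22"
    "f_comp m 5 Q = (mono (fst (V_data ! m)) * ppval t T (snd (V_data ! m) ! 4) +
      mono (fst (Y_data ! m)) * ppval t T (snd (Y_data ! m) ! 4)) / 22"
  using f_comp_eq_component[OF Q assms, of 1] f_comp_eq_component[OF Q assms, of 2] f_comp_eq_component[OF Q assms, of 3]
    f_comp_eq_component[OF Q assms, of 4] f_comp_eq_component[OF Q assms, of 5]
  by (simp_all add: component_def)

lemma residues_less_11: "(0 :: nat) < 11" "(1 :: nat) < 11" "(2 :: nat) < 11" "(3 :: nat) < 11" "(4 :: nat) < 11" "(5 :: nat) < 11" "(6 :: nat) < 11" "(7 :: nat) < 11" "(8 :: nat) < 11" "(9 :: nat) < 11" "(10 :: nat) < 11"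
  by simp_all

lemmas f_comp_explicit = f_comp_values[OF residues_less_11(1), unfolded V_data_nth Y_data_nth fst_conv snd_conv]
  f_comp_values[OF residues_less_11(2), unfolded V_data_nth Y_data_nth fst_conv snd_conv]
  f_comp_values[OF residues_less_11(3), unfolded V_data_nth Y_data_nth fst_conv snd_conv]
  f_comp_values[OF residues_less_11(4), unfolded V_data_nth Y_data_nth fst_conv snd_conv]
  f_comp_values[OF residues_less_11(5), unfolded V_data_nth Y_data_nth fst_conv snd_conv]
  f_comp_values[OF residues_less_11(6), unfolded V_data_nth Y_data_nth fst_conv snd_conv]
  f_comp_values[OF residues_less_11(7), unfolded V_data_nth Y_data_nth fst_conv snd_conv]
  f_comp_values[OF residues_less_11(8), unfolded V_data_nth Y_data_nth fst_conv snd_conv]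
  f_comp_values[OF residues_less_11(9), unfolded V_data_nth Y_data_nth fst_conv snd_conv]
  f_comp_values[OF residues_less_11(10), unfolded V_data_nth Y_data_nth fst_conv snd_conv]
  f_comp_values[OF residues_less_11(11), unfolded V_data_nth Y_data_nth fst_conv snd_conv]

end

theorem mainTheorem3:
  fixes q :: complex
  assumes "0 < norm q" and "norm q < 1"
  shows "
    f_comp 0 1 q =
          - 9/22 * V0 q / t_fun q - 61/22 * V0 q - 95/22 * V0 q * t_fun q
          - 49/22 * V0 q * T_fun q + 48/11 * V0 q * T_fun q * t_fun q
          - 95/22 * V0 q * T_fun q * t_fun q ^ 2 + 9/22 * Y0 q \<and>
    f_comp 0 2 q =
          - 7/22 * V0 q / t_fun q + 87/22 * V0 q - 47/22 * V0 q * t_fun q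
          - 65/22 * V0 q * T_fun q - 3/11 * V0 q * T_fun q * t_fun q
          - 47/22 * V0 q * T_fun q * t_fun q ^ 2 + 7/22 * Y0 q \<and>
    f_comp 0 3 q =
          - 5/22 * V0 q / t_fun q - 249/22 * V0 q + 1/22 * V0 q * t_fun q
          + 161/22 * V0 q * T_fun q - 54/11 * V0 q * T_fun q * t_fun q
          + 1/22 * V0 q * T_fun q * t_fun q ^ 2 + 5/22 * Y0 q \<and>
    f_comp 0 4 q =
          - 3/22 * V0 q / t_fun q + 141/22 * V0 q + 49/22 * V0 q * t_fun q
          - 97/22 * V0 q * T_fun q + 16/11 * V0 q * T_fun q * t_fun q
          + 49/22 * V0 q * T_fun q * t_fun q ^ 2 + 3/22 * Y0 q \<and>
    f_comp 0 5 q =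
          - 1/22 * V0 q / t_fun q + 47/22 * V0 q + 97/22 * V0 q * t_fun q
          - 113/22 * V0 q * T_fun q - 35/11 * V0 q * T_fun q * t_fun q
          + 97/22 * V0 q * T_fun q * t_fun q ^ 2 + 1/22 * Y0 q \<and>
    f_comp 1 1 q =
          - 46/11 * V1 q - 42/11 * V1 q * t_fun q + 4/11 * V1 q * t_fun q ^ 2
          + 36/11 * V1 q * T_fun q - 71/11 * V1 q * T_fun q * t_fun q
          - 145/11 * V1 q * T_fun q * t_fun q ^ 2 - 3 * V1 q * T_fun q * t_fun q ^ 3
          - 1/11 * Y1 q \<and>
    f_comp 1 2 q =
          - 4/11 * V1 q - 223/22 * V1 q * t_fun q - 215/22 * V1 q * t_fun q ^ 2
          + 1/22 * V1 q * T_fun q + 78/11 * V1 q * T_fun q * t_fun q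
          + 40/11 * V1 q * T_fun q * t_fun q ^ 2 - 6 * V1 q * T_fun q * t_fun q ^ 3
          + 7/22 * Y1 q \<and>
    f_comp 1 3 q =
          49/11 * V1 q + 221/22 * V1 q * t_fun q + 123/22 * V1 q * t_fun q ^ 2
          - 103/22 * V1 q * T_fun q - 48/11 * V1 q * T_fun q * t_fun q
          - 6/11 * V1 q * T_fun q * t_fun q ^ 2 + 2 * V1 q * T_fun q * t_fun q ^ 3
          + 5/22 * Y1 q \<and>
    f_comp 1 4 q =
          - 19/11 * V1 q - 61/22 * V1 q * t_fun q - 23/22 * V1 q * t_fun q ^ 2
          + 35/22 * V1 q * T_fun q - 53/11 * V1 q * T_fun q * t_fun q
          - 52/11 * V1 q * T_fun q * t_fun q ^ 2 - V1 q * T_fun q * t_fun q ^ 3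
          + 3/22 * Y1 q \<and>
    f_comp 1 5 q =
          - 87/11 * V1 q - 101/22 * V1 q * t_fun q + 73/22 * V1 q * t_fun q ^ 2
          + 173/22 * V1 q * T_fun q + 63/11 * V1 q * T_fun q * t_fun q
          + 23/11 * V1 q * T_fun q * t_fun q ^ 2 + 7 * V1 q * T_fun q * t_fun q ^ 3
          + 1/22 * Y1 q \<and>
    f_comp 2 1 q =
          2/11 * V2 q / t_fun q - 17/11 * V2 q + 15/11 * V2 q * t_fun q
          + 39/11 * V2 q * T_fun q - 58/11 * V2 q * T_fun q * t_fun q
          + 4/11 * V2 q * T_fun q * t_fun q ^ 2 - 2/11 * Y2 q \<and>
    f_comp 2 2 q =
          - 47/22 * V2 q / t_fun q - 145/22 * V2 q - 171/22 * V2 q * t_fun q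
          - 9/22 * V2 q * T_fun q + 16/11 * V2 q * T_fun q * t_fun q
          + 27/22 * V2 q * T_fun q * t_fun q ^ 2 + 3/22 * Y2 q \<and>
    f_comp 2 3 q =
          - 5/11 * V2 q / t_fun q - 18/11 * V2 q + 23/11 * V2 q * t_fun q
          - 37/11 * V2 q * T_fun q + 24/11 * V2 q * T_fun q * t_fun q
          - 10/11 * V2 q * T_fun q * t_fun q ^ 2 + 5/11 * Y2 q \<and>
    f_comp 2 4 q =
          - 3/11 * V2 q / t_fun q + 86/11 * V2 q + 38/11 * V2 q * t_fun q
          + 2/11 * V2 q * T_fun q - 34/11 * V2 q * T_fun q * t_fun q
          - 6/11 * V2 q * T_fun q * t_fun q ^ 2 + 3/11 * Y2 q \<and>
    f_comp 2 5 q =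
          - 1/11 * V2 q / t_fun q - 173/11 * V2 q - 68/11 * V2 q * t_fun q
          + 41/11 * V2 q * T_fun q + 29/11 * V2 q * T_fun q * t_fun q
          - 2/11 * V2 q * T_fun q * t_fun q ^ 2 + 1/11 * Y2 q \<and>
    f_comp 3 1 q =
          5/11 * V3 q / t_fun q - 153/22 * V3 q - 53/22 * V3 q * t_fun q
          - 15/22 * V3 q * T_fun q / t_fun q + 73/11 * V3 q * T_fun q
          + 60/11 * V3 q * T_fun q * t_fun q + 5/22 * Y3 q \<and>
    f_comp 3 2 q =
          - 1/11 * V3 q / t_fun q + 79/22 * V3 q + 59/22 * V3 q * t_fun q
          + 3/22 * V3 q * T_fun q / t_fun q - 63/11 * V3 q * T_fun q
          - 12/11 * V3 q * T_fun q * t_fun q - 1/22 * Y3 q \<and>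
    f_comp 3 3 q =
          - 51/11 * V3 q / t_fun q + 18/11 * V3 q - 8/11 * V3 q * t_fun q
          + 16/11 * V3 q * T_fun q / t_fun q - 67/11 * V3 q * T_fun q
          - 7/11 * V3 q * T_fun q * t_fun q + 2/11 * Y3 q \<and>
    f_comp 3 4 q =
          9/11 * V3 q / t_fun q - 227/22 * V3 q - 47/22 * V3 q * t_fun q
          - 27/22 * V3 q * T_fun q / t_fun q + 83/11 * V3 q * T_fun q
          - 13/11 * V3 q * T_fun q * t_fun q + 9/22 * Y3 q \<and>
    f_comp 3 5 q =
          3/11 * V3 q / t_fun q + 247/22 * V3 q + 65/22 * V3 q * t_fun q
          - 9/22 * V3 q * T_fun q / t_fun q - 53/11 * V3 q * T_fun q
          - 85/11 * V3 q * T_fun q * t_fun q + 3/22 * Y3 q \<and>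
    f_comp 4 1 q =
          122/11 * V4 q / t_fun q + 405/22 * V4 q + 161/22 * V4 q * t_fun q
          - 245/22 * V4 q * T_fun q / t_fun q - 135/11 * V4 q * T_fun q
          - 10/11 * V4 q * T_fun q * t_fun q + 1/22 * Y4 q \<and>
    f_comp 4 2 q =
          - 75/11 * V4 q / t_fun q - 123/11 * V4 q - 48/11 * V4 q * t_fun q
          + 52/11 * V4 q * T_fun q / t_fun q + 82/11 * V4 q * T_fun q
          + 24/11 * V4 q * T_fun q * t_fun q + 1/11 * Y4 q \<and>
    f_comp 4 3 q =
          3/11 * V4 q / t_fun q + 5/22 * V4 q - 1/22 * V4 q * t_fun q
          - 9/22 * V4 q * T_fun q / t_fun q - 42/11 * V4 q * T_fun q
          - 30/11 * V4 q * T_fun q * t_fun q + 3/22 * Y4 q \<and>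
    f_comp 4 4 q =
          - 29/11 * V4 q / t_fun q - 4/11 * V4 q + 25/11 * V4 q * t_fun q
          - 17/11 * V4 q * T_fun q / t_fun q - 78/11 * V4 q * T_fun q
          - 73/11 * V4 q * T_fun q * t_fun q + 2/11 * Y4 q \<and>
    f_comp 4 5 q =
          5/11 * V4 q / t_fun q - 153/22 * V4 q - 163/22 * V4 q * t_fun q
          - 15/22 * V4 q * T_fun q / t_fun q + 51/11 * V4 q * T_fun q
          + 71/11 * V4 q * T_fun q * t_fun q + 5/22 * Y4 q \<and>
    f_comp 5 1 q =
          - 15/11 * V5 q + 103/11 * V5 q * t_fun q + 9 * V5 q * t_fun q ^ 2
          + 16/11 * V5 q * t_fun q ^ 3 - 7 * V5 q * T_fun q * t_fun q
          - 91/11 * V5 q * T_fun q * t_fun q ^ 2 - 16/11 * V5 q * T_fun q * t_fun q ^ 3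
          + 4/11 * Y5 q \<and>
    f_comp 5 2 q =
          - 5/22 * V5 q - 369/22 * V5 q * t_fun q - 15 * V5 q * t_fun q ^ 2
          - 35/22 * V5 q * t_fun q ^ 3 + 8 * V5 q * T_fun q * t_fun q
          + 126/11 * V5 q * T_fun q * t_fun q ^ 2 + 35/22 * V5 q * T_fun q * t_fun q ^ 3
          + 5/22 * Y5 q \<and>
    f_comp 5 3 q =
          - 34/11 * V5 q + 56/11 * V5 q * t_fun q + 5 * V5 q * t_fun q ^ 2
          + 4/11 * V5 q * t_fun q ^ 3 + V5 q * T_fun q * t_fun q
          - 53/11 * V5 q * T_fun q * t_fun q ^ 2 - 4/11 * V5 q * T_fun q * t_fun q ^ 3
          + 1/11 * Y5 q \<and>
    f_comp 5 4 q =
          1/22 * V5 q - 23/22 * V5 q * t_fun q + 3 * V5 q * t_fun q ^ 2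
          + 7/22 * V5 q * t_fun q ^ 3 - 6 * V5 q * T_fun q * t_fun q
          - 1/11 * V5 q * T_fun q * t_fun q ^ 2 - 7/22 * V5 q * T_fun q * t_fun q ^ 3
          - 1/22 * Y5 q \<and>
    f_comp 5 5 q =
          - 53/11 * V5 q + 9/11 * V5 q * t_fun q + V5 q * t_fun q ^ 2
          - 8/11 * V5 q * t_fun q ^ 3 - 2 * V5 q * T_fun q * t_fun q
          - 15/11 * V5 q * T_fun q * t_fun q ^ 2 + 8/11 * V5 q * T_fun q * t_fun q ^ 3
          - 2/11 * Y5 q \<and>
    f_comp 6 1 q =
          - 10 * V6 q - 19 * V6 q * t_fun q - 6 * V6 q * t_fun q ^ 2 + 9 * V6 q * T_fun q
          + 6 * V6 q * T_fun q * t_fun q + 6 * V6 q * T_fun q * t_fun q ^ 2 \<and>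
    f_comp 6 2 q =
          2 * V6 q + 17 * V6 q * t_fun q + 10 * V6 q * t_fun q ^ 2 - 4 * V6 q * T_fun q
          - 10 * V6 q * T_fun q * t_fun q - 10 * V6 q * T_fun q * t_fun q ^ 2 \<and>
    f_comp 6 3 q =
          3 * V6 q - 13 * V6 q * t_fun q - 7 * V6 q * t_fun q ^ 2 - 6 * V6 q * T_fun q
          + 7 * V6 q * T_fun q * t_fun q + 7 * V6 q * T_fun q * t_fun q ^ 2 \<and>
    f_comp 6 4 q =
          - 7 * V6 q + V6 q * t_fun q - 2 * V6 q * t_fun q ^ 2 + 3 * V6 q * T_fun q
          + 2 * V6 q * T_fun q * t_fun q + 2 * V6 q * T_fun q * t_fun q ^ 2 \<and>
    f_comp 6 5 q =
          5 * V6 q + 4 * V6 q * t_fun q + 3 * V6 q * t_fun q ^ 2 + V6 q * T_fun q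
          - 3 * V6 q * T_fun q * t_fun q - 3 * V6 q * T_fun q * t_fun q ^ 2 \<and>
    f_comp 7 1 q =
          141/22 * V7 q / t_fun q + 56/11 * V7 q + 197/22 * V7 q * t_fun q
          + 21/22 * V7 q * t_fun q ^ 2 - 141/22 * V7 q * T_fun q / t_fun q
          - 9/11 * V7 q * T_fun q - 8 * V7 q * T_fun q * t_fun q
          - 21/22 * V7 q * T_fun q * t_fun q ^ 2 + 3/22 * Y7 q \<and>
    f_comp 7 2 q =
          - 46/11 * V7 q / t_fun q - 64/11 * V7 q - 78/11 * V7 q * t_fun q
          - 12/11 * V7 q * t_fun q ^ 2 + 46/11 * V7 q * T_fun q / t_fun q
          - 7/11 * V7 q * T_fun q + 6 * V7 q * T_fun q * t_fun q
          + 12/11 * V7 q * T_fun q * t_fun q ^ 2 + 3/11 * Y7 q \<and>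
    f_comp 7 3 q =
          - 25/11 * V7 q / t_fun q - 19/11 * V7 q + 26/11 * V7 q * t_fun q
          + 4/11 * V7 q * t_fun q ^ 2 + 25/11 * V7 q * T_fun q / t_fun q
          - 38/11 * V7 q * T_fun q - 2 * V7 q * T_fun q * t_fun q
          - 4/11 * V7 q * T_fun q * t_fun q ^ 2 - 1/11 * Y7 q \<and>
    f_comp 7 4 q =
          47/22 * V7 q / t_fun q + 59/11 * V7 q - 15/22 * V7 q * t_fun q
          + 7/22 * V7 q * t_fun q ^ 2 - 47/22 * V7 q * T_fun q / t_fun q
          - 3/11 * V7 q * T_fun q + V7 q * T_fun q * t_fun q
          - 7/22 * V7 q * T_fun q * t_fun q ^ 2 + 1/22 * Y7 q \<and>
    f_comp 7 5 q =
          50/11 * V7 q / t_fun q - 83/11 * V7 q - 52/11 * V7 q * t_fun q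
          - 8/11 * V7 q * t_fun q ^ 2 - 50/11 * V7 q * T_fun q / t_fun q
          + 76/11 * V7 q * T_fun q + 4 * V7 q * T_fun q * t_fun q
          + 8/11 * V7 q * T_fun q * t_fun q ^ 2 + 2/11 * Y7 q \<and>
    f_comp 8 1 q =
          - 2 * V8 q / t_fun q - 21/22 * V8 q + 107/22 * V8 q * t_fun q
          + 79/22 * V8 q * t_fun q ^ 2 - 107/22 * V8 q * T_fun q * t_fun q
          + 2/11 * V8 q * T_fun q * t_fun q ^ 2 + 79/22 * V8 q * T_fun q * t_fun q ^ 3
          - 1/22 * Y8 q \<and>
    f_comp 8 2 q =
          - 4 * V8 q / t_fun q - 120/11 * V8 q - 80/11 * V8 q * t_fun q
          + 2/11 * V8 q * t_fun q ^ 2 - 41/11 * V8 q * T_fun q * t_fun q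
          - 29/11 * V8 q * T_fun q * t_fun q ^ 2 + 2/11 * V8 q * T_fun q * t_fun q ^ 3
          - 1/11 * Y8 q \<and>
    f_comp 8 3 q =
          5 * V8 q / t_fun q + 179/22 * V8 q + 79/22 * V8 q * t_fun q
          - 5/22 * V8 q * t_fun q ^ 2 + 163/22 * V8 q * T_fun q * t_fun q
          + 6/11 * V8 q * T_fun q * t_fun q ^ 2 - 5/22 * V8 q * T_fun q * t_fun q ^ 3
          - 3/22 * Y8 q \<and>
    f_comp 8 4 q =
          - 8 * V8 q / t_fun q - 95/22 * V8 q - 23/22 * V8 q * t_fun q
          - 69/22 * V8 q * t_fun q ^ 2 - 219/22 * V8 q * T_fun q * t_fun q
          - 14/11 * V8 q * T_fun q * t_fun q ^ 2 - 69/22 * V8 q * T_fun q * t_fun q ^ 3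
          + 7/22 * Y8 q \<and>
    f_comp 8 5 q =
          V8 q / t_fun q - 124/11 * V8 q - 123/11 * V8 q * t_fun q
          - 6/11 * V8 q * t_fun q ^ 2 + 2/11 * V8 q * T_fun q * t_fun q
          - 34/11 * V8 q * T_fun q * t_fun q ^ 2 - 6/11 * V8 q * T_fun q * t_fun q ^ 3
          + 3/11 * Y8 q \<and>
    f_comp 9 1 q =
          15/22 * V9 q / t_fun q ^ 2 + 4/11 * V9 q / t_fun q - 5/11 * V9 q
          - 15/22 * V9 q * T_fun q / t_fun q ^ 2 + 7/22 * V9 q * T_fun q / t_fun q
          - 29/11 * V9 q * T_fun q - 1/22 * V9 q * T_fun q * t_fun q - 5/22 * Y9 q \<and>
    f_comp 9 2 q =
          - 3/22 * V9 q / t_fun q ^ 2 - 25/11 * V9 q / t_fun q + 1/11 * V9 q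
          + 3/22 * V9 q * T_fun q / t_fun q ^ 2 + 47/22 * V9 q * T_fun q / t_fun q
          + 30/11 * V9 q * T_fun q + 97/22 * V9 q * T_fun q * t_fun q + 1/22 * Y9 q \<and>
    f_comp 9 3 q =
          - 21/22 * V9 q / t_fun q ^ 2 + 67/11 * V9 q / t_fun q + 7/11 * V9 q
          + 21/22 * V9 q * T_fun q / t_fun q ^ 2 - 155/22 * V9 q * T_fun q / t_fun q
          - 32/11 * V9 q * T_fun q - 47/22 * V9 q * T_fun q * t_fun q + 7/22 * Y9 q \<and>
    f_comp 9 4 q =
          8/11 * V9 q / t_fun q ^ 2 - 28/11 * V9 q / t_fun q + 35/11 * V9 q
          - 8/11 * V9 q * T_fun q / t_fun q ^ 2 + 36/11 * V9 q * T_fun q / t_fun q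
          - 39/11 * V9 q * T_fun q - 57/11 * V9 q * T_fun q * t_fun q + 1/11 * Y9 q \<and>
    f_comp 9 5 q =
          9/22 * V9 q / t_fun q ^ 2 - 46/11 * V9 q / t_fun q - 124/11 * V9 q
          - 9/22 * V9 q * T_fun q / t_fun q ^ 2 + 101/22 * V9 q * T_fun q / t_fun q
          + 31/11 * V9 q * T_fun q - 49/22 * V9 q * T_fun q * t_fun q - 3/22 * Y9 q \<and>
    f_comp 10 1 q =
          75/11 * V10 q + 39/11 * V10 q * t_fun q - 4/11 * V10 q * t_fun q ^ 2
          + 16/11 * V10 q * T_fun q * t_fun q + 14/11 * V10 q * T_fun q * t_fun q ^ 2
          - 4/11 * V10 q * T_fun q * t_fun q ^ 3 + 2/11 * Y10 q \<and>
    f_comp 10 2 q =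
          - 92/11 * V10 q - 43/11 * V10 q * t_fun q - 8/11 * V10 q * t_fun q ^ 2
          + 32/11 * V10 q * T_fun q * t_fun q + 28/11 * V10 q * T_fun q * t_fun q ^ 2
          - 8/11 * V10 q * T_fun q * t_fun q ^ 3 + 4/11 * Y10 q \<and>
    f_comp 10 3 q =
          43/22 * V10 q + 3/22 * V10 q * t_fun q + 9/22 * V10 q * t_fun q ^ 2
          - 157/22 * V10 q * T_fun q * t_fun q - 46/11 * V10 q * T_fun q * t_fun q ^ 2
          + 9/22 * V10 q * T_fun q * t_fun q ^ 3 + 1/22 * Y10 q \<and>
    f_comp 10 4 q =
          - 52/11 * V10 q + 2/11 * V10 q * t_fun q + 6/11 * V10 q * t_fun q ^ 2
          - 24/11 * V10 q * T_fun q * t_fun q - 21/11 * V10 q * T_fun q * t_fun q ^ 2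
          + 6/11 * V10 q * T_fun q * t_fun q ^ 3 - 3/11 * Y10 q \<and>
    f_comp 10 5 q =
          23/11 * V10 q - 80/11 * V10 q * t_fun q + 2/11 * V10 q * t_fun q ^ 2
          + 113/11 * V10 q * T_fun q * t_fun q - 7/11 * V10 q * T_fun q * t_fun q ^ 2
          + 2/11 * V10 q * T_fun q * t_fun q ^ 3 - 1/11 * Y10 q"
proof -
  interpret theta_eleven q by unfold_locales (use assms in auto)
  show ?thesis
    unfolding f_comp_explicit V_eq_mono Y_eq_mono t_fun_eq T_fun_eq cancel_t
    \<comment> \<open>Both sides are now the same combination of \<open>mono\<close> values with
      coefficients in \<open>t\<close> and \<open>T\<close>, up to clearing the denominators 11 and
      22.\<close>
    by (intro conjI; simp add: ppval_def field_simps power_numeral_reduce)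
qed

end
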